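(* Let $p\equiv 3\pmod 4$ be a prime. Let $m$ be a positive odd integer and let $r\ge 2$ be an integer. Then $$G_{(mp^r-1)/2}\equiv p^2\,G_{(mp^{r-2}-1)/2}\pmod{p^{2r-1}}.$$ More precisely, if $M$ is any positive odd integer, then $$G_{(p^2M-1)/2}-p^2\,G_{(M-1)/2}\in p^{2v_p(M)+3}\,\mathbb Z_p .$$
   Context: For integers $n\ge 0$, $G_n=\sum_{k=0}^n 4^k\binom{2n-2k}{n-k}^2\binom{2k}{k}$ (so $G_0,G_1,G_2,\dots=1,12,164,\dots$). $v_p$ denotes the $p$-adic valuation and $\mathbb Z_p$ the ring of $p$-adic integers. *)

theory Defs
  imports "HOL-Computational_Algebra.Primes" "HOL-Number_Theory.Cong" "HOL-Algebra.Ideal"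
begin

definition G :: "nat \<Rightarrow> int" where
  "G n = (\<Sum>k=0..n. 4 ^ k * int ((2*n - 2*k) choose (n - k)) ^ 2 * int ((2*k) choose k))"

text \<open>
  The ring of \<open>p\<close>-adic integers as the inverse limit of the rings of integers modulo \<open>p ^ n\<close>:
  an element is a sequence \<open>x\<close> of canonical residues \<open>x n\<close> modulo \<open>p ^ n\<close>
  that are compatible under reduction.
\<close>

definition padic_int :: "nat \<Rightarrow> (nat \<Rightarrow> int) ring" where
  "padic_int p =
    \<lparr> carrier = {x. \<forall>n. 0 \<le> x n \<and> x n < int p ^ n \<and> x (Suc n) mod int p ^ n = x n},
      mult = (\<lambda>x y n. (x n * y n) mod int p ^ n),
      one = (\<lambda>n. 1 mod int p ^ n),
      zero = (\<lambda>n. 0),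
      add = (\<lambda>x y n. (x n + y n) mod int p ^ n) \<rparr>"

definition padic_of_int :: "nat \<Rightarrow> int \<Rightarrow> nat \<Rightarrow> int" where
  "padic_of_int p a = (\<lambda>n. a mod int p ^ n)"

lemma padic_of_int_closed:
  assumes "p > 0"
  shows "padic_of_int p a \<in> carrier (padic_int p)"
  using assms by (simp add: padic_of_int_def padic_int_def mod_mod_cancel)

lemma padic_of_int_hom:
  "padic_of_int p (a + b) = padic_of_int p a \<oplus>\<^bsub>padic_int p\<^esub> padic_of_int p b"
  "padic_of_int p (a * b) = padic_of_int p a \<otimes>\<^bsub>padic_int p\<^esub> padic_of_int p b"
  "padic_of_int p 1 = \<one>\<^bsub>padic_int p\<^esub>"
  "padic_of_int p 0 = \<zero>\<^bsub>padic_int p\<^esub>"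
  by (auto simp: padic_of_int_def padic_int_def mod_simps)

lemma padic_int_compatible:
  assumes "x \<in> carrier (padic_int p)"
  shows "x (Suc n) mod int p ^ n = x n" "x n mod int p ^ n = x n"
  using assms by (simp_all add: padic_int_def)

lemma cring_padic_int:
  assumes "p > 0"
  shows "cring (padic_int p)"
proof -
  have red: "(u mod int p ^ Suc n) mod int p ^ n = u mod int p ^ n" for u n
    by (simp add: mod_mod_cancel)
  have add: "x \<oplus>\<^bsub>padic_int p\<^esub> y \<in> carrier (padic_int p)"
    if "x \<in> carrier (padic_int p)" "y \<in> carrier (padic_int p)" for x y
  proof -
    have "(x (Suc n) + y (Suc n)) mod int p ^ n = (x n + y n) mod int p ^ n" for n
      by (metis mod_add_eq padic_int_compatible(1) that)
    then show ?thesis using assms red by (simp add: padic_int_def del: power_Suc)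
  qed
  have mult: "x \<otimes>\<^bsub>padic_int p\<^esub> y \<in> carrier (padic_int p)"
    if "x \<in> carrier (padic_int p)" "y \<in> carrier (padic_int p)" for x y
  proof -
    have "(x (Suc n) * y (Suc n)) mod int p ^ n = (x n * y n) mod int p ^ n" for n
      by (metis mod_mult_eq padic_int_compatible(1) that)
    then show ?thesis using assms red by (simp add: padic_int_def del: power_Suc)
  qed
  have neg: "\<exists>y \<in> carrier (padic_int p). y \<oplus>\<^bsub>padic_int p\<^esub> x = \<zero>\<^bsub>padic_int p\<^esub>"
    if "x \<in> carrier (padic_int p)" for x
  proof
    have "(- x (Suc n)) mod int p ^ n = (- x n) mod int p ^ n" for n
      by (metis mod_minus_eq padic_int_compatible(1) that)
    then show "(\<lambda>n. (- x n) mod int p ^ n) \<in> carrier (padic_int p)"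
      using assms red by (simp add: padic_int_def del: power_Suc)
    show "(\<lambda>n. (- x n) mod int p ^ n) \<oplus>\<^bsub>padic_int p\<^esub> x = \<zero>\<^bsub>padic_int p\<^esub>"
      by (simp add: padic_int_def mod_simps)
  qed
  have zero: "\<zero>\<^bsub>padic_int p\<^esub> \<in> carrier (padic_int p)"
    and one: "\<one>\<^bsub>padic_int p\<^esub> \<in> carrier (padic_int p)"
    using padic_of_int_closed[OF assms] padic_of_int_hom(3,4) by metis+
  show ?thesis
  proof (intro cringI abelian_groupI comm_monoidI)
    fix x assume x: "x \<in> carrier (padic_int p)"
    show "\<zero>\<^bsub>padic_int p\<^esub> \<oplus>\<^bsub>padic_int p\<^esub> x = x" "\<one>\<^bsub>padic_int p\<^esub> \<otimes>\<^bsub>padic_int p\<^esub> x = x"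
      using padic_int_compatible(2)[OF x] by (simp_all add: padic_int_def mod_simps)
  qed (use add mult neg zero one in
        \<open>auto simp: padic_int_def mod_simps algebra_simps simp del: power_Suc\<close>)
qed

lemma padic_of_int_mem_power_ideal_iff:
  assumes "p > 0"
  shows "padic_of_int p a \<in> PIdl\<^bsub>padic_int p\<^esub> (padic_of_int p (int p ^ k)) \<longleftrightarrow> int p ^ k dvd a"
proof
  assume "padic_of_int p a \<in> PIdl\<^bsub>padic_int p\<^esub> (padic_of_int p (int p ^ k))"
  then obtain x where "padic_of_int p a = x \<otimes>\<^bsub>padic_int p\<^esub> padic_of_int p (int p ^ k)"
    by (auto simp: cgenideal_def)
  then have "padic_of_int p a k = (x \<otimes>\<^bsub>padic_int p\<^esub> padic_of_int p (int p ^ k)) k"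
    by simp
  then show "int p ^ k dvd a"
    by (simp add: padic_of_int_def padic_int_def mod_eq_0_iff_dvd)
next
  assume "int p ^ k dvd a"
  then obtain b where "a = b * int p ^ k"
    by (metis dvdE mult.commute)
  then show "padic_of_int p a \<in> PIdl\<^bsub>padic_int p\<^esub> (padic_of_int p (int p ^ k))"
    using padic_of_int_closed[OF assms, of b] padic_of_int_hom(2) by (auto simp: cgenideal_def)
qed

end

(*
  Write N = 2n + 1. By Whipple's transformation, G n is 2^(N-2) times the alternating sum w(N) of
  (-1)^j (N - 2j) N! c_j c_(N-j) over 0 <= j <= N, where c_j = (qfac j / j!)^2. The weights are symmetric
  under j -> N - j, so the alternating sum against them kills even functions of Y = N - 2j.

  For p = 3 mod 4 split j by its residue r mod p. In each residue class the weights are the weights of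
  the same kind for N/p (with 1/4 and 3/4 interchanged) times a power of p and a unit, and modulo any power
  of p the unit is a polynomial in Y that is constant modulo p. If r is not 0, the even parts cancel and
  what remains is p (N/p) times a first moment plus p^2 times third moments for N/p. By induction on the
  exponent of p in N, the first moment for N is divisible by N and the third moments essentially by N^2,
  so these classes are negligible. The
  class r = 0, applied twice, leads from N = p^2 M back to M with the factor p^2; the unit which appears
  is constant to the required precision, and is evaluated at j = 0 with Wilson's theorem.
*)
theory Submission
  imports Defs "HOL-Computational_Algebra.Polynomial" "HOL-Number_Theory.Number_Theory"
begin

section \<open>A very-well-poised form of the sequence\<close>

text \<open>Whipple's transformation only supplies the formula; it is verified by showing that both
  sides satisfy one second-order recurrence. Two dissection steps are needed because multiplication
  by p exchanges the classes 1 and 3 modulo 4: one step turns the balanced sums with shift 0 into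
  those with shift 1, and only the next one returns to the original weights. The weights have large
  powers of p in their denominators, so valuations are estimated for whole sums, and the unit
  factors are replaced by polynomials modulo a power of p chosen beyond those denominators. The
  critical precision is 2v + 3, where p^v divides M. In the twofold zero class the third moments are
  only known to be divisible by p^(2v-1), so they must arrive with p^4. The substitution of pY twice
  into the argument and the powers of p of the two dissections together give p^2; the other p^2
  requires the unit to be constant modulo p^2, not just modulo p. Two effects provide this: squaring
  allows l to be paired with p - l inside a block of factors, and the product over a and B - a
  cancels the remaining linear dependence on a.\<close>

text \<open>
  \<open>qfac j\<close> is the product of the positive integers \<open>i \<le> 2 j - 3\<close> with \<open>i \<equiv> 2 j + 1\<close> modulo 4, that is
  a rescaled \<open>\<Gamma>(j/2 + 1/4)\<close>.  Whipple's transformation turns the sum defining \<open>G\<close> into a very-well-poised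
  series in the quantities \<open>(qfac j / j!)\<^sup>2\<close>.
\<close>

fun qfac :: "nat \<Rightarrow> nat" where
  "qfac 0 = 1"
| "qfac (Suc 0) = 1"
| "qfac (Suc (Suc j)) = (2 * j + 1) * qfac j"

definition kap :: "nat \<Rightarrow> nat \<Rightarrow> rat" where
  "kap s j = (of_nat (qfac (j + s)) / fact j)\<^sup>2"

text \<open>
  \<open>ybal\<close> is the distance from the centre of symmetry, so that \<open>altsum s s A\<close> kills even polynomials if \<open>A\<close> is odd.
  The shifts \<open>s\<close>, \<open>t\<close> are forced by the dissection of \<open>qfac\<close> modulo \<open>p\<close>.
\<close>

definition ybal :: "nat \<Rightarrow> nat \<Rightarrow> nat \<Rightarrow> nat \<Rightarrow> int" where
  "ybal s t A a = (int A - int a + int t) - (int a + int s)"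

definition altsum :: "nat \<Rightarrow> nat \<Rightarrow> nat \<Rightarrow> int poly \<Rightarrow> rat" where
  "altsum s t A F = (\<Sum>a\<le>A. (- 1) ^ a * of_int (poly F (ybal s t A a)) * kap s a * kap t (A - a))"

section \<open>The recurrence of the defining sum\<close>

definition cbin :: "nat \<Rightarrow> rat" where
  "cbin m = of_nat ((2 * m) choose m)"

lemma cbin_0 [simp]: "cbin 0 = 1"
  by (simp add: cbin_def)

lemma cbin_Suc: "cbin (Suc m) = 2 * (2 * of_nat m + 1) / (of_nat m + 1) * cbin m"
proof -
  have *: "cbin m = fact (2 * m) / (fact m * fact m)" for m
    by (simp add: cbin_def binomial_fact mult_2)
  have "(fact (2 * Suc m) :: rat) = (2 * of_nat m + 2) * ((2 * of_nat m + 1) * fact (2 * m))"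
    by (simp add: algebra_simps)
  moreover have "(fact (Suc m) :: rat) = (of_nat m + 1) * fact m"
    by simp
  moreover have "(of_nat m + 1 :: rat) \<noteq> 0"
    by (metis of_nat_Suc of_nat_neq_0 add.commute)
  ultimately show ?thesis
    unfolding * by (simp add: divide_simps) (simp add: algebra_simps)
qed

lemma G_cbin: "of_int (G n) = (\<Sum>k\<le>n. 4 ^ k * (cbin (n - k))\<^sup>2 * cbin k)"
proof -
  have "2 * n - 2 * k = 2 * (n - k)" for k by simp
  then show ?thesis
    by (simp add: G_def cbin_def atLeast0AtMost)
qed

text \<open>Middle coefficient shared by the recurrences of \<open>G\<close> and
  \<open>Hsum\<close>; \<open>G_eq_Hsum\<close> rests on this coincidence.\<close>

definition recpol :: "nat \<Rightarrow> rat" where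
  "recpol n = 32 * (of_nat n + 1)\<^sup>2 + 32 * (of_nat n + 1) + 12"

text \<open>\<open>G_cert_poly\<close> and \<open>R_cert_poly\<close> below are the telescoping certificates given by Zeilberger's algorithm.\<close>

lemma G_cert_poly:
  fixes k m :: rat
  defines "n \<equiv> k + m"
  defines "y \<equiv> \<lambda>k. 16 + 24 * n + 8 * n\<^sup>2 + 4 * k - 8 * k\<^sup>2"
  shows "(n + 2)\<^sup>2 * (4 * (2 * m + 1) * (2 * m + 3))\<^sup>2
      - (32 * (n + 1)\<^sup>2 + 32 * (n + 1) + 12) * (2 * (2 * m + 1) * (m + 2))\<^sup>2
      + 256 * (n + 1)\<^sup>2 * ((m + 1) * (m + 2))\<^sup>2
      = 8 * (2 * k + 1) * (m + 2)\<^sup>2 * y (k + 1) - k * (2 * (2 * m + 1))\<^sup>2 * y k"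
  unfolding n_def y_def by Groebner_Basis.algebra

lemma of_nat_Suc_nonzero [simp]: "1 + of_nat n \<noteq> (0 :: rat)" "of_nat n + 1 \<noteq> (0 :: rat)"
  by (metis of_nat_Suc of_nat_neq_0) (metis add.commute of_nat_Suc of_nat_neq_0)

text \<open>Boundary bookkeeping for \<open>G_rec\<close>: \<open>X\<close>, \<open>Y\<close>,
  \<open>Z\<close> are the sums over the common range \<open>k \<le> n\<close> for the indices n +
  2, n + 1, n, \<open>S\<close> is their telescoped combination, and the terms with \<open>c\<close>
  and \<open>c'\<close> are the summands k = n + 1 and k = n + 2 outside that range.\<close>

lemma G_rec_combine:
  fixes n S X Y Z p c c' G1 G2 R :: rat
  assumes "S = 4 * p * c * (12 * (n + 1)\<^sup>2)" "S = (n + 2)\<^sup>2 * X - R * Y + 256 * (n + 1)\<^sup>2 * Z"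
    "G2 = X + 4 * p * 2\<^sup>2 * c + 16 * p * c'" "G1 = Y + 4 * p * c"
    "(n + 2)\<^sup>2 * c' = 2 * (2 * n + 3) * (n + 2) * c" "R = 32 * (n + 1)\<^sup>2 + 32 * (n + 1) + 12"
  shows "(n + 2)\<^sup>2 * G2 = R * G1 - 256 * (n + 1)\<^sup>2 * Z"
  using assms by Groebner_Basis.algebra

lemma G_rec:
  "(of_nat n + 2)\<^sup>2 * rat_of_int (G (n + 2)) =
     recpol n * of_int (G (n + 1)) - 256 * (of_nat n + 1)\<^sup>2 * of_int (G n)"
proof -
  let ?n = "of_nat n :: rat"
  define y where "y k = 16 + 24 * ?n + 8 * ?n\<^sup>2 + 4 * k - 8 * k\<^sup>2" for k
  \<comment> \<open>The certificate. Its factor \<open>of_nat k\<close> vanishes at k = 0, so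
    telescoping leaves only the upper boundary.\<close>
  define C where "C k = 4 ^ k * cbin k * of_nat k * (cbin (n + 1 - k) / (of_nat (n + 1 - k) + 1))\<^sup>2 * y (of_nat k)" for k
  define S where "S k = 4 ^ k * cbin k * ((?n + 2)\<^sup>2 * (cbin (n + 2 - k))\<^sup>2 - recpol n * (cbin (n + 1 - k))\<^sup>2
    + 256 * (?n + 1)\<^sup>2 * (cbin (n - k))\<^sup>2)" for k
  have S: "S k = C (Suc k) - C k" if "k \<le> n" for k
  proof -
    define m where "m = n - k"
    have n: "n = k + m" and nn: "?n = of_nat k + of_nat m"
      using that by (simp_all add: m_def)
    let ?k = "of_nat k :: rat" and ?m = "of_nat m :: rat"
    \<comment> \<open>Common factor of three consecutive values of \<open>cbin\<close>. Dividing by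
      it turns the telescoping claim into the polynomial identity
      \<open>G_cert_poly\<close>.\<close>
    define v where "v = cbin m / ((?m + 1) * (?m + 2))"
    have nz: "?m + 1 \<noteq> 0" "?m + 2 \<noteq> 0" "?k + 1 \<noteq> 0"
      using of_nat_Suc_nonzero(2)[of m] of_nat_Suc_nonzero(2)[of "Suc m"] of_nat_Suc_nonzero(2)[of k]
      by (simp_all add: add.commute)
    have cancel: "a / d * (b * d * c) = a * b * c" if "d \<noteq> 0" for a b c d :: rat
      using that by simp
    have c0: "cbin m = (?m + 1) * (?m + 2) * v"
      using nz by (simp add: v_def)
    have c1: "cbin (Suc m) = 2 * (2 * ?m + 1) * (?m + 2) * v"
      unfolding cbin_Suc v_def using nz by (simp add: divide_simps)
    have "cbin (Suc (Suc m)) = 2 * (2 * ?m + 3) / (?m + 2) * cbin (Suc m)"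
      by (subst cbin_Suc) (simp add: algebra_simps)
    also have "\<dots> = 2 * (2 * ?m + 3) * (2 * (2 * ?m + 1)) * v"
      unfolding c1 by (rule cancel) (rule nz)
    also have "\<dots> = 4 * (2 * ?m + 1) * (2 * ?m + 3) * v"
      by Groebner_Basis.algebra
    finally have c2: "cbin (Suc (Suc m)) = 4 * (2 * ?m + 1) * (2 * ?m + 3) * v" .
    have k1: "cbin (Suc k) * (?k + 1) = 2 * (2 * ?k + 1) * cbin k"
      unfolding cbin_Suc using nz by (simp add: divide_simps)
    have "C (Suc k) = 4 ^ Suc k * (cbin (Suc k) * (?k + 1)) * (cbin m / (?m + 1))\<^sup>2 * y (?k + 1)"
      by (simp add: C_def n add.commute mult_ac)
    also have "cbin m / (?m + 1) = (?m + 2) * v"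
      unfolding c0 using nz by simp
    finally have C1: "C (Suc k) = 4 ^ k * cbin k * v\<^sup>2 * (8 * (2 * ?k + 1) * (?m + 2)\<^sup>2 * y (?k + 1))"
      unfolding k1 by (simp add: power_mult_distrib mult_ac)
    have "C k = 4 ^ k * cbin k * ?k * (cbin (Suc m) / (?m + 2))\<^sup>2 * y ?k"
      by (simp add: C_def n add.commute mult_ac)
    also have "cbin (Suc m) / (?m + 2) = 2 * (2 * ?m + 1) * v"
      unfolding c1 using nz by simp
    finally have C0: "C k = 4 ^ k * cbin k * v\<^sup>2 * (?k * (2 * (2 * ?m + 1))\<^sup>2 * y ?k)"
      by (simp add: power_mult_distrib mult_ac)
    have "S k = 4 ^ k * cbin k * ((?n + 2)\<^sup>2 * (cbin (Suc (Suc m)))\<^sup>2 - recpol n * (cbin (Suc m))\<^sup>2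
      + 256 * (?n + 1)\<^sup>2 * (cbin m)\<^sup>2)"
      by (simp add: S_def n)
    also have "\<dots> = 4 ^ k * cbin k * v\<^sup>2 * ((?n + 2)\<^sup>2 * (4 * (2 * ?m + 1) * (2 * ?m + 3))\<^sup>2
      - recpol n * (2 * (2 * ?m + 1) * (?m + 2))\<^sup>2
      + 256 * (?n + 1)\<^sup>2 * ((?m + 1) * (?m + 2))\<^sup>2)"
      unfolding c0 c1 c2 power_mult_distrib by (simp only: ring_distribs mult_ac)
    also have "\<dots> = 4 ^ k * cbin k * v\<^sup>2 * (8 * (2 * ?k + 1) * (?m + 2)\<^sup>2 * y (?k + 1) - ?k * (2 * (2 * ?m + 1))\<^sup>2 * y ?k)"
      unfolding recpol_def y_def nn using G_cert_poly[of ?k ?m] by simp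
    also have "\<dots> = C (Suc k) - C k"
      unfolding C0 C1 by (simp add: right_diff_distrib)
    finally show ?thesis .
  qed
  have tele: "(\<Sum>k\<le>n. C (Suc k) - C k) = C (Suc n) - C 0"
    by (simp add: lessThan_Suc_atMost[symmetric] sum_lessThan_telescope)
  have "(\<Sum>k\<le>n. S k) = C (Suc n)"
    using tele S by (simp add: C_def)
  moreover have "C (Suc n) = 4 ^ Suc n * cbin (Suc n) * (12 * (?n + 1)\<^sup>2)"
    by (simp add: C_def y_def algebra_simps power2_eq_square)
  moreover have "(\<Sum>k\<le>n. S k) = (?n + 2)\<^sup>2 * (\<Sum>k\<le>n. 4 ^ k * (cbin (n + 2 - k))\<^sup>2 * cbin k)
     - recpol n * (\<Sum>k\<le>n. 4 ^ k * (cbin (n + 1 - k))\<^sup>2 * cbin k)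
     + 256 * (?n + 1)\<^sup>2 * (\<Sum>k\<le>n. 4 ^ k * (cbin (n - k))\<^sup>2 * cbin k)"
    by (simp add: S_def sum_distrib_left sum_subtractf sum.distrib algebra_simps)
  moreover have "rat_of_int (G (n + 2)) = (\<Sum>k\<le>n. 4 ^ k * (cbin (n + 2 - k))\<^sup>2 * cbin k)
      + 4 ^ Suc n * (cbin 1)\<^sup>2 * cbin (Suc n) + 4 ^ Suc (Suc n) * cbin (Suc (Suc n))"
    by (simp add: G_cbin)
  moreover have "rat_of_int (G (n + 1)) = (\<Sum>k\<le>n. 4 ^ k * (cbin (n + 1 - k))\<^sup>2 * cbin k)
      + 4 ^ Suc n * cbin (Suc n)"
    by (simp add: G_cbin)
  moreover have "cbin 1 = 2"
    using cbin_Suc[of 0] by simp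
  moreover have "(?n + 2)\<^sup>2 * cbin (Suc (Suc n)) = 2 * (2 * ?n + 3) * (?n + 2) * cbin (Suc n)"
  proof -
    have "?n + 2 \<noteq> 0" using of_nat_Suc_nonzero(2)[of "Suc n"] by (simp add: add.commute)
    moreover have "cbin (Suc (Suc n)) = 2 * (2 * ?n + 3) / (?n + 2) * cbin (Suc n)"
      by (subst cbin_Suc) (simp add: algebra_simps)
    ultimately show ?thesis by (simp add: power2_eq_square)
  qed
  ultimately show ?thesis
    unfolding G_cbin[of n]
    by (intro G_rec_combine[where S = "\<Sum>k\<le>n. S k" and p = "4 ^ n" and c = "cbin (Suc n)"
        and c' = "cbin (Suc (Suc n))" and X = "\<Sum>k\<le>n. 4 ^ k * (cbin (n + 2 - k))\<^sup>2 * cbin k"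
        and Y = "\<Sum>k\<le>n. 4 ^ k * (cbin (n + 1 - k))\<^sup>2 * cbin k"])
      (simp_all add: recpol_def)
qed

section \<open>The same recurrence for the well-poised sum\<close>

definition qeven :: "nat \<Rightarrow> rat" where "qeven k = of_nat (qfac (2 * k)) / fact (2 * k)"
definition qodd :: "nat \<Rightarrow> rat" where "qodd k = of_nat (qfac (2 * k + 1)) / fact (2 * k + 1)"

lemma qeven_Suc: "qeven (Suc k) = (4 * of_nat k + 1) / ((2 * of_nat k + 1) * (2 * of_nat k + 2)) * qeven k"
  by (simp add: qeven_def field_simps)

lemma qodd_Suc: "qodd (Suc k) = (4 * of_nat k + 3) / ((2 * of_nat k + 2) * (2 * of_nat k + 3)) * qodd k"
  by (simp add: qodd_def field_simps)

text \<open>The part of the alternating sum for N = 2n + 1 with even index j = 2k, so that the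
  weight is N - 2j. The odd indices contribute the same amount, see
  \<open>altsum_Hsum\<close>.\<close>

definition Hsum :: "nat \<Rightarrow> rat" where
  "Hsum n = (\<Sum>k\<le>n. (2 * of_nat n + 1 - 4 * of_nat k) * (qeven k)\<^sup>2 * (qodd (n - k))\<^sup>2)"

lemma R_cert_poly:
  fixes k m :: rat
  defines "n \<equiv> k + m"
  defines "y \<equiv> \<lambda>k. (1454 + 3243 * n + 2666 * n^2 + 960 * n^3 + 128 * n^4)
     + (- 2410 - 3988 * n - 2160 * n^2 - 384 * n^3) * k
     + (1420 + 1552 * n + 416 * n^2) * k^2 + (- 352 - 192 * n) * k^3 + 32 * k^4"
  shows "(n + 2)\<^sup>2 * (2 * (2 * n + 3) * (2 * n + 4) * (2 * n + 5)) * (2 * n + 5 - 4 * k) * ((4 * m + 3) * (4 * m + 7))\<^sup>2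
      - (32 * (n + 1)\<^sup>2 + 32 * (n + 1) + 12) * ((n + 3 / 2)) * (2 * n + 3 - 4 * k) * ((4 * m + 3) * (2 * m + 4) * (2 * m + 5))\<^sup>2
      + 16 * (n + 1) * (2 * n + 1 - 4 * k) * ((2 * m + 2) * (2 * m + 3) * (2 * m + 4) * (2 * m + 5))\<^sup>2
      = ((4 * k + 1) * (2 * m + 4) * (2 * m + 5))\<^sup>2 * y (k + 1) - ((4 * m + 3) * (2 * k) * (2 * k - 1))\<^sup>2 * y k"
  unfolding n_def y_def by Groebner_Basis.algebra

text \<open>This is the recurrence \<open>G_rec\<close> for
  \<open>4 ^ n * fact (2 * n + 1) * Hsum n\<close>, divided by 16 (n + 1) and the common
  normalisation; hence the additional linear factors.\<close>

lemma Hsum_rec: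
  "(of_nat n + 2)\<^sup>2 * (2 * (2 * of_nat n + 3) * (2 * of_nat n + 4) * (2 * of_nat n + 5)) * Hsum (n + 2) =
     recpol n * (of_nat n + 3 / 2) * Hsum (n + 1) - 16 * (of_nat n + 1) * Hsum n"
proof -
  let ?n = "of_nat n :: rat"
  let ?a = "(?n + 2)\<^sup>2 * (2 * (2 * ?n + 3) * (2 * ?n + 4) * (2 * ?n + 5))"
  let ?b = "recpol n * (?n + 3 / 2)"
  let ?c = "16 * (?n + 1)"
  define y where "y k = (1454 + 3243 * ?n + 2666 * ?n^2 + 960 * ?n^3 + 128 * ?n^4)
     + (- 2410 - 3988 * ?n - 2160 * ?n^2 - 384 * ?n^3) * k
     + (1420 + 1552 * ?n + 416 * ?n^2) * k^2 + (- 352 - 192 * ?n) * k^3 + 32 * k^4" for k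
  \<comment> \<open>The factor \<open>2 * of_nat k * (2 * of_nat k - 1)\<close> kills the lower
    boundary and at k + 1 cancels the denominator of \<open>qeven_Suc\<close>.\<close>
  define C where "C k = (qeven k)\<^sup>2 * (qodd (n + 1 - k) / ((2 * of_nat (n + 1 - k) + 2) * (2 * of_nat (n + 1 - k) + 3)))\<^sup>2
       * (2 * of_nat k * (2 * of_nat k - 1))\<^sup>2 * y (of_nat k)" for k
  define S where "S k = (qeven k)\<^sup>2 * (?a * (2 * ?n + 5 - 4 * of_nat k) * (qodd (n + 2 - k))\<^sup>2
       - ?b * (2 * ?n + 3 - 4 * of_nat k) * (qodd (n + 1 - k))\<^sup>2
       + ?c * (2 * ?n + 1 - 4 * of_nat k) * (qodd (n - k))\<^sup>2)" for k
  have pos: "2 * rat_of_nat m + 1 > 0" "2 * rat_of_nat m + 2 > 0" "2 * rat_of_nat m + 3 > 0" "2 * rat_of_nat m + 4 > 0" "2 * rat_of_nat m + 5 > 0" for m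
    by (rule add_nonneg_pos; simp)+
  have nz: "2 * rat_of_nat m + 1 \<noteq> 0" "2 * rat_of_nat m + 2 \<noteq> 0" "2 * rat_of_nat m + 3 \<noteq> 0" "2 * rat_of_nat m + 4 \<noteq> 0" "2 * rat_of_nat m + 5 \<noteq> 0" for m
    using pos[of m] by simp_all
  have S: "S k = C (Suc k) - C k" if "k \<le> n" for k
  proof -
    define m where "m = n - k"
    have n: "n = k + m" and nn: "?n = of_nat k + of_nat m"
      using that by (simp_all add: m_def)
    let ?k = "of_nat k :: rat" and ?m = "of_nat m :: rat"
    \<comment> \<open>Common factor of three consecutive values of \<open>qodd\<close>, which
      reduces the claim to \<open>R_cert_poly\<close>.\<close>
    define x where "x = qodd m / ((2 * ?m + 2) * (2 * ?m + 3) * (2 * ?m + 4) * (2 * ?m + 5))"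
    have r0: "qodd m = (2 * ?m + 2) * (2 * ?m + 3) * (2 * ?m + 4) * (2 * ?m + 5) * x"
      using nz[of m] by (simp add: x_def)
    have r1: "qodd (Suc m) = (4 * ?m + 3) * (2 * ?m + 4) * (2 * ?m + 5) * x"
      unfolding qodd_Suc r0 using nz[of m] by simp
    have "qodd (Suc (Suc m)) = (4 * ?m + 7) / ((2 * ?m + 4) * (2 * ?m + 5)) * qodd (Suc m)"
      by (subst qodd_Suc) (simp add: algebra_simps)
    also have "\<dots> = (4 * ?m + 3) * (4 * ?m + 7) * x"
      unfolding r1 using nz[of m] by simp
    finally have r2: "qodd (Suc (Suc m)) = (4 * ?m + 3) * (4 * ?m + 7) * x" .
    have p1: "qeven (Suc k) * (2 * (?k + 1) * (2 * (?k + 1) - 1)) = (4 * ?k + 1) * qeven k"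
    proof -
      have "2 * (?k + 1) * (2 * (?k + 1) - 1) = (2 * ?k + 1) * (2 * ?k + 2)"
        by (simp add: algebra_simps)
      moreover have "a / d * c * d = a * c" if "d \<noteq> 0" for a c d :: rat
        using that by simp
      moreover have "(2 * ?k + 1) * (2 * ?k + 2) \<noteq> 0"
        using nz[of k] by simp
      ultimately show ?thesis
        unfolding qeven_Suc by metis
    qed
    have "C (Suc k) = (qeven (Suc k) * (2 * (?k + 1) * (2 * (?k + 1) - 1)))\<^sup>2
        * (qodd m / ((2 * ?m + 2) * (2 * ?m + 3)))\<^sup>2 * y (?k + 1)"
      by (simp add: C_def n add.commute power_mult_distrib mult_ac)
    also have "qodd m / ((2 * ?m + 2) * (2 * ?m + 3)) = (2 * ?m + 4) * (2 * ?m + 5) * x"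
      unfolding r0 using nz[of m] by simp
    finally have C1: "C (Suc k) = (qeven k)\<^sup>2 * x\<^sup>2 * (((4 * ?k + 1) * (2 * ?m + 4) * (2 * ?m + 5))\<^sup>2 * y (?k + 1))"
      unfolding p1 by (simp add: power_mult_distrib mult_ac)
    have "C k = (qeven k)\<^sup>2 * (qodd (Suc m) / ((2 * ?m + 4) * (2 * ?m + 5)))\<^sup>2 * (2 * ?k * (2 * ?k - 1))\<^sup>2 * y ?k"
      by (simp add: C_def n add.commute mult_ac)
    also have "qodd (Suc m) / ((2 * ?m + 4) * (2 * ?m + 5)) = (4 * ?m + 3) * x"
      unfolding r1 using nz[of m] by simp
    finally have C0: "C k = (qeven k)\<^sup>2 * x\<^sup>2 * (((4 * ?m + 3) * (2 * ?k) * (2 * ?k - 1))\<^sup>2 * y ?k)"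
      by Groebner_Basis.algebra
    have "S k = (qeven k)\<^sup>2 * (?a * (2 * ?n + 5 - 4 * of_nat k) * (qodd (Suc (Suc m)))\<^sup>2
       - ?b * (2 * ?n + 3 - 4 * of_nat k) * (qodd (Suc m))\<^sup>2
       + ?c * (2 * ?n + 1 - 4 * of_nat k) * (qodd m)\<^sup>2)"
      by (simp add: S_def n)
    also have "\<dots> = (qeven k)\<^sup>2 * x\<^sup>2 * (?a * (2 * ?n + 5 - 4 * of_nat k) * ((4 * ?m + 3) * (4 * ?m + 7))\<^sup>2
       - ?b * (2 * ?n + 3 - 4 * of_nat k) * ((4 * ?m + 3) * (2 * ?m + 4) * (2 * ?m + 5))\<^sup>2
       + ?c * (2 * ?n + 1 - 4 * of_nat k) * ((2 * ?m + 2) * (2 * ?m + 3) * (2 * ?m + 4) * (2 * ?m + 5))\<^sup>2)"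
      unfolding r0 r1 r2 by Groebner_Basis.algebra
    also have "\<dots> = (qeven k)\<^sup>2 * x\<^sup>2 * (((4 * ?k + 1) * (2 * ?m + 4) * (2 * ?m + 5))\<^sup>2 * y (?k + 1)
       - ((4 * ?m + 3) * (2 * ?k) * (2 * ?k - 1))\<^sup>2 * y ?k)"
      unfolding recpol_def y_def nn R_cert_poly[of ?k ?m] ..
    also have "\<dots> = C (Suc k) - C k"
      unfolding C0 C1 by (simp add: right_diff_distrib)
    finally show ?thesis .
  qed
  have tele: "(\<Sum>k\<le>n. C (Suc k) - C k) = C (Suc n) - C 0"
    by (simp add: lessThan_Suc_atMost[symmetric] sum_lessThan_telescope)
  have "(\<Sum>k\<le>n. S k) = C (Suc n)"
    using tele S by (simp add: C_def)
  moreover have "C (Suc n) = (qeven (Suc n))\<^sup>2 * ((?n + 1) * (2 * ?n + 1))\<^sup>2 / 9 * y (?n + 1)"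
    by (simp add: C_def qodd_def power2_eq_square field_simps)
  moreover have "(\<Sum>k\<le>n. S k) = ?a * (\<Sum>k\<le>n. (2 * ?n + 5 - 4 * of_nat k) * (qeven k)\<^sup>2 * (qodd (n + 2 - k))\<^sup>2)
     - ?b * (\<Sum>k\<le>n. (2 * ?n + 3 - 4 * of_nat k) * (qeven k)\<^sup>2 * (qodd (n + 1 - k))\<^sup>2)
     + ?c * Hsum n"
    unfolding S_def Hsum_def sum_distrib_left sum_subtractf[symmetric] sum.distrib[symmetric]
    by (rule sum.cong) (auto simp: algebra_simps)
  moreover have r01: "qodd 0 = 1" "qodd (Suc 0) = 1 / 2"
    by (simp_all add: qodd_def numeral_eq_Suc)
  moreover have "Hsum (n + 2) = (\<Sum>k\<le>n. (2 * ?n + 5 - 4 * of_nat k) * (qeven k)\<^sup>2 * (qodd (n + 2 - k))\<^sup>2)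
      + (1 - 2 * ?n) * (qeven (Suc n))\<^sup>2 / 4 + (- 3 - 2 * ?n) * (qeven (Suc (Suc n)))\<^sup>2"
    by (simp add: Hsum_def r01 power_divide) (simp add: algebra_simps)
  moreover have "Hsum (n + 1) = (\<Sum>k\<le>n. (2 * ?n + 3 - 4 * of_nat k) * (qeven k)\<^sup>2 * (qodd (n + 1 - k))\<^sup>2)
      + (- 1 - 2 * ?n) * (qeven (Suc n))\<^sup>2"
    by (simp add: Hsum_def r01) (simp add: algebra_simps)
  moreover have "(2 * ?n + 3) * (2 * ?n + 4) * qeven (Suc (Suc n)) = (4 * ?n + 5) * qeven (Suc n)"
  proof -
    have "qeven (Suc (Suc n)) = (4 * ?n + 5) / ((2 * ?n + 3) * (2 * ?n + 4)) * qeven (Suc n)"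
      by (subst qeven_Suc) (simp add: algebra_simps)
    then show ?thesis using nz[of n] by simp
  qed
  ultimately show ?thesis
    unfolding recpol_def y_def by Groebner_Basis.algebra
qed

text \<open>Both sides satisfy the same second-order recurrence with nonzero leading coefficient and
  agree for n = 0 and n = 1.\<close>

lemma G_eq_Hsum: "rat_of_int (G n) = 4 ^ n * fact (2 * n + 1) * Hsum n"
proof (induction n rule: less_induct)
  case (less n)
  consider "n = 0" | "n = 1" | k where "n = k + 2"
    by (metis One_nat_def Suc_1 add.commute less_2_cases_iff not_less le_Suc_ex)
  then show ?case
  proof cases
    case 1
    then show ?thesis by (simp add: G_def Hsum_def qeven_def qodd_def)
  next
    case 2
    then show ?thesis
      by (simp add: G_def Hsum_def qeven_def qodd_def power2_eq_square numeral_eq_Suc)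
  next
    case (3 k)
    let ?k = "of_nat k :: rat"
    have IH0: "rat_of_int (G k) = 4 ^ k * fact (2 * k + 1) * Hsum k"
      and IH1: "rat_of_int (G (k + 1)) = 4 ^ (k + 1) * fact (2 * (k + 1) + 1) * Hsum (k + 1)"
      using less 3 by simp_all
    have f1: "(fact (2 * (k + 1) + 1) :: rat) = (2 * ?k + 2) * (2 * ?k + 3) * fact (2 * k + 1)"
      by (simp add: algebra_simps)
    have f2: "(fact (2 * (k + 2) + 1) :: rat) = (2 * ?k + 4) * (2 * ?k + 5) * fact (2 * (k + 1) + 1)"
      by (simp add: algebra_simps numeral_2_eq_2)
    have "(?k + 2)\<^sup>2 \<noteq> 0"
      using of_nat_Suc_nonzero(2)[of "Suc k"] by (simp add: add.commute)
    moreover have "(?k + 2)\<^sup>2 * rat_of_int (G (k + 2)) =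
       (?k + 2)\<^sup>2 * (4 ^ (k + 2) * fact (2 * (k + 2) + 1) * Hsum (k + 2))"
    proof -
      let ?f = "fact (2 * k + 1) :: rat" and ?p = "4 ^ k :: rat"
      have "(?k + 2)\<^sup>2 * (4 ^ (k + 2) * fact (2 * (k + 2) + 1) * Hsum (k + 2))
        = 16 * ?p * ?f * (?k + 1) * ((?k + 2)\<^sup>2 * (2 * (2 * ?k + 3) * (2 * ?k + 4) * (2 * ?k + 5)) * Hsum (k + 2))"
        unfolding f2 f1 power_add by Groebner_Basis.algebra
      also have "\<dots> = recpol k * (4 ^ (k + 1) * fact (2 * (k + 1) + 1) * Hsum (k + 1))
           - 256 * (?k + 1)\<^sup>2 * (?p * ?f * Hsum k)"
        unfolding Hsum_rec f1 power_add power_one_right by Groebner_Basis.algebra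
      also have "\<dots> = (?k + 2)\<^sup>2 * rat_of_int (G (k + 2))"
        unfolding G_rec IH0 IH1 ..
      finally show ?thesis ..
    qed
    ultimately show ?thesis
      using 3 by simp
  qed
qed

section \<open>Divisibility by powers of a prime and finite differences\<close>

locale prime3 =
  fixes p :: nat
  assumes prime_p: "prime p" and mod4: "p mod 4 = 3"
begin

lemma p_gt_2: "p > 2"
  using mod4 by (cases "p \<le> 2") (auto simp: le_Suc_eq numeral_2_eq_2)

lemma p_pos [simp]: "p > 0"
  using p_gt_2 by simp

lemma p_odd: "odd p"
  using prime_p p_gt_2 prime_odd_nat by blast

lemma prime_int_p: "prime (int p)"
  using prime_p by simp

text \<open>\<open>pdv k x\<close> says that the \<open>p\<close>-adic valuation of \<open>x\<close> is at least \<open>k\<close>.\<close>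

definition pdv :: "int \<Rightarrow> rat \<Rightarrow> bool" where
  "pdv k x \<longleftrightarrow> (\<exists>a b. \<not> int p dvd b \<and> x = of_nat p powi k * (of_int a / of_int b))"

lemma pdvI: "\<not> int p dvd b \<Longrightarrow> x = of_nat p powi k * (of_int a / of_int b) \<Longrightarrow> pdv k x"
  by (auto simp: pdv_def)

lemma not_dvd_nonzero: "\<not> int p dvd b \<Longrightarrow> b \<noteq> 0"
  by auto

lemma p_not_dvd_mult: "\<not> int p dvd a \<Longrightarrow> \<not> int p dvd b \<Longrightarrow> \<not> int p dvd a * b"
  using prime_int_p by (simp add: prime_dvd_mult_iff)

lemma p_not_dvd_power: "\<not> int p dvd a \<Longrightarrow> \<not> int p dvd a ^ n"
  using prime_int_p prime_dvd_power by blast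

lemma p_not_dvd_prod: "(\<And>x. x \<in> S \<Longrightarrow> \<not> int p dvd f x) \<Longrightarrow> \<not> int p dvd (\<Prod>x\<in>S. f x)"
  using prime_int_p not_prime_unit by (induction S rule: infinite_finite_induct) (auto simp: prime_dvd_mult_iff)

lemma p_not_dvd_1: "\<not> int p dvd 1"
  using prime_int_p not_prime_unit by blast

lemma coprime_p_power: "\<not> int p dvd a \<Longrightarrow> coprime a (int p ^ k)"
  using prime_int_p by (metis coprime_commute coprime_power_left_iff prime_imp_coprime)

lemma pdv_0 [simp]: "pdv k 0"
  by (rule pdvI[OF p_not_dvd_1, where a = 0]) simp

lemma pdv_mult: "pdv k x \<Longrightarrow> pdv l y \<Longrightarrow> pdv (k + l) (x * y)"
proof -
  assume "pdv k x" "pdv l y"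
  then obtain a b c d where *: "\<not> int p dvd b" "\<not> int p dvd d"
    "x = of_nat p powi k * (of_int a / of_int b)" "y = of_nat p powi l * (of_int c / of_int d)"
    unfolding pdv_def by blast
  show ?thesis
    by (rule pdvI[OF p_not_dvd_mult[OF *(1,2)], where a = "a * c"]) (simp add: * power_int_add)
qed

lemma pdv_minus: "pdv k x \<Longrightarrow> pdv k (- x)"
  unfolding pdv_def by (metis minus_divide_left mult_minus_right of_int_minus)

lemma pdv_add: "pdv k x \<Longrightarrow> pdv k y \<Longrightarrow> pdv k (x + y)"
proof -
  assume "pdv k x" "pdv k y"
  then obtain a b c d where *: "\<not> int p dvd b" "\<not> int p dvd d"
    "x = of_nat p powi k * (of_int a / of_int b)" "y = of_nat p powi k * (of_int c / of_int d)"
    unfolding pdv_def by blast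
  have "b \<noteq> 0" "d \<noteq> 0" using * by auto
  then show ?thesis
    by (intro pdvI[OF p_not_dvd_mult[OF *(1,2)], where a = "a * d + c * b"]) (simp add: * field_simps)
qed

lemma pdv_sum: "(\<And>i. i \<in> S \<Longrightarrow> pdv k (f i)) \<Longrightarrow> pdv k (\<Sum>i\<in>S. f i)"
  by (induction S rule: infinite_finite_induct) (auto intro: pdv_add)

lemma pdv_powi: "pdv k (of_nat p powi k)"
  by (rule pdvI[OF p_not_dvd_1, where a = 1]) simp

lemma pdv_of_int: "pdv 0 (of_int a)"
  by (rule pdvI[OF p_not_dvd_1, where a = a]) simp

lemma pdv_of_nat: "pdv 0 (of_nat a)"
  using pdv_of_int[of "int a"] by simp

lemma pdv_unit: "\<not> int p dvd b \<Longrightarrow> pdv 0 (of_int a / of_int b)"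
  by (rule pdvI) simp_all

lemma pdv_mono: "pdv k x \<Longrightarrow> l \<le> k \<Longrightarrow> pdv l x"
proof -
  assume "pdv k x" "l \<le> k"
  then obtain a b where *: "\<not> int p dvd b" "x = of_nat p powi k * (of_int a / of_int b)"
    unfolding pdv_def by blast
  have "(of_nat p :: rat) powi k = of_nat p powi l * of_nat p powi (k - l)"
    by (simp flip: power_int_add)
  also have "(of_nat p :: rat) powi (k - l) = of_int (int p ^ nat (k - l))"
    using \<open>l \<le> k\<close> by (simp add: power_int_def)
  finally show ?thesis
    by (intro pdvI[OF *(1), where a = "int p ^ nat (k - l) * a"]) (simp add: *(2))
qed

lemma pdv_power_mult: "pdv l x \<Longrightarrow> pdv (int k + l) (of_nat p ^ k * x)"
  using pdv_mult[OF pdv_powi[of "int k"]] by simp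

lemma pdv_unit_mult_iff: "\<not> int p dvd b \<Longrightarrow> pdv k (of_int b * x) \<longleftrightarrow> pdv k x"
proof
  assume b: "\<not> int p dvd b" and "pdv k (of_int b * x)"
  then have "pdv (0 + k) ((of_int 1 / of_int b) * (of_int b * x))"
    by (intro pdv_mult pdv_unit)
  then show "pdv k x" using not_dvd_nonzero[OF b] by simp
next
  assume "\<not> int p dvd b" "pdv k x"
  then show "pdv k (of_int b * x)" using pdv_mult[OF pdv_of_int] by fastforce
qed

lemma pdv_of_int_iff: "pdv (int k) (of_int a) \<longleftrightarrow> int p ^ k dvd a"
proof
  assume "pdv (int k) (of_int a)"
  then obtain c b where *: "\<not> int p dvd b" "of_int a = of_nat p powi int k * (of_int c / of_int b :: rat)"
    unfolding pdv_def by blast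
  then have "(of_int (a * b) :: rat) = of_int (int p ^ k * c)"
    using not_dvd_nonzero[OF *(1)] by simp
  then have "a * b = int p ^ k * c"
    by (simp only: of_int_eq_iff)
  then have "int p ^ k dvd a * b" by simp
  then show "int p ^ k dvd a"
    using coprime_p_power[OF *(1)] by (metis coprime_commute coprime_dvd_mult_left_iff)
next
  assume "int p ^ k dvd a"
  then obtain c where "a = int p ^ k * c" by auto
  then show "pdv (int k) (of_int a)"
    by (intro pdvI[OF p_not_dvd_1, where a = c]) simp
qed

lemma pdv_dvd: "int p ^ k dvd a \<Longrightarrow> pdv l x \<Longrightarrow> pdv (int k + l) (of_int a * x)"
  by (intro pdv_mult) (simp_all add: pdv_of_int_iff)

lemma pdv_int_mult: "pdv l x \<Longrightarrow> pdv l (of_int a * x)"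
  using pdv_mult[OF pdv_of_int, of l x a] by simp

lemma pdv_exists: "\<exists>B::nat. pdv (- int B) x"
proof -
  obtain a b where ab: "x = of_int a / of_int b" "b \<noteq> 0"
    by (metis Fract_of_int_quotient Rat_cases less_irrefl)
  obtain c where c: "b = int p ^ multiplicity (int p) b * c" "\<not> int p dvd c"
    using multiplicity_decompose'[of b "int p"] ab(2) prime_int_p not_prime_unit by blast
  define m where "m = multiplicity (int p) b"
  have "x = of_nat p powi (- int m) * (of_int a / of_int c)"
    using c(1) ab(1) by (simp add: power_int_minus field_simps m_def[symmetric])
  then show ?thesis using pdvI[OF c(2)] by blast
qed

text \<open>A crude bound on denominators, with no control over its size.
  \<open>class_sum_approx\<close> uses it to decide how precisely the unit factors have to be
  approximated.\<close>

lemma pdv_exists_uniform: "finite S \<Longrightarrow> \<exists>B::nat. \<forall>i\<in>S. pdv (- int B) (f i)"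
proof (induction S rule: finite_induct)
  case (insert i S)
  then obtain B where B: "\<forall>i\<in>S. pdv (- int B) (f i)" by blast
  obtain C where C: "pdv (- int C) (f i)" using pdv_exists by blast
  show ?case
    by (rule exI[of _ "max B C"]) (use B C in \<open>auto intro: pdv_mono\<close>)
qed simp

end

section \<open>Forward differences\<close>

definition fdiff :: "(nat \<Rightarrow> int) \<Rightarrow> nat \<Rightarrow> int" where
  "fdiff f n = f (Suc n) - f n"

lemma fdiff_pow_Suc: "(fdiff ^^ Suc i) f = (fdiff ^^ i) (fdiff f)"
  by (simp add: funpow_swap1)

lemma fdiff_pow_add: "(fdiff ^^ i) (\<lambda>n. f n + g n) = (\<lambda>n. (fdiff ^^ i) f n + (fdiff ^^ i) g n)"
proof (induction i arbitrary: f g)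
  case (Suc i)
  have "fdiff (\<lambda>n. f n + g n) = (\<lambda>n. fdiff f n + fdiff g n)"
    by (simp add: fdiff_def fun_eq_iff)
  then show ?case by (simp only: fdiff_pow_Suc Suc)
qed simp

lemma fdiff_pow_shift: "(fdiff ^^ i) (\<lambda>n. f (Suc n)) n = (fdiff ^^ i) f (Suc n)"
proof (induction i arbitrary: f)
  case (Suc i)
  have "fdiff (\<lambda>n. f (Suc n)) = (\<lambda>n. fdiff f (Suc n))"
    by (simp add: fdiff_def fun_eq_iff)
  then show ?case by (simp only: fdiff_pow_Suc Suc)
qed simp

lemma fdiff_pow_const: "(fdiff ^^ Suc i) (\<lambda>n. c) = (\<lambda>n. 0)"
proof -
  have "fdiff (\<lambda>n. c) = (\<lambda>n. 0)" for c
    by (simp add: fdiff_def fun_eq_iff)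
  then show ?thesis by (induction i) auto
qed

lemma newton_forward: "f a = (\<Sum>i\<le>a. int (a choose i) * (fdiff ^^ i) f 0)"
proof (induction a arbitrary: f)
  case (Suc a)
  let ?d = "\<lambda>i. (fdiff ^^ i) f 0"
  have "f (Suc a) = f a + fdiff f a"
    by (simp add: fdiff_def)
  also have "\<dots> = (\<Sum>i\<le>a. int (a choose i) * ?d i) + (\<Sum>i\<le>a. int (a choose i) * ?d (Suc i))"
    using Suc[of f] Suc[of "fdiff f"] by (simp only: fdiff_pow_Suc)
  also have "(\<Sum>i\<le>a. int (a choose i) * ?d i) = (\<Sum>i\<le>Suc a. int (a choose i) * ?d i)"
    by simp
  also have "\<dots> = ?d 0 + (\<Sum>i\<le>a. int (a choose Suc i) * ?d (Suc i))"
    by (subst sum.atMost_Suc_shift) simp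
  also have "\<dots> + (\<Sum>i\<le>a. int (a choose i) * ?d (Suc i)) = ?d 0 + (\<Sum>i\<le>a. int (Suc a choose Suc i) * ?d (Suc i))"
    by (simp add: sum.distrib[symmetric] algebra_simps)
  also have "\<dots> = (\<Sum>i\<le>Suc a. int (Suc a choose i) * ?d i)"
    by (subst sum.atMost_Suc_shift) simp
  finally show ?case .
qed simp

text \<open>A form of the Leibniz rule that avoids its binomial coefficients.\<close>

lemma fdiff_mult_dvd:
  assumes "\<And>s t n n'. s + t = i \<Longrightarrow> m dvd (fdiff ^^ s) f n * (fdiff ^^ t) g n'"
  shows "m dvd (fdiff ^^ i) (\<lambda>n. f n * g n) n"
  using assms
proof (induction i arbitrary: f g n)
  case 0
  then show ?case by fastforce
next
  case (Suc i)
  \<comment> \<open>The discrete product rule evaluates \<open>g\<close> at \<open>Suc n\<close>.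
    The shift is harmless because the hypothesis allows independent points \<open>n\<close> and
    \<open>n'\<close>.\<close>
  have "fdiff (\<lambda>n. f n * g n) = (\<lambda>n. fdiff f n * g (Suc n) + f n * fdiff g n)"
    by (simp add: fdiff_def fun_eq_iff algebra_simps)
  then have "(fdiff ^^ Suc i) (\<lambda>n. f n * g n) n
     = (fdiff ^^ i) (\<lambda>n. fdiff f n * g (Suc n)) n + (fdiff ^^ i) (\<lambda>n. f n * fdiff g n) n"
    by (simp only: fdiff_pow_Suc fdiff_pow_add)
  moreover have "m dvd (fdiff ^^ i) (\<lambda>n. fdiff f n * g (Suc n)) n"
  proof (rule Suc.IH)
    fix s t n n' assume "s + t = i"
    then show "m dvd (fdiff ^^ s) (fdiff f) n * (fdiff ^^ t) (\<lambda>n. g (Suc n)) n'"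
      using Suc.prems[of "Suc s" t n "Suc n'"] by (simp only: fdiff_pow_Suc fdiff_pow_shift add_Suc)
  qed
  moreover have "m dvd (fdiff ^^ i) (\<lambda>n. f n * fdiff g n) n"
  proof (rule Suc.IH)
    fix s t n n' assume "s + t = i"
    then show "m dvd (fdiff ^^ s) f n * (fdiff ^^ t) (fdiff g) n'"
      using Suc.prems[of s "Suc t" n n'] by (simp only: fdiff_pow_Suc add_Suc_right)
  qed
  ultimately show ?case by (metis dvd_add)
qed

text \<open>Differencing \<open>m * int n\<close> once yields \<open>m\<close>, so each difference
  produces a factor \<open>m\<close>; the product rule carries this through Horner's scheme.\<close>

lemma fdiff_pow_poly_dvd: "m ^ s dvd (fdiff ^^ s) (\<lambda>n. poly F (m * int n)) n"
proof (induction F arbitrary: s n)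
  case 0
  then show ?case by (cases s) (simp_all add: fdiff_pow_const del: funpow.simps)
next
  case (pCons a F)
  have "m ^ s dvd (fdiff ^^ s) (\<lambda>n. (m * int n) * poly F (m * int n)) n"
  proof (rule fdiff_mult_dvd)
    fix i j n n' assume ij: "i + j = s"
    have "m ^ i dvd (fdiff ^^ i) (\<lambda>n. m * int n) n"
    proof (cases i)
      case (Suc i')
      have "fdiff (\<lambda>n. m * int n) = (\<lambda>n. m)"
        by (simp add: fdiff_def fun_eq_iff algebra_simps)
      then show ?thesis
        using Suc by (cases i') (simp_all add: fdiff_pow_const fdiff_pow_Suc del: funpow.simps)
    qed simp
    then show "m ^ s dvd (fdiff ^^ i) (\<lambda>n. m * int n) n * (fdiff ^^ j) (\<lambda>n. poly F (m * int n)) n'"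
      using pCons(2)[of j n'] ij by (metis mult_dvd_mono power_add)
  qed
  moreover have "m ^ s dvd (fdiff ^^ s) (\<lambda>n. a) n"
    by (cases s) (simp_all add: fdiff_pow_const del: funpow.simps)
  ultimately show ?case
    by (simp add: fdiff_pow_add)
qed

section \<open>Polynomial approximation of factorials without their \<open>p\<close>-multiples\<close>

lemma falling_prod_binomial: "(\<Prod>l<i. int a - int l) = fact i * int (a choose i)"
proof (induction i)
  case (Suc i)
  have "Suc i * (a choose Suc i) = (a - i) * (a choose i)"
    using times_binomial_minus1_eq[of "Suc i" a] binomial_absorb_comp[of a i] by simp
  then have "int (Suc i) * int (a choose Suc i) = int (a - i) * int (a choose i)"
    by (metis of_nat_mult)
  also have "\<dots> = (int a - int i) * int (a choose i)"
    by (cases "i \<le> a") (simp_all add: of_nat_diff binomial_eq_0)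
  finally have *: "int (Suc i) * int (a choose Suc i) = (int a - int i) * int (a choose i)" .
  have "fact (Suc i) * int (a choose Suc i) = fact i * (int (Suc i) * int (a choose Suc i))"
    by (simp add: algebra_simps)
  also have "\<dots> = fact i * int (a choose i) * (int a - int i)"
    unfolding * by simp
  finally show ?case using Suc by simp
qed simp

definition falling_poly :: "nat \<Rightarrow> int poly" where
  "falling_poly i = (\<Prod>l<i. [:- int l, 1:])"

lemma poly_falling: "poly (falling_poly i) (int a) = fact i * int (a choose i)"
  by (simp add: falling_poly_def poly_prod falling_prod_binomial[symmetric])

text \<open>Inversion permutes the units, so their product is its own inverse. Working with the
  square avoids deciding the sign in the generalised Wilson theorem.\<close>

lemma prod_units_square:
  assumes "n > (1::int)"
  shows "[(\<Prod>x | x \<in> {1..n} \<and> coprime x n. x) ^ 2 = 1] (mod n)"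
proof -
  let ?S = "{x. x \<in> {1..n} \<and> coprime x n}"
  have inv: "modular_inverse n x \<in> ?S \<and> modular_inverse n (modular_inverse n x) = x" if "x \<in> ?S" for x
  proof -
    have x: "coprime x n" "x > 0" "x \<le> n" "x \<noteq> n" using that assms by auto
    then have "modular_inverse n (modular_inverse n x) = x"
      by (intro modular_inverse_int_eqI) (auto intro: cong_modular_inverse2)
    moreover have "modular_inverse n x > 0" "modular_inverse n x < n"
      using assms x by (auto intro: mult_modular_inverse_int_pos modular_inverse_int_less)
    ultimately show ?thesis using x by simp
  qed
  have "bij_betw (modular_inverse n) ?S ?S"
    by (rule bij_betw_byWitness[where f' = "modular_inverse n"]) (use inv in auto)
  then have "(\<Prod>x\<in>?S. x) = (\<Prod>x\<in>?S. modular_inverse n x)"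
    by (rule prod.reindex_bij_betw[symmetric])
  then have "(\<Prod>x\<in>?S. x) ^ 2 = (\<Prod>x\<in>?S. x * modular_inverse n x)"
    by (simp add: power2_eq_square prod.distrib)
  also have "[\<dots> = (\<Prod>x\<in>?S. 1)] (mod n)"
    by (rule cong_prod) (auto intro: cong_modular_inverse1)
  finally show ?thesis by simp
qed

context prime3
begin

text \<open>Up to sign this is Morita's p-adic Gamma function at m + 1.\<close>

definition pfact :: "nat \<Rightarrow> int" where
  "pfact m = (\<Prod>i | i \<in> {1..m} \<and> \<not> p dvd i. int i)"

lemma pfact_0 [simp]: "pfact 0 = 1"
  by (simp add: pfact_def)

lemma pfact_Suc: "pfact (Suc m) = (if p dvd Suc m then 1 else int (Suc m)) * pfact m"
proof (cases "p dvd Suc m")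
  case True
  then have "{i. i \<in> {1..Suc m} \<and> \<not> p dvd i} = {i. i \<in> {1..m} \<and> \<not> p dvd i}"
    by (auto simp: le_Suc_eq)
  then show ?thesis using True by (simp add: pfact_def)
next
  case False
  then have "{i. i \<in> {1..Suc m} \<and> \<not> p dvd i} = insert (Suc m) {i. i \<in> {1..m} \<and> \<not> p dvd i}"
    by (auto simp: le_Suc_eq)
  then show ?thesis using False by (simp add: pfact_def)
qed

lemma p_not_dvd_pfact: "\<not> int p dvd pfact m"
  unfolding pfact_def by (rule p_not_dvd_prod) auto

lemma fact_pfact: "fact m = int p ^ (m div p) * fact (m div p) * pfact m"
proof (induction m)
  case (Suc m)
  show ?case
  proof (cases "p dvd Suc m")
    case True
    then have d: "Suc m div p = Suc (m div p)"
      by (simp add: div_Suc dvd_eq_mod_eq_0)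
    have "int (Suc m) = int p * int (Suc (m div p))"
      using True d by (metis dvd_mult_div_cancel of_nat_mult)
    then have "fact (Suc m) = int p * int (Suc (m div p)) * fact m"
      by simp
    then show ?thesis
      using True by (simp add: d Suc pfact_Suc)
  next
    case False
    then have d: "Suc m div p = m div p"
      by (simp add: div_Suc dvd_eq_mod_eq_0)
    have "fact (Suc m) = int (Suc m) * fact m" by simp
    then show ?thesis
      using False Suc by (simp only: d pfact_Suc if_False mult_ac)
  qed
qed simp

text \<open>Legendre's bound e <= (i - 1) / (p - 1), weakened by p >= 3 to (i - 1) / 2. It follows
  by iterating \<open>fact_pfact\<close>, since i div p is at most i / 3.\<close>

lemma fact_p_part: "\<exists>e m. fact i = int p ^ e * m \<and> \<not> int p dvd m \<and> (i > 0 \<longrightarrow> 2 * e + 1 \<le> i)"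
proof (induction i rule: less_induct)
  case (less i)
  show ?case
  proof (cases "i < p")
    case True
    then show ?thesis
      using fact_pfact[of i] p_not_dvd_pfact by (intro exI[of _ 0] exI[of _ "pfact i"]) auto
  next
    case False
    define j where "j = i div p"
    have j: "j < i" "j > 0" "3 * j \<le> i"
    proof -
      have "p * j \<le> i" by (simp add: j_def)
      moreover have "3 * j \<le> p * j" using p_gt_2 by simp
      ultimately show "3 * j \<le> i" by linarith
      show "j > 0" using False by (simp add: j_def div_greater_zero_iff)
      then show "j < i" using \<open>3 * j \<le> i\<close> by linarith
    qed
    obtain e m where em: "fact j = int p ^ e * m" "\<not> int p dvd m" "2 * e + 1 \<le> j"
      using less[OF j(1)] j(2) by auto
    have "fact i = int p ^ (j + e) * (m * pfact i)"
      using fact_pfact[of i] em(1) by (simp add: j_def[symmetric] power_add)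
    moreover have "\<not> int p dvd m * pfact i"
      using em(2) p_not_dvd_pfact by (rule p_not_dvd_mult)
    moreover have "2 * (j + e) + 1 \<le> i" using em(3) j(3) by presburger
    ultimately show ?thesis by blast
  qed
qed

lemma pfact_block: "r < p \<Longrightarrow> pfact (p * n + r) = pfact (p * n) * (\<Prod>l\<in>{1..r}. int (p * n + l))"
proof (induction r)
  case (Suc r)
  have "\<not> p dvd Suc (p * n + r)"
  proof
    assume "p dvd Suc (p * n + r)"
    then have "p dvd Suc r"
      by (metis add_Suc_right dvd_add_right_iff dvd_triv_left)
    then show False using Suc.prems by (simp add: nat_dvd_not_less)
  qed
  then have "pfact (p * n + Suc r) = int (p * n + Suc r) * pfact (p * n + r)"
    using pfact_Suc[of "p * n + r"] by simp
  then show ?case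
    using Suc by (simp add: prod.nat_ivl_Suc' mult_ac)
qed simp

lemma pfact_mult_Suc: "pfact (p * Suc n) = pfact (p * n) * (\<Prod>l\<in>{1..p - 1}. int (p * n + l))"
proof -
  have eq: "p * Suc n = Suc (p * n + (p - 1))"
    using p_pos by (simp add: algebra_simps)
  then have "p dvd Suc (p * n + (p - 1))" by (metis dvd_triv_left)
  then have "pfact (p * Suc n) = pfact (p * n + (p - 1))"
    by (simp only: eq pfact_Suc if_True mult_1)
  then show ?thesis using pfact_block[of "p - 1" n] by simp
qed

lemma pfact_mult: "pfact (p * n) = (\<Prod>i<n. \<Prod>l\<in>{1..p - 1}. int (p * i + l))"
  by (induction n) (simp_all only: pfact_mult_Suc prod.lessThan_Suc mult_0_right pfact_0 prod.empty lessThan_0)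

lemma pfact_add_power:
  assumes "k > 0"
  shows "[pfact (p ^ k + m) = pfact (p ^ k) * pfact m] (mod int p ^ k)"
proof (induction m)
  case (Suc m)
  have iff: "p dvd Suc (p ^ k + m) \<longleftrightarrow> p dvd Suc m"
    using assms by (metis add_Suc_right dvd_add_right_iff dvd_power)
  have "[int (Suc (p ^ k + m)) = int (Suc m)] (mod int p ^ k)"
    by (simp add: cong_iff_dvd_diff)
  then show ?case
    using cong_mult[OF _ Suc, of "if p dvd Suc m then 1 else int (Suc (p ^ k + m))" "if p dvd Suc m then 1 else int (Suc m)"]
    by (auto simp: pfact_Suc iff mult_ac split: if_splits)
qed simp

lemma pfact_power_square: "k > 0 \<Longrightarrow> [pfact (p ^ k) ^ 2 = 1] (mod int p ^ k)"
proof -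
  assume k: "k > 0"
  have "int p ^ k > 1" using k p_gt_2 by (intro one_less_power) auto
  have "bij_betw int {i. i \<in> {1..p ^ k} \<and> \<not> p dvd i} {x. x \<in> {1..int p ^ k} \<and> coprime x (int p ^ k)}"
  proof (rule bij_betw_byWitness[where f' = nat])
    have cop: "coprime (int i) (int p ^ k) \<longleftrightarrow> \<not> p dvd i" for i
    proof -
      have "coprime i p \<longleftrightarrow> \<not> p dvd i"
        using prime_p by (metis coprime_absorb_left coprime_commute not_prime_unit prime_imp_coprime)
      then show ?thesis using k by simp
    qed
    show "int ` {i. i \<in> {1..p ^ k} \<and> \<not> p dvd i} \<subseteq> {x. x \<in> {1..int p ^ k} \<and> coprime x (int p ^ k)}"
    proof (rule image_subsetI)
      fix i assume i: "i \<in> {i. i \<in> {1..p ^ k} \<and> \<not> p dvd i}"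
      then have "int i \<le> int p ^ k" by (metis mem_Collect_eq atLeastAtMost_iff of_nat_le_iff of_nat_power)
      then show "int i \<in> {x. x \<in> {1..int p ^ k} \<and> coprime x (int p ^ k)}"
        using cop[of i] i by simp
    qed
    show "nat ` {x. x \<in> {1..int p ^ k} \<and> coprime x (int p ^ k)} \<subseteq> {i. i \<in> {1..p ^ k} \<and> \<not> p dvd i}"
    proof safe
      fix x assume x: "x \<in> {1..int p ^ k}" "coprime x (int p ^ k)"
      then show "nat x \<in> {1..p ^ k}"
        by (auto simp: nat_le_iff)
      assume "p dvd nat x"
      then show False using cop[of "nat x"] x by simp
    qed
  qed auto
  then have "pfact (p ^ k) = (\<Prod>x | x \<in> {1..int p ^ k} \<and> coprime x (int p ^ k). x)"
    unfolding pfact_def by (rule prod.reindex_bij_betw)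
  then show ?thesis using prod_units_square[OF \<open>int p ^ k > 1\<close>] by simp
qed

text \<open>A shift by \<open>p ^ k\<close> multiplies \<open>pfact\<close> by
  \<open>pfact (p ^ k)\<close>, whose square is 1; after squaring, \<open>p ^ k\<close> is a genuine
  period.\<close>

lemma pfact_square_periodic:
  assumes "k > 0"
  shows "[pfact (n * p ^ k + m) ^ 2 = pfact m ^ 2] (mod int p ^ k)"
proof (induction n)
  case (Suc n)
  have "Suc n * p ^ k + m = p ^ k + (n * p ^ k + m)" by simp
  then have "[pfact (Suc n * p ^ k + m) ^ 2 = (pfact (p ^ k) * pfact (n * p ^ k + m)) ^ 2] (mod int p ^ k)"
    using pfact_add_power[OF assms] by (metis cong_pow)
  also have "(pfact (p ^ k) * pfact (n * p ^ k + m)) ^ 2 = pfact (p ^ k) ^ 2 * pfact (n * p ^ k + m) ^ 2"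
    by (rule power_mult_distrib)
  also have "[\<dots> = 1 * pfact m ^ 2] (mod int p ^ k)"
    by (intro cong_mult pfact_power_square assms Suc)
  finally show ?case by simp
qed simp

text \<open>
  The functions that agree modulo \<open>p ^ k\<close> with a polynomial which is constant modulo \<open>p\<close> and linear modulo \<open>p\<^sup>2\<close>,
  except for a cubic term that occurs only for \<open>p = 3\<close>.  The point of the shape is that \<open>f a * f (B - a)\<close> is then
  constant modulo \<open>p\<^sup>2\<close>.
\<close>

definition cub :: "nat \<Rightarrow> (nat \<Rightarrow> int) \<Rightarrow> bool" where
  "cub k f \<longleftrightarrow> (\<exists>c ea eb g. int p dvd 3 * eb \<and>
     (\<forall>a. [f a = c + int p * (ea * int a + eb * int a ^ 3) + int p ^ 2 * poly g (int a)] (mod int p ^ k)))"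

lemma cubI: "int p dvd 3 * eb \<Longrightarrow>
    (\<And>a. [f a = c + int p * (ea * int a + eb * int a ^ 3) + int p ^ 2 * poly g (int a)] (mod int p ^ k)) \<Longrightarrow> cub k f"
  unfolding cub_def by blast

lemma cub_cong: "cub k f \<Longrightarrow> (\<And>a. [g a = f a] (mod int p ^ k)) \<Longrightarrow> cub k g"
  unfolding cub_def by (meson cong_trans)

lemma cub_const: "cub k (\<lambda>_. c)"
  by (rule cubI[where c = c and ea = 0 and eb = 0 and g = 0]) auto

lemma cub_add:
  assumes "cub k f" "cub k g"
  shows "cub k (\<lambda>a. f a + g a)"
proof -
  obtain c ea eb h where 1: "int p dvd 3 * eb"
    "\<And>a. [f a = c + int p * (ea * int a + eb * int a ^ 3) + int p ^ 2 * poly h (int a)] (mod int p ^ k)"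
    using assms(1) unfolding cub_def by blast
  obtain c' ea' eb' h' where 2: "int p dvd 3 * eb'"
    "\<And>a. [g a = c' + int p * (ea' * int a + eb' * int a ^ 3) + int p ^ 2 * poly h' (int a)] (mod int p ^ k)"
    using assms(2) unfolding cub_def by blast
  show ?thesis
  proof (rule cubI[where c = "c + c'" and ea = "ea + ea'" and eb = "eb + eb'" and g = "h + h'"])
    show "int p dvd 3 * (eb + eb')" using 1(1) 2(1) by (simp add: distrib_left)
    show "[f a + g a = c + c' + int p * ((ea + ea') * int a + (eb + eb') * int a ^ 3) + int p ^ 2 * poly (h + h') (int a)] (mod int p ^ k)" for a
      using cong_add[OF 1(2)[of a] 2(2)[of a]] by (simp add: algebra_simps)
  qed
qed

lemma cub_sum: "(\<And>i. i \<in> S \<Longrightarrow> cub k (f i)) \<Longrightarrow> cub k (\<lambda>a. \<Sum>i\<in>S. f i a)"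
  by (induction S rule: infinite_finite_induct) (auto intro: cub_const cub_add)

lemma cub_mult:
  assumes "cub k f" "cub k g"
  shows "cub k (\<lambda>a. f a * g a)"
proof -
  obtain c ea eb h where 1: "int p dvd 3 * eb"
    "\<And>a. [f a = c + int p * (ea * int a + eb * int a ^ 3) + int p ^ 2 * poly h (int a)] (mod int p ^ k)"
    using assms(1) unfolding cub_def by blast
  obtain c' ea' eb' h' where 2: "int p dvd 3 * eb'"
    "\<And>a. [g a = c' + int p * (ea' * int a + eb' * int a ^ 3) + int p ^ 2 * poly h' (int a)] (mod int p ^ k)"
    using assms(2) unfolding cub_def by blast
  define L where "L = [:0, ea, 0, eb:]"
  define L' where "L' = [:0, ea', 0, eb':]"
  have L: "poly L x = ea * x + eb * x ^ 3" "poly L' x = ea' * x + eb' * x ^ 3" for x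
    by (simp_all add: L_def L'_def algebra_simps power3_eq_cube)
  define H where "H = L * L' + Polynomial.smult c h' + Polynomial.smult c' h + Polynomial.smult (int p) (L * h' + L' * h) + Polynomial.smult (int p ^ 2) (h * h')"
  show ?thesis
  proof (rule cubI[where c = "c * c'" and ea = "c * ea' + c' * ea" and eb = "c * eb' + c' * eb" and g = H])
    have "3 * (c * eb' + c' * eb) = c * (3 * eb') + c' * (3 * eb)" by (simp add: algebra_simps)
    then show "int p dvd 3 * (c * eb' + c' * eb)" using 1(1) 2(1) by (metis dvd_add dvd_mult)
    fix a
    have "(c + int p * (ea * int a + eb * int a ^ 3) + int p ^ 2 * poly h (int a)) *
      (c' + int p * (ea' * int a + eb' * int a ^ 3) + int p ^ 2 * poly h' (int a)) =
      c * c' + int p * ((c * ea' + c' * ea) * int a + (c * eb' + c' * eb) * int a ^ 3) + int p ^ 2 * poly H (int a)"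
      unfolding H_def poly_add poly_mult poly_smult L by Groebner_Basis.algebra
    then show "[f a * g a = c * c' + int p * ((c * ea' + c' * ea) * int a + (c * eb' + c' * eb) * int a ^ 3) + int p ^ 2 * poly H (int a)] (mod int p ^ k)"
      using cong_mult[OF 1(2)[of a] 2(2)[of a]] by simp
  qed
qed

lemma cub_power: "cub k f \<Longrightarrow> cub k (\<lambda>a. f a ^ n)"
  by (induction n) (auto intro: cub_const cub_mult)

text \<open>The mixed terms in the expansion of the cube carry the coefficient
  \<open>3 * eb\<close>. Its divisibility by p, which is part of \<open>cub\<close>, moves them into
  the part with factor \<open>int p ^ 2\<close>.\<close>

lemma cub_affine:
  assumes "cub k f"
  shows "cub k (\<lambda>a. f (u * a + v))"
proof -
  obtain c ea eb h where 1: "int p dvd 3 * eb"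
    "\<And>a. [f a = c + int p * (ea * int a + eb * int a ^ 3) + int p ^ 2 * poly h (int a)] (mod int p ^ k)"
    using assms(1) unfolding cub_def by blast
  from 1(1) obtain d where d: "3 * eb = int p * d" by auto
  let ?u = "int u" and ?v = "int v"
  define H where "H = pcompose h [:?v, ?u:] + [:0, d * ?u * ?v ^ 2, d * ?u ^ 2 * ?v:]"
  show ?thesis
  proof (rule cubI[where c = "c + int p * (ea * ?v + eb * ?v ^ 3)" and ea = "ea * ?u" and eb = "eb * ?u ^ 3" and g = H])
    have "3 * (eb * ?u ^ 3) = 3 * eb * ?u ^ 3" by simp
    then show "int p dvd 3 * (eb * ?u ^ 3)" using 1(1) by (metis dvd_mult2)
    fix a
    have H: "poly H (int a) = poly h (int (u * a + v)) + d * ?u * ?v ^ 2 * int a + d * ?u ^ 2 * ?v * int a ^ 2"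
      by (simp add: H_def poly_pcompose algebra_simps power2_eq_square)
    have "c + int p * (ea * int (u * a + v) + eb * int (u * a + v) ^ 3) + int p ^ 2 * poly h (int (u * a + v))
      = c + int p * (ea * ?v + eb * ?v ^ 3) + int p * (ea * ?u * int a + eb * ?u ^ 3 * int a ^ 3) + int p ^ 2 * poly H (int a)"
      unfolding H of_nat_add of_nat_mult using d by Groebner_Basis.algebra
    then show "[f (u * a + v) = c + int p * (ea * ?v + eb * ?v ^ 3) + int p * (ea * ?u * int a + eb * ?u ^ 3 * int a ^ 3) + int p ^ 2 * poly H (int a)] (mod int p ^ k)"
      using 1(2)[of "u * a + v"] by (simp only:)
  qed
qed

lemma unit_inverse_mod:
  assumes "\<not> int p dvd m"
  obtains m' where "[m * m' = 1] (mod int p ^ k)"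
  using coprime_p_power[OF assms, of k] cong_solve_coprime_int by blast

lemma cub_p_linear: "cub k (\<lambda>a. c + int p * (ea * int a))"
  by (rule cubI[where c = c and ea = ea and eb = 0 and g = 0]) auto

lemma cub_p2_poly: "cub k (\<lambda>a. int p ^ 2 * poly g (int a))"
  by (rule cubI[where c = 0 and ea = 0 and eb = 0 and g = g]) auto

text \<open>The only source of the cubic term: in x^3 - 3 x^2 + 2 x the coefficient 3 = p supplies
  the second factor p for the square term.\<close>

lemma cub_p3_poly: "p = 3 \<Longrightarrow> cub k (\<lambda>a. int p * (m * (int a * (int a - 1) * (int a - 2))))"
  by (rule cubI[where c = 0 and ea = "2 * m" and eb = m and g = "[:0, 0, - m:]"])
    (auto simp: algebra_simps power2_eq_square power3_eq_cube)

text \<open>The exponent is the one provided by the finite differences of a product of blocks; it beats the denominator \<open>i!\<close>.\<close>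

lemma cub_binomial:
  assumes "int p ^ ((2 * i + 2) div 3) dvd d"
  shows "cub k (\<lambda>a. int (a choose i) * d)"
proof -
  obtain v m where vm: "fact i = int p ^ v * m" "\<not> int p dvd m" "i > 0 \<Longrightarrow> 2 * v + 1 \<le> i"
    using fact_p_part[of i] by blast
  obtain m' where m': "[m * m' = 1] (mod int p ^ k)"
    using unit_inverse_mod[OF vm(2)] by blast
  obtain d' where d': "d = int p ^ ((2 * i + 2) div 3) * d'" using assms by auto
  \<comment> \<open>\<open>m'\<close> inverts the part of \<open>fact i\<close> prime to p, so the
    binomial coefficient costs exactly \<open>p ^ v\<close>, and \<open>w\<close> is the exponent
    left over.\<close>
  have main: "[int (a choose i) * d = int p ^ w * (m' * d' * poly (falling_poly i) (int a))] (mod int p ^ k)"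
    if "(2 * i + 2) div 3 = v + w" for w a
  proof -
    have "int p ^ w * (m' * d' * poly (falling_poly i) (int a)) = (m * m') * (int (a choose i) * d)"
      unfolding poly_falling vm(1) d' that power_add by (simp add: mult_ac)
    also have "[\<dots> = 1 * (int (a choose i) * d)] (mod int p ^ k)"
      by (intro cong_mult m' cong_refl)
    finally show ?thesis by (simp add: cong_sym_eq)
  qed
  consider "i = 0" | "i = 1" | "i = 3" "p = 3" | "i = 3" "p \<noteq> 3" | "i = 2" | "i \<ge> 4" by linarith
  then show ?thesis
  proof cases
    case 1
    then show ?thesis by (simp add: cub_const)
  next
    case 2
    then have "(\<lambda>a. int (a choose i) * d) = (\<lambda>a. 0 + int p * (d' * int a))"
      by (simp add: d' fun_eq_iff mult_ac)
    then show ?thesis using cub_p_linear[of k 0 d'] by simp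
  next
    \<comment> \<open>Here 3! costs one of the two available powers of p. It is the only case of
      degree above 1 with just one power left.\<close>
    case 3
    have "v = 1"
    proof -
      have "int 3 ^ v * m = 3 * 2" using vm(1) 3 by (simp add: fact_numeral)
      moreover have "v \<le> 1" using vm(3) 3 by simp
      moreover have "v \<noteq> 0"
      proof
        assume "v = 0"
        then have "m = 6" using \<open>int 3 ^ v * m = 3 * 2\<close> by simp
        then show False using vm(2) 3 by simp
      qed
      ultimately show ?thesis by simp
    qed
    then have *: "[int (a choose i) * d = int p ^ 1 * (m' * d' * poly (falling_poly i) (int a))] (mod int p ^ k)" for a
      using 3 by (intro main) simp
    have "poly (falling_poly i) (int a) = int a * (int a - 1) * (int a - 2)" for a
      using 3 by (simp add: falling_poly_def numeral_3_eq_3 lessThan_Suc algebra_simps)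
    then have "cub k (\<lambda>a. int p ^ 1 * (m' * d' * poly (falling_poly i) (int a)))"
      using cub_p3_poly[OF 3(2), of k "m' * d'"] by simp
    then show ?thesis by (rule cub_cong) (rule *)
  next
    case 4
    have "v = 0"
    proof (rule ccontr)
      assume "v \<noteq> 0"
      then have "int p dvd fact i"
        unfolding vm(1) by (simp add: dvd_power)
      moreover have "fact i = (6 :: int)"
        using 4 by (simp add: fact_numeral)
      ultimately have "int p dvd 6" by simp
      then have "p dvd 6" by presburger
      then have "p \<le> 6" by (simp add: dvd_imp_le)
      then have "p \<in> {3, 4, 5, 6}" using p_gt_2 by auto
      then show False using mod4 4(2) by auto
    qed
    then have *: "[int (a choose i) * d = int p ^ 2 * (m' * d' * poly (falling_poly i) (int a))] (mod int p ^ k)" for a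
      using 4 by (intro main) simp
    show ?thesis
      using cub_cong[OF cub_p2_poly[of k "Polynomial.smult (m' * d') (falling_poly i)"]] * by simp
  next
    case 5
    have "v = 0" using vm(3) 5 by simp
    then have *: "[int (a choose i) * d = int p ^ 2 * (m' * d' * poly (falling_poly i) (int a))] (mod int p ^ k)" for a
      using 5 by (intro main) simp
    show ?thesis
      using cub_cong[OF cub_p2_poly[of k "Polynomial.smult (m' * d') (falling_poly i)"]] * by simp
  next
    case 6
    \<comment> \<open>From i = 9 on, the bound v <= (i - 1) / 2 suffices in spite of the rounding;
      the values 4 to 8 are checked one by one.\<close>
    have "v + 2 \<le> (2 * i + 2) div 3"
    proof -
      have "2 * v + 1 \<le> i" using vm(3) 6 by simp
      show ?thesis
      proof (cases "i \<ge> 9")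
        case True
        then show ?thesis using \<open>2 * v + 1 \<le> i\<close> by linarith
      next
        case False
        then have "i \<in> {4, 5, 6, 7, 8}" using 6 by auto
        then show ?thesis using \<open>2 * v + 1 \<le> i\<close> by (elim insertE) auto
      qed
    qed
    then obtain w where w: "(2 * i + 2) div 3 = v + (2 + w)" by (metis add.assoc le_Suc_ex)
    have *: "[int (a choose i) * d = int p ^ 2 * (int p ^ w * m' * d' * poly (falling_poly i) (int a))] (mod int p ^ k)" for a
      using main[OF w, of a] by (simp add: power_add power2_eq_square mult_ac)
    show ?thesis
      using cub_cong[OF cub_p2_poly[of k "Polynomial.smult (int p ^ w * m' * d') (falling_poly i)"]] * by simp
  qed
qed

text \<open>The first difference of the product U is (f - 1) U. Under s further differences f - 1
  contributes p for s = 0, p^2 for s = 1 and p^s for s >= 2. The case s = 2 spends three differences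
  in all on two powers of p, which dictates the rate 2/3.\<close>

lemma block_prod_fdiff_dvd:
  assumes poly: "\<And>i. f i = poly F (int p * int i)"
    and d0: "\<And>i. int p dvd f i - 1" and d1: "\<And>i. int p ^ 2 dvd f (Suc i) - f i"
  shows "int p ^ ((2 * j + 2) div 3) dvd (fdiff ^^ j) (\<lambda>a. \<Prod>i<a. f i) n"
proof (induction j arbitrary: n rule: less_induct)
  case (less j)
  show ?case
  proof (cases j)
    case (Suc j')
    let ?U = "\<lambda>a. \<Prod>i<a. f i"
    have "fdiff ?U = (\<lambda>a. (f a - 1) * ?U a)"
      by (simp add: fdiff_def fun_eq_iff algebra_simps)
    moreover have "int p ^ ((2 * j + 2) div 3) dvd (fdiff ^^ j') (\<lambda>a. (f a - 1) * ?U a) n"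
    proof (rule fdiff_mult_dvd)
      fix s t n n' assume st: "s + t = j'"
      define w where "w = (if s = 0 then 1 else if s = 1 then 2 else s)"
      have "int p ^ w dvd (fdiff ^^ s) (\<lambda>a. f a - 1) n"
      proof -
        consider "s = 0" | "s = 1" | "s \<ge> 2" by linarith
        then show ?thesis
        proof cases
          case 1
          then show ?thesis using d0 by (simp add: w_def)
        next
          case 2
          then show ?thesis using d1 by (simp add: w_def fdiff_def)
        next
          case 3
          have "(\<lambda>a. f a - 1) = (\<lambda>a. poly (F - 1) (int p * int a))"
            by (simp add: poly fun_eq_iff)
          then show ?thesis using 3 fdiff_pow_poly_dvd[of "int p" s "F - 1" n] by (simp add: w_def)
        qed
      qed
      moreover have "int p ^ ((2 * t + 2) div 3) dvd (fdiff ^^ t) ?U n'"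
        using less st Suc by simp
      ultimately have "int p ^ (w + (2 * t + 2) div 3) dvd (fdiff ^^ s) (\<lambda>a. f a - 1) n * (fdiff ^^ t) ?U n'"
        unfolding power_add by (rule mult_dvd_mono)
      moreover have "(2 * j + 2) div 3 \<le> w + (2 * t + 2) div 3"
        using st Suc by (auto simp: w_def)
      ultimately show "int p ^ ((2 * j + 2) div 3) dvd (fdiff ^^ s) (\<lambda>a. f a - 1) n * (fdiff ^^ t) ?U n'"
        using power_le_dvd by blast
    qed
    ultimately show ?thesis
      using Suc by (simp only: fdiff_pow_Suc)
  qed simp
qed

text \<open>Newton's series of the product, truncated at 2k: beyond that index all differences at 0
  vanish modulo \<open>p ^ k\<close>, so the number of terms does not depend on a.\<close>

lemma cub_block_prod:
  assumes "\<And>i. f i = poly F (int p * int i)"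
    and "\<And>i. int p dvd f i - 1" and "\<And>i. int p ^ 2 dvd f (Suc i) - f i"
  shows "cub k (\<lambda>a. \<Prod>i<a. f i)"
proof -
  let ?U = "\<lambda>a. \<Prod>i<a. f i"
  let ?d = "\<lambda>i. (fdiff ^^ i) ?U 0"
  have dvd: "int p ^ ((2 * i + 2) div 3) dvd ?d i" for i
    using assms by (rule block_prod_fdiff_dvd)
  have "cub k (\<lambda>a. \<Sum>i\<le>2 * k. int (a choose i) * ?d i)"
    by (intro cub_sum cub_binomial dvd)
  moreover have "[?U a = (\<Sum>i\<le>2 * k. int (a choose i) * ?d i)] (mod int p ^ k)" for a
  proof -
    define n where "n = max a (2 * k)"
    have "?U a = (\<Sum>i\<le>a. int (a choose i) * ?d i)"
      by (rule newton_forward)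
    also have "\<dots> = (\<Sum>i\<le>n. int (a choose i) * ?d i)"
      by (rule sum.mono_neutral_left) (auto simp: n_def binomial_eq_0)
    also have "\<dots> = (\<Sum>i\<le>2 * k. int (a choose i) * ?d i) + (\<Sum>i\<in>{2 * k<..n}. int (a choose i) * ?d i)"
    proof -
      have "{..n} = {..2 * k} \<union> {2 * k<..n}" by (auto simp: n_def)
      moreover have "{..2 * k} \<inter> {2 * k<..n} = {}" by auto
      ultimately show ?thesis by (simp only: sum.union_disjoint finite_atMost finite_greaterThanAtMost)
    qed
    finally have "?U a - (\<Sum>i\<le>2 * k. int (a choose i) * ?d i) = (\<Sum>i\<in>{2 * k<..n}. int (a choose i) * ?d i)"
      by simp
    moreover have "int p ^ k dvd (\<Sum>i\<in>{2 * k<..n}. int (a choose i) * ?d i)"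
    proof (rule dvd_sum)
      fix i assume "i \<in> {2 * k<..n}"
      then have "k \<le> (2 * i + 2) div 3" by auto
      then show "int p ^ k dvd int (a choose i) * ?d i"
        using dvd[of i] by (meson dvd_mult power_le_dvd)
    qed
    ultimately show ?thesis by (simp add: cong_iff_dvd_diff)
  qed
  ultimately show ?thesis by (rule cub_cong)
qed

lemma cub_power_4: "cub k (\<lambda>a. 4 ^ ((p - 1) * a))"
proof -
  have "\<not> p dvd 4"
  proof
    assume "p dvd 4"
    then have "p \<le> 4" by (simp add: dvd_imp_le)
    then have "p \<in> {3, 4}" using p_gt_2 by auto
    then show False using \<open>p dvd 4\<close> mod4 by auto
  qed
  then have "[4 ^ (p - 1) = 1] (mod p)"
    using prime_p by (intro fermat_theorem)
  then have "[(4::int) ^ (p - 1) = 1] (mod int p)"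
    using cong_int_iff[of "4 ^ (p - 1)" 1 p] by simp
  then have "cub k (\<lambda>a. \<Prod>i<a. 4 ^ (p - 1))"
    by (intro cub_block_prod[where F = "[:4 ^ (p - 1):]"]) (simp_all add: cong_iff_dvd_diff)
  then show ?thesis by (simp add: power_mult)
qed

text \<open>In the squared block l is paired with p - l, and (p i + l)(p i + p - l) = l (p - l) +
  p^2 (i^2 + i). Hence the blocks are constant modulo p^2, and Wilson's theorem makes them 1 modulo
  p.\<close>

lemma cub_pfact_mult_square: "cub k (\<lambda>n. pfact (p * n) ^ 2)"
proof -
  define f where "f i = (\<Prod>l\<in>{1..p - 1}. int (p * i + l)) ^ 2" for i
  define F where "F = (\<Prod>l\<in>{1..p - 1}. [:int l, 1:]) ^ 2"
  define c where "c = (\<Prod>l\<in>{1..p - 1}. int l * (int p - int l))"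
  have sq: "f i = (\<Prod>l\<in>{1..p - 1}. int (p * i + l) * int (p * i + (p - l)))" for i
  proof -
    have "(\<Prod>l\<in>{1..p - 1}. int (p * i + l)) = (\<Prod>l\<in>{1..p - 1}. int (p * i + (p - l)))"
      by (rule prod.reindex_bij_witness[where i = "\<lambda>l. p - l" and j = "\<lambda>l. p - l"]) auto
    then show ?thesis by (simp add: f_def power2_eq_square prod.distrib)
  qed
  have fc: "[f i = c] (mod int p ^ 2)" for i
    unfolding sq c_def
  proof (rule cong_prod)
    fix l assume l: "l \<in> {1..p - 1}"
    then have "l \<le> p" by auto
    then have "int (p - l) = int p - int l" by (simp add: of_nat_diff)
    then have "int (p * i + l) * int (p * i + (p - l)) - int l * (int p - int l) = int p ^ 2 * (int i * int i + int i)"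
      by (simp add: algebra_simps power2_eq_square)
    then show "[int (p * i + l) * int (p * i + (p - l)) = int l * (int p - int l)] (mod (int p)\<^sup>2)"
      unfolding cong_iff_dvd_diff by (metis dvd_triv_left)
  qed
  have "cub k (\<lambda>a. \<Prod>i<a. f i)"
  proof (rule cub_block_prod)
    show "f i = poly F (int p * int i)" for i
      by (simp add: f_def F_def poly_prod add.commute)
    show "int p ^ 2 dvd f (Suc i) - f i" for i
      using fc by (meson cong_iff_dvd_diff cong_sym cong_trans)
    have "f 0 = (fact (p - 1)) ^ 2"
      by (simp add: f_def fact_prod)
    moreover have "[fact (p - 1) = - 1] (mod int p)"
      using wilson_theorem[OF prime_p] .
    ultimately have "[f 0 = 1] (mod int p)"
      using cong_pow[of "fact (p - 1)" "-1" "int p" 2] by simp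
    moreover have "[f i = f 0] (mod int p)" for i
      using fc by (meson cong_dvd_modulus cong_sym cong_trans dvd_power pos2)
    ultimately show "int p dvd f i - 1" for i
      by (meson cong_iff_dvd_diff cong_trans)
  qed
  then show ?thesis by (simp add: pfact_mult f_def prod_power_distrib)
qed

lemma cub_pfact_square: "cub k (\<lambda>n. pfact (p * n + m) ^ 2)"
proof -
  have "cub k (\<lambda>n. pfact (p * n + r) ^ 2)" if "r < p" for r
  proof -
    have "cub k (\<lambda>n. int (p * n + l))" for l
      using cub_p_linear[of k "int l" 1] by (simp add: add.commute)
    moreover have "cub k (\<lambda>n. \<Prod>l\<in>S. h l n)" if "\<And>l. cub k (h l)" for S :: "nat set" and h
      using that by (induction S rule: infinite_finite_induct) (auto intro: cub_const cub_mult)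
    ultimately have "cub k (\<lambda>n. \<Prod>l\<in>{1..r}. int (p * n + l))"
      by simp
    then have "cub k (\<lambda>n. pfact (p * n) ^ 2 * (\<Prod>l\<in>{1..r}. int (p * n + l)) ^ 2)"
      using cub_mult[OF cub_pfact_mult_square cub_power] by blast
    then show ?thesis using that by (simp add: pfact_block power_mult_distrib)
  qed
  from cub_affine[OF this[of "m mod p"], of 1 "m div p"] show ?thesis
    by (simp add: algebra_simps)
qed

text \<open>By Euler's theorem the inverse is a power of \<open>f\<close>, so closure under products
  is enough.\<close>

lemma cub_inverse:
  assumes "cub k f" "\<And>a. \<not> int p dvd f a"
  obtains g where "cub k g" "\<And>a. [f a * g a = 1] (mod int p ^ k)"
proof
  define e where "e = totient (p ^ k) - 1"
  have "totient (p ^ k) = Suc e" by (simp add: e_def)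
  show "cub k (\<lambda>a. f a ^ e)" using assms(1) by (rule cub_power)
  show "[f a * f a ^ e = 1] (mod int p ^ k)" for a
  proof -
    have "coprime (f a) (int (p ^ k))" using coprime_p_power[OF assms(2)] by simp
    then have "[f a ^ totient (p ^ k) = 1] (mod int (p ^ k))"
    proof (cases "k = 0")
      case False
      then have "1 < int (p ^ k)" using one_less_power[of "int p" k] p_gt_2 by simp
      then interpret R: residues "int (p ^ k)" "residue_ring (int (p ^ k))"
        by unfold_locales simp_all
      show ?thesis using R.euler_theorem[OF \<open>coprime (f a) (int (p ^ k))\<close>]
        by (simp add: nat_power_eq)
    qed simp
    then show ?thesis by (simp add: \<open>totient (p ^ k) = Suc e\<close>)
  qed
qed

end

section \<open>Dissection modulo \<open>p\<close>\<close>

lemma qfac_prod: "int (qfac J) = (\<Prod>h<J div 2. 2 * int J - 3 - 4 * int h)"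
proof (induction J rule: qfac.induct)
  case (3 j)
  have "(\<Prod>h<Suc (Suc j) div 2. 2 * int (Suc (Suc j)) - 3 - 4 * int h)
     = (2 * int j + 1) * (\<Prod>h<j div 2. 2 * int j - 3 - 4 * int h)"
  proof -
    have "Suc (Suc j) div 2 = Suc (j div 2)" by simp
    then show ?thesis
      unfolding prod.lessThan_Suc_shift by (simp only: prod.lessThan_Suc_shift) (simp add: algebra_simps)
  qed
  then show ?case using 3 by (simp only: qfac.simps of_nat_mult) simp
qed simp_all

context prime3
begin

definition qfac_unit :: "nat \<Rightarrow> int" where
  "qfac_unit J = (\<Prod>h | h < J div 2 \<and> \<not> int p dvd 2 * int J - 3 - 4 * int h. 2 * int J - 3 - 4 * int h)"

lemma p_not_dvd_4: "\<not> int p dvd 4"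
proof
  assume "int p dvd 4"
  then have "int p dvd 2 * 2" by simp
  then have "int p dvd 2" using prime_int_p by (metis prime_dvd_mult_iff)
  then show False using p_gt_2 zdvd_imp_le[of "int p" 2] by simp
qed

text \<open>The range \<open>h < J div 2\<close> says exactly that the factor 2J - 3 - 4h is
  positive, a condition that survives division by p. At h = e the factor is p (2b - 3), and every
  p-th factor from there on is again a multiple of p.\<close>

lemma multiples_bij:
  assumes J: "2 * int J - 3 = int p * (2 * int b - 3) + 4 * int e" and e: "e < p"
  shows "bij_betw (\<lambda>g. e + p * g) {..<b div 2} {h. h < J div 2 \<and> int p dvd 2 * int J - 3 - 4 * int h}"
proof -
  have val: "2 * int J - 3 - 4 * int (e + p * g) = int p * (2 * int b - 3 - 4 * int g)" for g
    using J by (simp add: algebra_simps)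
  have lt_iff: "h < J div 2 \<longleftrightarrow> 2 * int J - 3 - 4 * int h > 0" for h J
    by linarith
  have lt: "e + p * g < J div 2 \<longleftrightarrow> g < b div 2" for g
    unfolding lt_iff[of "e + p * g"] val lt_iff[of g b] using p_pos by (simp add: zero_less_mult_iff)
  show ?thesis
  proof (rule bij_betwI')
    fix g g' show "(e + p * g = e + p * g') = (g = g')" using p_gt_2 by auto
  next
    fix g assume "g \<in> {..<b div 2}"
    then show "e + p * g \<in> {h. h < J div 2 \<and> int p dvd 2 * int J - 3 - 4 * int h}"
      using lt val by simp
  next
    fix h assume h: "h \<in> {h. h < J div 2 \<and> int p dvd 2 * int J - 3 - 4 * int h}"
    have "2 * int J - 3 - 4 * int h = int p * (2 * int b - 3) + 4 * (int e - int h)"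
      using J by simp
    then have "int p dvd 4 * (int e - int h)"
      using h by (metis (no_types, lifting) dvd_add_right_iff dvd_triv_left mem_Collect_eq)
    then have "int p dvd int e - int h"
      using p_not_dvd_4 prime_dvd_mult_iff[OF prime_int_p] by blast
    then have "[int h = int e] (mod int p)"
      by (simp add: cong_iff_dvd_diff dvd_diff_commute)
    then have "h mod p = e" using e by (metis cong_def cong_int_iff mod_less)
    then have "h = e + p * (h div p)" by (metis add.commute mult_div_mod_eq)
    moreover from this have "h div p < b div 2" using h lt[of "h div p"] by simp
    ultimately show "\<exists>g\<in>{..<b div 2}. h = e + p * g" by blast
  qed
qed

lemma qfac_dissect:
  assumes J: "2 * int J - 3 = int p * (2 * int b - 3) + 4 * int e" and e: "e < p"
  shows "int (qfac J) = int p ^ (b div 2) * int (qfac b) * qfac_unit J"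
proof -
  let ?f = "\<lambda>h. 2 * int J - 3 - 4 * int h"
  let ?M = "{h. h < J div 2 \<and> int p dvd ?f h}"
  have "(\<Prod>h<J div 2. ?f h) = prod ?f ?M * qfac_unit J"
    unfolding qfac_unit_def by (subst prod.union_disjoint[symmetric]) (auto intro!: prod.cong)
  also have "prod ?f ?M = (\<Prod>g<b div 2. ?f (e + p * g))"
    by (rule prod.reindex_bij_betw[OF multiples_bij[OF assms], symmetric])
  also have "\<dots> = (\<Prod>g<b div 2. int p * (2 * int b - 3 - 4 * int g))"
    using J by (intro prod.cong) (simp_all add: algebra_simps)
  also have "\<dots> = int p ^ (b div 2) * int (qfac b)"
    by (simp add: prod.distrib qfac_prod)
  finally show ?thesis by (simp add: qfac_prod)
qed

text \<open>Counts the factors 4 that are extracted in \<open>qfac_unit_square_cong\<close>.\<close>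

lemma card_units_dissect:
  assumes J: "2 * int J - 3 = int p * (2 * int b - 3) + 4 * int e" and e: "e < p"
  shows "card {h. h < J div 2 \<and> \<not> int p dvd 2 * int J - 3 - 4 * int h} + b div 2 = J div 2"
proof -
  let ?f = "\<lambda>h. 2 * int J - 3 - 4 * int h"
  let ?M = "{h. h < J div 2 \<and> int p dvd ?f h}" and ?U = "{h. h < J div 2 \<and> \<not> int p dvd ?f h}"
  have "card ?M = b div 2"
    using bij_betw_same_card[OF multiples_bij[OF assms]] by simp
  moreover have "card (?U \<union> ?M) = card ?U + card ?M"
    by (rule card_Un_disjoint) auto
  moreover have "?U \<union> ?M = {..<J div 2}" by auto
  ultimately show ?thesis by simp
qed

text \<open>
  The multiples of \<open>p\<close> among the factors of \<open>qfac (p * a + x)\<close> are \<open>p\<close> times the factors of \<open>qfac (a + block_shift x)\<close>.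
\<close>

definition block_shift :: "nat \<Rightarrow> nat" where
  "block_shift x = (if even x then 1 else if 2 * x < p + 3 then 0 else 2)"

lemma block_shift_le: "block_shift x \<le> 2"
  by (simp add: block_shift_def)

lemma block_shift_parity: "even (block_shift x) \<longleftrightarrow> odd x"
  by (simp add: block_shift_def)

text \<open>The number E = 4e must be divisible by 4 and lie in [0, 4p). Since p is 3 modulo 4,
  divisibility forces a shift of parity opposite to x; for odd x the size condition chooses between
  0 and 2, with threshold 2x < p + 3.\<close>

lemma block_shift_dissect:
  assumes "x \<le> p + 1"
  obtains e where "e < p" "2 * int (p * a + x) - 3 = int p * (2 * int (a + block_shift x) - 3) + 4 * int e"
proof -
  define E where "E = 2 * int x - 3 - int p * (2 * int (block_shift x) - 3)"
  obtain q where q: "p = 4 * q + 3" using mod4 by (metis mult_div_mod_eq)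
  then have iq: "int p = 4 * int q + 3" by simp
  have "4 dvd E"
  proof (cases "even x")
    case True
    then obtain y where "x = 2 * y" by auto
    moreover have "block_shift x = 1" using True by (simp add: block_shift_def)
    ultimately have "E = 4 * (int y + int q)" by (simp add: E_def iq)
    then show ?thesis by simp
  next
    case False
    then obtain y where y: "x = 2 * y + 1" by (metis oddE)
    have "block_shift x = 0 \<or> block_shift x = 2" using False by (simp add: block_shift_def)
    then have "E = 2 * int x - 3 + 3 * int p \<or> E = 2 * int x - 3 - int p"
      by (auto simp: E_def)
    then have "E = 4 * (int y + 3 * int q + 2) \<or> E = 4 * (int y - int q - 1)"
      unfolding iq y by auto
    then show ?thesis by auto
  qed
  moreover have "E \<ge> 0" "E < 4 * int p"
    using assms p_gt_2 by (auto simp: E_def block_shift_def)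
  ultimately have e: "E = 4 * int (nat (E div 4))" "nat (E div 4) < p"
    by auto
  show ?thesis
    by (rule that[of "nat (E div 4)"]) (use e in \<open>auto simp: E_def algebra_simps\<close>)
qed

lemma kap_dissect:
  assumes r: "r < p" and s: "s \<le> 2"
  shows "kap s (p * a + r) = of_nat p powi (2 * int ((a + block_shift (r + s)) div 2) - 2 * int a)
     * kap (block_shift (r + s)) a * (of_int (qfac_unit (p * a + r + s)) / of_int (pfact (p * a + r)))\<^sup>2"
proof -
  let ?t = "block_shift (r + s)"
  obtain e where e: "e < p" "2 * int (p * a + (r + s)) - 3 = int p * (2 * int (a + ?t) - 3) + 4 * int e"
    using block_shift_dissect[of "r + s" a] r s by auto
  have q: "(of_nat (qfac (p * a + r + s)) :: rat)
    = of_nat p ^ ((a + ?t) div 2) * of_nat (qfac (a + ?t)) * of_int (qfac_unit (p * a + r + s))"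
    using arg_cong[OF qfac_dissect[OF e(2,1)], of rat_of_int] by (simp add: add.assoc)
  have d: "(p * a + r) div p = a" using r by simp
  have f: "(fact (p * a + r) :: rat) = of_nat p ^ a * fact a * of_int (pfact (p * a + r))"
    using arg_cong[OF fact_pfact[of "p * a + r"], of rat_of_int] by (simp add: d)
  have pw: "of_nat p powi (2 * int m - 2 * int a) = (of_nat p ^ m / of_nat p ^ a :: rat)\<^sup>2" for m
  proof -
    have "(of_nat p :: rat) powi (2 * int m - 2 * int a) = of_nat p powi (int (2 * m) - int (2 * a))"
      by simp
    also have "\<dots> = of_nat p ^ (2 * m) / of_nat p ^ (2 * a)"
      by (subst power_int_diff) (simp_all only: power_int_of_nat, simp)
    finally show ?thesis by (simp only: power_even_eq power_divide)
  qed
  show ?thesis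
    unfolding kap_def q f pw by (simp add: power_divide power_mult_distrib)
qed

text \<open>For J = 2H + d the consecutive factors end just above a point congruent to (2d + 1) lam
  - 1, whose squared \<open>pfact\<close> is the denominator of the product, moved to the left side.
  The factor \<open>16 ^ d\<close> makes the exponent of 4 equal to J + 1 - b for both
  parities.\<close>

definition par_const :: "nat \<Rightarrow> nat \<Rightarrow> int" where
  "par_const lam d = 16 ^ d * pfact ((2 * d + 1) * lam - 1) ^ 2"

lemma pfact_quot:
  "H \<le> z \<Longrightarrow> (\<Prod>h | h < H \<and> \<not> int p dvd int z - int h. int z - int h) * pfact (z - H) = pfact z"
proof (induction H)
  case (Suc H)
  let ?S = "\<lambda>H. {h. h < H \<and> \<not> int p dvd int z - int h}"
  have d: "int z - int H = int (Suc (z - Suc H))" using Suc.prems by simp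
  have dv: "int p dvd int z - int H \<longleftrightarrow> p dvd Suc (z - Suc H)"
    unfolding d of_nat_dvd_iff ..
  have z: "z - H = Suc (z - Suc H)" using Suc.prems by simp
  have S: "?S (Suc H) = (if p dvd Suc (z - Suc H) then ?S H else insert H (?S H))"
    using dv by (auto simp: less_Suc_eq)
  have IH: "prod (\<lambda>h. int z - int h) (?S H) * pfact (Suc (z - Suc H)) = pfact z"
    using Suc z by simp
  show ?case
  proof (cases "p dvd Suc (z - Suc H)")
    case True
    then show ?thesis using IH unfolding S pfact_Suc by simp
  next
    case False
    then show ?thesis using IH unfolding S pfact_Suc by (simp add: d mult_ac del: of_nat_Suc)
  qed
qed simp

text \<open>
  Dividing the progression by 4 modulo \<open>p ^ k\<close> makes its terms consecutive.  Even and odd \<open>J\<close> start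
  at different points, which only contributes the constants \<open>par_const\<close>.
\<close>

lemma qfac_unit_square_cong:
  assumes k: "k > 0" and lam: "4 * lam = 1 + w * p ^ k" "lam > 0"
    and J: "2 * int J - 3 = int p * (2 * int b - 3) + 4 * int e" and e: "e < p" and bJ: "odd (b + J)" "b \<le> J + 1"
  shows "[par_const lam (J mod 2) * qfac_unit J ^ 2 = 4 ^ (J + 1 - b) * pfact (2 * lam * J + lam - 1) ^ 2] (mod int p ^ k)"
proof -
  define H where "H = J div 2"
  define d where "d = J mod 2"
  have JH: "J = 2 * H + d" by (simp add: H_def d_def)
  \<comment> \<open>\<open>z\<close> represents (2J - 3) / 4 modulo \<open>p ^ k\<close>, so the
    factor with number h becomes 4 (z - h).\<close>
  define z where "z = 2 * lam * J + lam - 1"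
  have zH: "z = H + (H * w * p ^ k + ((2 * d + 1) * lam - 1))"
  proof -
    have "z + 1 = 4 * lam * H + (2 * d + 1) * lam"
      using lam(2) by (simp add: z_def JH algebra_simps)
    also have "4 * lam * H = H + H * w * p ^ k" unfolding lam(1) by (simp add: algebra_simps)
    finally show ?thesis using lam(2) by simp
  qed
  let ?f = "\<lambda>h. 2 * int J - 3 - 4 * int h" and ?g = "\<lambda>h. int z - int h"
  have fg: "[?f h = 4 * ?g h] (mod int p ^ k)" for h
  proof -
    have L: "4 * int lam = 1 + int w * int p ^ k"
      using arg_cong[OF lam(1), of int] by simp
    have "int z = 2 * int lam * int J + int lam - 1"
      using lam(2) by (simp add: z_def of_nat_diff)
    then have "4 * ?g h - ?f h = (4 * int lam - 1) * (2 * int J + 1)"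
      by (simp add: algebra_simps)
    also have "\<dots> = int p ^ k * (int w * (2 * int J + 1))"
      using L by simp
    finally show ?thesis by (metis cong_iff_dvd_diff cong_sym dvd_triv_left)
  qed
  have dv: "int p dvd ?f h \<longleftrightarrow> int p dvd ?g h" for h
  proof -
    have "[?f h = 4 * ?g h] (mod int p)"
      using fg k by (meson cong_dvd_modulus dvd_power)
    then have "int p dvd ?f h \<longleftrightarrow> int p dvd 4 * ?g h" by (rule cong_dvd_iff)
    also have "\<dots> \<longleftrightarrow> int p dvd 4 \<or> int p dvd ?g h"
      by (rule prime_dvd_mult_iff[OF prime_int_p])
    finally show ?thesis using p_not_dvd_4 by blast
  qed
  let ?U = "{h. h < H \<and> \<not> int p dvd ?g h}"
  define n where "n = card ?U"
  have n: "n + b div 2 = H"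
    using card_units_dissect[OF J e] by (simp add: n_def H_def dv)
  have "qfac_unit J = prod ?f ?U" by (simp add: qfac_unit_def H_def dv)
  also have "[\<dots> = (\<Prod>h\<in>?U. 4 * ?g h)] (mod int p ^ k)"
    by (rule cong_prod) (rule fg)
  also have "(\<Prod>h\<in>?U. 4 * ?g h) = 4 ^ n * prod ?g ?U"
    by (simp only: prod.distrib prod_constant n_def)
  finally have "[qfac_unit J * pfact (z - H) = 4 ^ n * prod ?g ?U * pfact (z - H)] (mod int p ^ k)"
    by (intro cong_mult cong_refl)
  also have "4 ^ n * prod ?g ?U * pfact (z - H) = 4 ^ n * pfact z"
    using pfact_quot[of H z] zH by (simp add: mult.assoc)
  finally have "[(qfac_unit J * pfact (z - H)) ^ 2 = (4 ^ n * pfact z) ^ 2] (mod int p ^ k)"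
    by (rule cong_pow)
  then have *: "[pfact (z - H) ^ 2 * qfac_unit J ^ 2 = 16 ^ n * pfact z ^ 2] (mod int p ^ k)"
  proof -
    have "(4 ^ n) ^ 2 = (16 ^ n :: int)"
      by (simp add: power2_eq_square flip: power_mult_distrib)
    with \<open>[(qfac_unit J * pfact (z - H)) ^ 2 = (4 ^ n * pfact z) ^ 2] (mod int p ^ k)\<close> show ?thesis
      by (simp only: power_mult_distrib mult.commute)
  qed
  have "[pfact (z - H) ^ 2 = pfact ((2 * d + 1) * lam - 1) ^ 2] (mod int p ^ k)"
    using pfact_square_periodic[OF k, of "H * w" "(2 * d + 1) * lam - 1"] by (simp add: zH)
  then have "[par_const lam d * qfac_unit J ^ 2 = 16 ^ d * (pfact (z - H) ^ 2 * qfac_unit J ^ 2)] (mod int p ^ k)"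
    unfolding par_const_def mult.assoc by (intro cong_mult cong_refl) (rule cong_sym)
  also have "[16 ^ d * (pfact (z - H) ^ 2 * qfac_unit J ^ 2) = 16 ^ d * (16 ^ n * pfact z ^ 2)] (mod int p ^ k)"
    by (intro cong_mult * cong_refl)
  also have "16 ^ d * (16 ^ n * pfact z ^ 2) = 4 ^ (2 * (d + n)) * pfact z ^ 2"
    by (simp add: power_add power_mult)
  also have "2 * (d + n) = J + 1 - b"
  proof -
    have "b = 2 * (b div 2) + b mod 2" by simp
    moreover have "b mod 2 + d = 1" using bJ(1) unfolding d_def by presburger
    ultimately obtain c m where "b = 2 * c + m" "m + d = 1" "n + c = H"
      using n by blast
    then have "J + 1 = b + 2 * (d + n)"
      unfolding JH by auto
    then show ?thesis by simp
  qed
  finally show ?thesis by (simp add: d_def z_def)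
qed

end

section \<open>Alternating sums over residue classes\<close>

lemma cong_poly_int: "[x = y] (mod m) \<Longrightarrow> [poly P x = poly P y] (mod (m::int))"
  by (induction P) (auto intro!: cong_add cong_mult)

lemma altsum_add: "altsum s t A (F + H) = altsum s t A F + altsum s t A H"
  by (simp add: altsum_def algebra_simps sum.distrib)

lemma altsum_smult: "altsum s t A (Polynomial.smult c F) = of_int c * altsum s t A F"
  by (simp add: altsum_def algebra_simps sum_distrib_left)

lemma altsum_reflect:
  "altsum s t A F = (- 1) ^ A * altsum t s A (pcompose F [:0, - 1:])"
proof -
  have "altsum s t A F = (\<Sum>a\<le>A. (- 1) ^ (A - a) * of_int (poly F (ybal s t A (A - a))) * kap s (A - a) * kap t a)"
    unfolding altsum_def
    by (rule sum.reindex_bij_witness[where i = "\<lambda>a. A - a" and j = "\<lambda>a. A - a"]) auto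
  also have "\<dots> = (\<Sum>a\<le>A. (- 1) ^ A * ((- 1) ^ a * of_int (poly (pcompose F [:0, - 1:]) (ybal t s A a)) * kap t a * kap s (A - a)))"
  proof (rule sum.cong[OF refl])
    fix a assume "a \<in> {..A}"
    then have a: "a \<le> A" by simp
    then have "(- 1 :: rat) ^ (A - a) = (- 1) ^ A * (- 1) ^ a"
      by (metis (no_types) minus_one_power_iff even_add even_diff_nat le_add_diff_inverse2 mult_minus1 mult_1 minus_minus not_less linorder_not_le)
    moreover have "ybal s t A (A - a) = - ybal t s A a"
      using a by (simp add: ybal_def of_nat_diff)
    ultimately show "(- 1) ^ (A - a) * of_int (poly F (ybal s t A (A - a))) * kap s (A - a) * kap t a =
      (- 1) ^ A * ((- 1) ^ a * of_int (poly (pcompose F [:0, - 1:]) (ybal t s A a)) * kap t a * kap s (A - a))"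
      by (simp add: poly_pcompose mult_ac)
  qed
  finally show ?thesis
    by (simp add: altsum_def sum_distrib_left)
qed

lemma altsum_even_eq_0:
  assumes "odd A" "pcompose F [:0, - 1:] = F"
  shows "altsum t t A F = 0"
  using altsum_reflect[of t t A F] assms by simp

lemma altsum_const_eq_0: "odd A \<Longrightarrow> altsum t t A [:c:] = 0"
  by (rule altsum_even_eq_0) simp_all

lemma altsum_square_eq_0: "odd A \<Longrightarrow> altsum t t A [:0, 0, c:] = 0"
  by (rule altsum_even_eq_0) (simp_all add: pcompose_pCons)

text \<open>The terms of degree 0 and 2 vanish by symmetry. Everything of degree at least 3 stays
  together, because one bound will cover it.\<close>

lemma altsum_decomp:
  assumes "odd A"
  shows "altsum t t A (pCons c0 (pCons c1 (pCons c2 F)))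
     = of_int c1 * altsum t t A [:0, 1:] + altsum t t A (pCons 0 (pCons 0 (pCons 0 F)))"
proof -
  have "pCons c0 (pCons c1 (pCons c2 F)) = [:c0:] + Polynomial.smult c1 [:0, 1:] + [:0, 0, c2:] + pCons 0 (pCons 0 (pCons 0 F))"
    by simp
  then show ?thesis
    using assms by (simp only: altsum_add altsum_smult) (simp add: altsum_const_eq_0 altsum_square_eq_0)
qed

lemma kap_Suc_shift: "kap (Suc t) a = (of_nat a + 1)\<^sup>2 * kap t (Suc a)"
  by (simp add: kap_def power_divide power_mult_distrib divide_simps add.commute)

text \<open>Converts an unbalanced sum into a balanced one, where symmetry is available: by
  \<open>kap_Suc_shift\<close> the larger shift costs the square of A - a + 1, which is half of A +
  1 + Y, and the additional term a = A + 1 has weight 0.\<close>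

lemma altsum_shift:
  "4 * altsum t (Suc t) A H = altsum t t (Suc A) (H * [:int (Suc A), 1:]\<^sup>2)"
proof -
  let ?f = "\<lambda>a. (- 1) ^ a * of_int (poly (H * [:int (Suc A), 1:]\<^sup>2) (ybal t t (Suc A) a)) * kap t a * kap t (Suc A - a) :: rat"
  have y: "ybal t t (Suc A) a = ybal t (Suc t) A a" "int (Suc A) + ybal t t (Suc A) a = 2 * (int A - int a + 1)" for a
    by (simp_all add: ybal_def)
  have "4 * ((- 1) ^ a * of_int (poly H (ybal t (Suc t) A a)) * kap t a * kap (Suc t) (A - a)) = ?f a" if "a \<le> A" for a
  proof -
    define z where "z = int A - int a + 1"
    have "poly (H * [:int (Suc A), 1:]\<^sup>2) (ybal t t (Suc A) a) = poly H (ybal t (Suc t) A a) * (int (Suc A) + ybal t t (Suc A) a)\<^sup>2"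
      unfolding y(1) by (simp add: poly_power)
    also have "\<dots> = poly H (ybal t (Suc t) A a) * (2 * z)\<^sup>2"
      unfolding y(2) z_def ..
    finally have 1: "poly (H * [:int (Suc A), 1:]\<^sup>2) (ybal t t (Suc A) a) = poly H (ybal t (Suc t) A a) * (2 * z)\<^sup>2" .
    have 2: "kap (Suc t) (A - a) = (of_int z)\<^sup>2 * kap t (Suc A - a)"
      using that by (simp add: kap_Suc_shift Suc_diff_le of_nat_diff z_def)
    show ?thesis
      unfolding 1 2 by (simp add: power_mult_distrib)
  qed
  then have "4 * altsum t (Suc t) A H = (\<Sum>a\<le>A. ?f a)"
    unfolding altsum_def sum_distrib_left by (intro sum.cong refl) (simp only: atMost_iff)
  moreover have "?f (Suc A) = 0"
    using y(2)[of "Suc A"] by (simp add: poly_power)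
  ultimately show ?thesis
    by (simp add: altsum_def)
qed

lemma sum_residue_classes:
  fixes g :: "nat \<Rightarrow> 'a :: comm_monoid_add"
  assumes "p > 0"
  shows "(\<Sum>j\<le>N. g j) = (\<Sum>r<p. \<Sum>a | p * a + r \<le> N. g (p * a + r))"
proof -
  have fin: "finite {a. p * a + r \<le> N}" for r
  proof (rule finite_subset)
    show "{a. p * a + r \<le> N} \<subseteq> {..N}"
    proof (rule subsetI)
      fix a assume "a \<in> {a. p * a + r \<le> N}"
      then have "p * a + r \<le> N" by simp
      moreover have "1 * a \<le> p * a" using assms by (intro mult_right_mono) simp_all
      ultimately show "a \<in> {..N}" unfolding atMost_iff by linarith
    qed
  qed simp
  have "(\<Sum>r<p. \<Sum>a | p * a + r \<le> N. g (p * a + r)) = (\<Sum>(r, a)\<in>(SIGMA r:{..<p}. {a. p * a + r \<le> N}). g (p * a + r))"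
    by (rule sum.Sigma) (use fin in auto)
  also have "\<dots> = (\<Sum>j\<le>N. g j)"
    by (rule sum.reindex_bij_witness[where i = "\<lambda>j. (j mod p, j div p)" and j = "\<lambda>(r, a). p * a + r"])
      (use assms in auto)
  finally show ?thesis ..
qed

lemma residue_index_set:
  fixes p r r' B :: nat
  assumes "r' < p"
  shows "{a. p * a + r \<le> p * B + r + r'} = {..B}"
proof -
  have "p * a \<le> p * B + r' \<longleftrightarrow> a \<le> B" for a
  proof
    assume "p * a \<le> p * B + r'"
    then have "p * a < p * Suc B" using assms by simp
    then show "a \<le> B" using assms by (metis less_Suc_eq_le mult_less_cancel1)
  next
    assume "a \<le> B"
    then show "p * a \<le> p * B + r'" by (simp add: trans_le_add1)
  qed
  then show ?thesis by (auto simp: add.commute add.left_commute)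
qed

context prime3
begin

definition unit_part :: "nat \<Rightarrow> nat \<Rightarrow> nat \<Rightarrow> rat" where
  "unit_part s r a = (of_int (qfac_unit (p * a + r + s)) / of_int (pfact (p * a + r)))\<^sup>2"

lemma pdv_unit_part: "pdv 0 (unit_part s r a)"
  unfolding unit_part_def power2_eq_square
  using pdv_mult[of 0 _ 0] pdv_unit[OF p_not_dvd_pfact] by fastforce

lemma inverse_of_4_mod_power: "\<exists>lam w. 4 * lam = 1 + w * p ^ k \<and> lam > 0"
proof -
  have "p ^ k mod 4 = 1 \<or> p ^ k mod 4 = 3"
  proof (induction k)
    case (Suc k)
    have "p ^ Suc k mod 4 = (p mod 4) * (p ^ k mod 4) mod 4" by (simp add: mod_mult_eq)
    then show ?case using Suc mod4 by auto
  qed simp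
  then show ?thesis
  proof
    assume "p ^ k mod 4 = 1"
    then have "4 dvd 1 + 3 * p ^ k" by presburger
    then obtain lam where "1 + 3 * p ^ k = 4 * lam" by auto
    then show ?thesis by (intro exI[of _ lam] exI[of _ 3]) auto
  next
    assume "p ^ k mod 4 = 3"
    then have "4 dvd 1 + 1 * p ^ k" by presburger
    then obtain lam where "1 + 1 * p ^ k = 4 * lam" by auto
    then show ?thesis by (intro exI[of _ lam] exI[of _ 1]) auto
  qed
qed

text \<open>\<open>K\<close> clears the constants \<open>par_const\<close>. It is chosen before
  \<open>r\<close> and \<open>s\<close> because units belonging to two different residues are
  multiplied in \<open>unit_part_pair_poly\<close>.\<close>

lemma unit_part_cub:
  assumes k: "k > 0"
  shows "\<exists>K :: nat \<Rightarrow> int. (\<forall>d. \<not> int p dvd K d) \<and>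
    (\<forall>r s. r < p \<longrightarrow> s \<le> 2 \<longrightarrow> (\<exists>f. cub k f \<and>
       (\<forall>a. pdv (int k) (of_int (K ((p * a + r + s) mod 2)) * unit_part s r a - of_int (f a)))))"
proof -
  obtain lam w where lam: "4 * lam = 1 + w * p ^ k" "lam > 0"
    using inverse_of_4_mod_power by blast
  define K where "K = par_const lam"
  have "\<not> int p dvd 16"
    using p_not_dvd_mult[OF p_not_dvd_4 p_not_dvd_4] by simp
  then have K: "\<not> int p dvd K d" for d
    unfolding K_def par_const_def
    by (intro p_not_dvd_mult p_not_dvd_power p_not_dvd_pfact)
  have "\<exists>f. cub k f \<and> (\<forall>a. pdv (int k) (of_int (K ((p * a + r + s) mod 2)) * unit_part s r a - of_int (f a)))"
    if r: "r < p" and s: "s \<le> 2" for r s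
  proof -
    let ?t = "block_shift (r + s)"
    define h where "h a = 4 ^ ((p - 1) * a) * 4 ^ (r + s + 1 - ?t) * pfact (p * (2 * lam * a) + (2 * lam * (r + s) + lam - 1)) ^ 2" for a
    have "cub k (\<lambda>a. pfact (p * (2 * lam * a + 0) + (2 * lam * (r + s) + lam - 1)) ^ 2)"
      by (rule cub_affine[OF cub_pfact_square])
    then have ch: "cub k h"
      unfolding h_def by (intro cub_mult cub_power_4 cub_const) simp
    have "\<not> int p dvd pfact (p * a + r) ^ 2" for a
      by (intro p_not_dvd_power p_not_dvd_pfact)
    then obtain g where g: "cub k g" "\<And>a. [pfact (p * a + r) ^ 2 * g a = 1] (mod int p ^ k)"
      using cub_inverse[OF cub_pfact_square[of k r]] by blast
    have main: "pdv (int k) (of_int (K ((p * a + r + s) mod 2)) * unit_part s r a - of_int (h a * g a))" for a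
    proof -
      let ?J = "p * a + r + s"
      let ?b = "a + ?t"
      obtain e where e: "e < p" "2 * int ?J - 3 = int p * (2 * int ?b - 3) + 4 * int e"
        using block_shift_dissect[of "r + s" a] r s by (auto simp: add.assoc)
      have tle: "?t \<le> r + s + 1" by (auto simp: block_shift_def intro: Suc_leI odd_pos)
      have expo: "?J + 1 - ?b = (p - 1) * a + (r + s + 1 - ?t)"
        and ble: "?b \<le> ?J + 1"
      proof -
        obtain q where q: "p = Suc q" using p_gt_2 by (cases p) auto
        show "?J + 1 - ?b = (p - 1) * a + (r + s + 1 - ?t)" "?b \<le> ?J + 1"
          using tle by (simp_all add: q)
      qed
      have "odd (?b + ?J)"
        using block_shift_parity[of "r + s"] p_odd by auto
      then have "[K (?J mod 2) * qfac_unit ?J ^ 2 = 4 ^ (?J + 1 - ?b) * pfact (2 * lam * ?J + lam - 1) ^ 2] (mod int p ^ k)"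
        unfolding K_def by (intro qfac_unit_square_cong[OF k lam e(2,1)] ble)
      also have "2 * lam * ?J + lam - 1 = p * (2 * lam * a) + (2 * lam * (r + s) + lam - 1)"
        using lam(2) by (simp add: algebra_simps)
      also have "4 ^ (?J + 1 - ?b) * pfact (p * (2 * lam * a) + (2 * lam * (r + s) + lam - 1)) ^ 2 = h a"
        by (simp only: expo h_def power_add)
      finally have 1: "[K (?J mod 2) * qfac_unit ?J ^ 2 = h a * 1] (mod int p ^ k)" by simp
      have "[h a * 1 = h a * (pfact (p * a + r) ^ 2 * g a)] (mod int p ^ k)"
        by (intro cong_mult cong_refl cong_sym[OF g(2)])
      with 1 have "[K (?J mod 2) * qfac_unit ?J ^ 2 = h a * (pfact (p * a + r) ^ 2 * g a)] (mod int p ^ k)"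
        by (rule cong_trans)
      then have "int p ^ k dvd K (?J mod 2) * qfac_unit ?J ^ 2 - h a * g a * pfact (p * a + r) ^ 2"
        by (simp add: cong_iff_dvd_diff mult_ac)
      then have "pdv (int k + 0) (of_int (K (?J mod 2) * qfac_unit ?J ^ 2 - h a * g a * pfact (p * a + r) ^ 2) * (of_int 1 / of_int (pfact (p * a + r) ^ 2)))"
        by (intro pdv_mult pdv_unit p_not_dvd_power p_not_dvd_pfact) (simp only: pdv_of_int_iff)
      moreover have "pfact (p * a + r) \<noteq> 0"
        using p_not_dvd_pfact not_dvd_nonzero by blast
      ultimately show ?thesis
        by (simp add: unit_part_def power_divide field_simps)
    qed
    show ?thesis
      by (intro exI[of _ "\<lambda>a. h a * g a"] conjI allI cub_mult ch g(1) main)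
  qed
  then show ?thesis using K by blast
qed

text \<open>As 2 is invertible modulo \<open>p ^ k\<close>, both a and B - a are linear in Y = B -
  2a + c.\<close>

lemma cub_complement:
  assumes "cub k f" "cub k f'"
  shows "\<exists>h0 h1. \<forall>a\<le>B. [f a * f' (B - a) = poly ([:h0:] + Polynomial.smult (int p) h1) (int B - 2 * int a + c)] (mod int p ^ k)"
proof -
  have "\<exists>c0 P. \<forall>a. [f a = c0 + int p * poly P (int a)] (mod int p ^ k)" if cub: "cub k f" for f
  proof -
    obtain c0 ea eb g where g: "\<And>a. [f a = c0 + int p * (ea * int a + eb * int a ^ 3) + int p ^ 2 * poly g (int a)] (mod int p ^ k)"
      using cub unfolding cub_def by blast
    have "c0 + int p * (ea * x + eb * x ^ 3) + int p ^ 2 * poly g x = c0 + int p * poly ([:0, ea, 0, eb:] + Polynomial.smult (int p) g) x" for x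
      by (simp add: algebra_simps power2_eq_square power3_eq_cube)
    then show ?thesis using g by metis
  qed
  then obtain c0 P c1 P' where P: "\<And>a. [f a = c0 + int p * poly P (int a)] (mod int p ^ k)"
    and P': "\<And>a. [f' a = c1 + int p * poly P' (int a)] (mod int p ^ k)"
    using assms by meson
  have "\<not> int p dvd 2" using p_not_dvd_4 by (metis dvd_trans dvd_triv_left mult_2 numeral_Bit0)
  then obtain h where h: "[2 * h = 1] (mod int p ^ k)"
    using unit_inverse_mod by blast
  define R where "R = pcompose P [:h * (int B + c), - h:]"
  define R' where "R' = pcompose P' [:h * (int B - c), h:]"
  have "[f a * f' (B - a) = poly ([:c0 * c1:] + Polynomial.smult (int p) (Polynomial.smult c0 R' + Polynomial.smult c1 R + Polynomial.smult (int p) (R * R'))) (int B - 2 * int a + c)] (mod int p ^ k)"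
    if a: "a \<le> B" for a
  proof -
    let ?Y = "int B - 2 * int a + c"
    have "[int a = (2 * h) * int a] (mod int p ^ k)"
      using cong_mult[OF h cong_refl, of "int a"] by (simp add: cong_sym_eq)
    also have "(2 * h) * int a = h * (int B + c) + ?Y * - h"
      by (simp add: algebra_simps)
    finally have "[poly P (int a) = poly R ?Y] (mod int p ^ k)"
      unfolding R_def poly_pcompose by (intro cong_poly_int) simp
    then have 1: "[f a = c0 + int p * poly R ?Y] (mod int p ^ k)"
      using P[of a] by (meson cong_add cong_mult cong_refl cong_trans)
    have "[int (B - a) = (2 * h) * int (B - a)] (mod int p ^ k)"
      using cong_mult[OF h cong_refl, of "int (B - a)"] by (simp add: cong_sym_eq)
    also have "(2 * h) * int (B - a) = h * (int B - c) + ?Y * h"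
      using a by (simp add: algebra_simps of_nat_diff)
    finally have "[poly P' (int (B - a)) = poly R' ?Y] (mod int p ^ k)"
      unfolding R'_def poly_pcompose by (intro cong_poly_int) simp
    then have 2: "[f' (B - a) = c1 + int p * poly R' ?Y] (mod int p ^ k)"
      using P'[of "B - a"] by (meson cong_add cong_mult cong_refl cong_trans)
    have "(c0 + int p * poly R ?Y) * (c1 + int p * poly R' ?Y) =
      poly ([:c0 * c1:] + Polynomial.smult (int p) (Polynomial.smult c0 R' + Polynomial.smult c1 R + Polynomial.smult (int p) (R * R'))) ?Y"
      by (simp add: algebra_simps)
    then show ?thesis using cong_mult[OF 1 2] by simp
  qed
  then show ?thesis by blast
qed

text \<open>One more power of p than in \<open>cub_complement\<close>: the linear terms add up to ea
  B, and a^3 + (B - a)^3 = B^3 - 3 B a (B - a), where 3 eb is divisible by p.\<close>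

lemma cub_complement_same:
  assumes "cub k f"
  shows "\<exists>h0 h1. \<forall>a\<le>B. [f a * f (B - a) = poly ([:h0:] + Polynomial.smult (int p ^ 2) h1) (int B - 2 * int a)] (mod int p ^ k)"
proof -
  obtain c ea eb g where eb: "int p dvd 3 * eb"
    and g: "\<And>a. [f a = c + int p * (ea * int a + eb * int a ^ 3) + int p ^ 2 * poly g (int a)] (mod int p ^ k)"
    using assms unfolding cub_def by blast
  from eb obtain d where d: "3 * eb = int p * d" by auto
  have "\<not> int p dvd 2" using p_not_dvd_4 by (metis dvd_trans dvd_triv_left mult_2 numeral_Bit0)
  then obtain h where h: "[2 * h = 1] (mod int p ^ k)"
    using unit_inverse_mod by blast
  let ?B = "int B"
  define L where "L = [:0, ea, 0, eb:]"
  have L: "poly L x = ea * x + eb * x ^ 3" for x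
    by (simp add: L_def algebra_simps power3_eq_cube)
  define X where "X = [:h * ?B, - h:]"
  define X' where "X' = [:h * ?B, h:]"
  define E where "E = pcompose L X * pcompose L X'
     + Polynomial.smult c (pcompose g X + pcompose g X') + Polynomial.smult (int p) (pcompose L X * pcompose g X' + pcompose L X' * pcompose g X)
     + Polynomial.smult (int p ^ 2) (pcompose g X * pcompose g X') - Polynomial.smult (c * d * ?B) (X * X')"
  define h0 where "h0 = c\<^sup>2 + int p * c * (ea * ?B + eb * ?B ^ 3)"
  have "[f a * f (B - a) = poly ([:h0:] + Polynomial.smult (int p ^ 2) E) (int B - 2 * int a)] (mod int p ^ k)"
    if a: "a \<le> B" for a
  proof -
    let ?Y = "int B - 2 * int a"
    define x where "x = poly X ?Y"
    define x' where "x' = poly X' ?Y"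
    \<comment> \<open>\<open>x\<close> and \<open>x'\<close> are the polynomials in Y standing for a
      and B - a. Their sum is B only modulo \<open>p ^ k\<close>, so the cancellation below leaves a
      multiple of x + x' - B.\<close>
    have xx: "[x + x' = ?B] (mod int p ^ k)"
    proof -
      have "x + x' = 2 * h * ?B" by (simp add: x_def x'_def X_def X'_def algebra_simps)
      then show ?thesis using cong_mult[OF h cong_refl, of ?B] by simp
    qed
    have "[int a = (2 * h) * int a] (mod int p ^ k)"
      using cong_mult[OF h cong_refl, of "int a"] by (simp add: cong_sym_eq)
    also have "(2 * h) * int a = x"
      by (simp add: x_def X_def algebra_simps)
    finally have ax: "[int a = x] (mod int p ^ k)" .
    have "[int (B - a) = (2 * h) * int (B - a)] (mod int p ^ k)"
      using cong_mult[OF h cong_refl, of "int (B - a)"] by (simp add: cong_sym_eq)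
    also have "(2 * h) * int (B - a) = x'"
      using a by (simp add: x'_def X'_def algebra_simps of_nat_diff)
    finally have bx: "[int (B - a) = x'] (mod int p ^ k)" .
    define F where "F = [:c:] + Polynomial.smult (int p) L + Polynomial.smult (int p ^ 2) g"
    have F: "poly F y = c + int p * poly L y + int p ^ 2 * poly g y" for y
      by (simp add: F_def)
    have fF: "[f b = poly F (int b)] (mod int p ^ k)" for b
      using g[of b] by (simp add: F L)
    have 1: "[f a = poly F x] (mod int p ^ k)"
      by (rule cong_trans[OF fF cong_poly_int[OF ax]])
    have 2: "[f (B - a) = poly F x'] (mod int p ^ k)"
      by (rule cong_trans[OF fF cong_poly_int[OF bx]])
    have PE: "poly E ?Y = poly L x * poly L x' + c * (poly g x + poly g x') + int p * (poly L x * poly g x' + poly L x' * poly g x)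
      + int p ^ 2 * (poly g x * poly g x') - c * d * ?B * (x * x')"
      by (simp add: E_def poly_pcompose x_def x'_def)
    have "poly F x * poly F x' - poly ([:h0:] + Polynomial.smult (int p ^ 2) E) ?Y
      = int p * c * (poly L x + poly L x' - (ea * ?B + eb * ?B ^ 3) + int p * d * ?B * (x * x'))"
      unfolding F poly_add poly_smult h0_def PE
      by (simp only: poly_pCons poly_0 mult_zero_right add_0_right) Groebner_Basis.algebra
    also have "poly L x + poly L x' - (ea * ?B + eb * ?B ^ 3) + int p * d * ?B * (x * x')
      = (x + x' - ?B) * (ea + eb * ((x + x')\<^sup>2 + (x + x') * ?B + ?B\<^sup>2) - int p * d * (x * x'))"
      unfolding L using d by Groebner_Basis.algebra
    finally have "int p ^ k dvd poly F x * poly F x' - poly ([:h0:] + Polynomial.smult (int p ^ 2) E) ?Y"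
      using xx by (simp add: cong_iff_dvd_diff)
    then have "[poly F x * poly F x' = poly ([:h0:] + Polynomial.smult (int p ^ 2) E) ?Y] (mod int p ^ k)"
      by (simp add: cong_iff_dvd_diff)
    then show ?thesis by (rule cong_trans[OF cong_mult[OF 1 2]])
  qed
  then show ?thesis by blast
qed

section \<open>A residue class as an alternating sum for N / p\<close>

definition altterm :: "nat \<Rightarrow> nat \<Rightarrow> nat \<Rightarrow> int poly \<Rightarrow> nat \<Rightarrow> rat" where
  "altterm s s' N F j = (- 1) ^ j * of_int (poly F (ybal s s' N j)) * kap s j * kap s' (N - j)"

text \<open>Exactly one of \<open>a + t\<close> and \<open>B - a + t'\<close> is odd, so the two
  halvings in \<open>kap_dissect\<close> together lose 1 and the power of p does not depend on a.
  The distance from the centre becomes x0 + p Y.\<close>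

lemma altterm_dissect:
  assumes r: "r < p" "r' < p" and s: "s \<le> 2" "s' \<le> 2" and N: "N = p * B + r + r'" and odd: "odd (N + s + s')"
    and a: "a \<le> B" and t: "t = block_shift (r + s)" "t' = block_shift (r' + s')"
    and x0: "x0 = int (r' + s') - int (r + s) - int p * (int t' - int t)"
  shows "altterm s s' N F (p * a + r) = (- 1) ^ r * of_nat p powi (int t + int t' - 1 - int B) *
     ((- 1) ^ a * of_int (poly (pcompose F [:x0, int p:]) (ybal t t' B a)) * kap t a * kap t' (B - a)
       * (unit_part s r a * unit_part s' r' (B - a)))"
proof -
  have NJ: "N - (p * a + r) = p * (B - a) + r'"
    using a by (simp add: N diff_mult_distrib2)
  have sgn: "(- 1 :: rat) ^ (p * a + r) = (- 1) ^ r * (- 1) ^ a"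
    using p_odd by (simp add: power_add power_mult)
  have y: "ybal s s' N (p * a + r) = x0 + int p * ybal t t' B a"
    by (simp add: ybal_def N x0 algebra_simps)
  have "odd (B + t + t')"
    using odd p_odd block_shift_parity[of "r + s"] block_shift_parity[of "r' + s'"] by (auto simp: N t)
  moreover have "(a + t) + (B - a + t') = B + t + t'" using a by simp
  ultimately have "odd ((a + t) + (B - a + t'))" by metis
  then have "2 * ((a + t) div 2) + 2 * ((B - a + t') div 2) + 1 = (a + t) + (B - a + t')"
    by presburger
  then have "2 * int ((a + t) div 2) + 2 * int ((B - a + t') div 2) + 1 = int t + int t' + int B"
    using a by linarith
  then have e: "(2 * int ((a + t) div 2) - 2 * int a) + (2 * int ((B - a + t') div 2) - 2 * int (B - a)) = int t + int t' - 1 - int B"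
    using a by (simp add: of_nat_diff)
  have "of_nat p powi (2 * int ((a + t) div 2) - 2 * int a) * of_nat p powi (2 * int ((B - a + t') div 2) - 2 * int (B - a))
     = (of_nat p powi (int t + int t' - 1 - int B) :: rat)"
    unfolding e[symmetric] by (simp add: power_int_add)
  then show ?thesis
    unfolding altterm_def NJ sgn y kap_dissect[OF r(1) s(1)] kap_dissect[OF r(2) s(2)] unit_part_def t[symmetric]
    by (simp add: poly_pcompose mult_ac)
qed

definition cpoly :: "int poly \<Rightarrow> bool" where
  "cpoly H \<longleftrightarrow> (\<exists>h0 h1. H = [:h0:] + Polynomial.smult (int p) h1)"

text \<open>The indices of the two units add up to the odd number N + s + s', so they have opposite
  parity. Thus both multipliers \<open>K 0\<close> and \<open>K 1\<close> occur for every a, and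
  their product \<open>m\<close> is a single constant for the class.\<close>

lemma unit_part_pair_poly:
  assumes r: "r < p" "r' < p" and s: "s \<le> 2" "s' \<le> 2" and N: "N = p * B + r + r'" and odd: "odd (N + s + s')"
    and k: "k > 0"
  shows "\<exists>m H. \<not> int p dvd m \<and> cpoly H \<and> (s = s' \<and> r = r' \<longrightarrow> c = 0 \<longrightarrow> (\<exists>h0 h1. H = [:h0:] + Polynomial.smult (int p ^ 2) h1)) \<and>
    (\<forall>a\<le>B. pdv (int k) (of_int m * (unit_part s r a * unit_part s' r' (B - a)) - of_int (poly H (int B - 2 * int a + c))))"
proof -
  obtain K where K: "\<And>d. \<not> int p dvd K d"
    and unit_part: "\<And>r s. r < p \<Longrightarrow> s \<le> 2 \<Longrightarrow> \<exists>f. cub k f \<and>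
       (\<forall>a. pdv (int k) (of_int (K ((p * a + r + s) mod 2)) * unit_part s r a - of_int (f a)))"
    using unit_part_cub[OF k] by blast
  obtain f where f: "cub k f" "\<And>a. pdv (int k) (of_int (K ((p * a + r + s) mod 2)) * unit_part s r a - of_int (f a))"
    using unit_part[OF r(1) s(1)] by blast
  \<comment> \<open>In the symmetric case the same function has to be taken twice, since
    \<open>cub_complement_same\<close> needs it.\<close>
  obtain f' where f': "cub k f'" "\<And>a. pdv (int k) (of_int (K ((p * a + r' + s') mod 2)) * unit_part s' r' a - of_int (f' a))"
    and ff': "s = s' \<and> r = r' \<longrightarrow> f' = f"
  proof (cases "s = s' \<and> r = r'")
    case True
    then show ?thesis using that f by blast
  next
    case False
    then show ?thesis using that unit_part[OF r(2) s(2)] by blast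
  qed
  obtain H where H: "cpoly H" "s = s' \<and> r = r' \<longrightarrow> c = 0 \<longrightarrow> (\<exists>h0 h1. H = [:h0:] + Polynomial.smult (int p ^ 2) h1)"
    "\<And>a. a \<le> B \<Longrightarrow> [f a * f' (B - a) = poly H (int B - 2 * int a + c)] (mod int p ^ k)"
  proof (cases "s = s' \<and> r = r' \<and> c = 0")
    case True
    then obtain h0 h1 where "\<forall>a\<le>B. [f a * f' (B - a) = poly ([:h0:] + Polynomial.smult (int p ^ 2) h1) (int B - 2 * int a + c)] (mod int p ^ k)"
      using cub_complement_same[OF f(1), of B] ff' by auto
    moreover have "Polynomial.smult (int p ^ 2) h1 = Polynomial.smult (int p) (Polynomial.smult (int p) h1)"
      by (simp add: power2_eq_square)
    ultimately show ?thesis using that unfolding cpoly_def by metis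
  next
    case False
    then show ?thesis
      using that cub_complement[OF f(1) f'(1), of B c] unfolding cpoly_def by metis
  qed
  define m where "m = K 0 * K 1"
  have "pdv (int k) (of_int m * (unit_part s r a * unit_part s' r' (B - a)) - of_int (poly H (int B - 2 * int a + c)))" if a: "a \<le> B" for a
  proof -
    let ?J = "p * a + r + s" and ?J' = "p * (B - a) + r' + s'"
    let ?u = "of_int (K (?J mod 2)) * unit_part s r a" and ?u' = "of_int (K (?J' mod 2)) * unit_part s' r' (B - a)"
    have "?J + ?J' = N + s + s'"
    proof -
      have "p * a + p * (B - a) = p * B"
        using a by (metis add_mult_distrib2 le_add_diff_inverse)
      then show ?thesis by (simp add: N)
    qed
    then have "?J mod 2 = 0 \<and> ?J' mod 2 = 1 \<or> ?J mod 2 = 1 \<and> ?J' mod 2 = 0"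
      using odd by presburger
    then have "K (?J mod 2) * K (?J' mod 2) = m"
      unfolding m_def by (metis mult.commute)
    then have m: "of_int m = (of_int (K (?J mod 2)) * of_int (K (?J' mod 2)) :: rat)"
      by (metis of_int_mult)
    have "pdv (int k) (?u * ?u' - of_int (f a) * of_int (f' (B - a)))"
    proof -
      have "pdv 0 ?u'" using pdv_int_mult[OF pdv_unit_part] .
      then have "pdv (int k + 0) ((?u - of_int (f a)) * ?u')" using f(2) by (intro pdv_mult)
      moreover have "pdv (0 + int k) (of_int (f a) * (?u' - of_int (f' (B - a))))"
        using f'(2) by (intro pdv_mult pdv_of_int)
      ultimately have "pdv (int k) ((?u - of_int (f a)) * ?u' + of_int (f a) * (?u' - of_int (f' (B - a))))"
        by (intro pdv_add) simp_all
      then show ?thesis by (simp add: algebra_simps)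
    qed
    moreover have "pdv (int k) (of_int (f a * f' (B - a) - poly H (int B - 2 * int a + c)))"
      using H(3)[OF a] by (simp only: pdv_of_int_iff cong_iff_dvd_diff)
    ultimately have "pdv (int k) ((?u * ?u' - of_int (f a) * of_int (f' (B - a))) + of_int (f a * f' (B - a) - poly H (int B - 2 * int a + c)))"
      by (rule pdv_add)
    then show ?thesis by (simp add: m mult_ac)
  qed
  moreover have "\<not> int p dvd m" unfolding m_def by (intro p_not_dvd_mult K)
  ultimately show ?thesis using H(1,2) by blast
qed

text \<open>The precision k is arbitrary, because the units are approximated beyond the denominators
  of the weights. The pointwise approximation is kept in the conclusion so that \<open>H\<close> can
  later be evaluated at a = 0.\<close>

lemma class_sum_approx:
  fixes k :: nat
  assumes r: "r < p" "r' < p" and s: "s \<le> 2" "s' \<le> 2" and N: "N = p * B + r + r'" and odd: "odd (N + s + s')"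
    and t: "t = block_shift (r + s)" "t' = block_shift (r' + s')"
    and x0: "x0 = int (r' + s') - int (r + s) - int p * (int t' - int t)"
  shows "\<exists>m H. \<not> int p dvd m \<and> cpoly H \<and> (s = s' \<and> r = r' \<longrightarrow> (\<exists>h0 h1. H = [:h0:] + Polynomial.smult (int p ^ 2) h1)) \<and>
    (\<forall>a\<le>B. pdv (int k) (of_int m * (unit_part s r a * unit_part s' r' (B - a)) - of_int (poly H (ybal t t' B a)))) \<and>
    pdv (int k) (of_int m * (\<Sum>a\<le>B. altterm s s' N F (p * a + r)) -
      (- 1) ^ r * of_nat p powi (int t + int t' - 1 - int B) * altsum t t' B (pcompose F [:x0, int p:] * H))"
proof -
  define w where "w a = (- 1) ^ r * of_nat p powi (int t + int t' - 1 - int B) *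
     ((- 1) ^ a * of_int (poly (pcompose F [:x0, int p:]) (ybal t t' B a)) * kap t a * kap t' (B - a))" for a
  obtain C :: nat where C: "\<And>a. a \<le> B \<Longrightarrow> pdv (- int C) (w a)"
    using pdv_exists_uniform[of "{..B}" w] by auto
  have y: "ybal t t' B a = int B - 2 * int a + (int t' - int t)" for a
    by (simp add: ybal_def)
  obtain m H where mH: "\<not> int p dvd m" "cpoly H"
    "s = s' \<and> r = r' \<longrightarrow> int t' - int t = 0 \<longrightarrow> (\<exists>h0 h1. H = [:h0:] + Polynomial.smult (int p ^ 2) h1)"
    "\<And>a. a \<le> B \<Longrightarrow> pdv (int (k + C + 1)) (of_int m * (unit_part s r a * unit_part s' r' (B - a)) - of_int (poly H (ybal t t' B a)))"
  proof -
    have "k + C + 1 > 0" by simp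
    from unit_part_pair_poly[OF r s N odd this, of "int t' - int t"] show ?thesis
      using that unfolding y by blast
  qed
  have "of_int m * (\<Sum>a\<le>B. altterm s s' N F (p * a + r)) -
      (- 1) ^ r * of_nat p powi (int t + int t' - 1 - int B) * altsum t t' B (pcompose F [:x0, int p:] * H)
    = (\<Sum>a\<le>B. w a * (of_int m * (unit_part s r a * unit_part s' r' (B - a)) - of_int (poly H (ybal t t' B a))))"
    unfolding altsum_def sum_distrib_left sum_subtractf[symmetric]
  proof (rule sum.cong[OF refl])
    fix a assume "a \<in> {..B}"
    then have 1: "altterm s s' N F (p * a + r) = w a * (unit_part s r a * unit_part s' r' (B - a))"
      unfolding w_def using altterm_dissect[OF r s N odd _ t x0] by simp
    have 2: "(- 1) ^ r * of_nat p powi (int t + int t' - 1 - int B) *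
        ((- 1) ^ a * of_int (poly (pcompose F [:x0, int p:] * H) (ybal t t' B a)) * kap t a * kap t' (B - a))
      = w a * of_int (poly H (ybal t t' B a))"
      unfolding w_def poly_mult of_int_mult by (simp only: mult_ac)
    show "of_int m * altterm s s' N F (p * a + r) - (- 1) ^ r * of_nat p powi (int t + int t' - 1 - int B) *
        ((- 1) ^ a * of_int (poly (pcompose F [:x0, int p:] * H) (ybal t t' B a)) * kap t a * kap t' (B - a))
      = w a * (of_int m * (unit_part s r a * unit_part s' r' (B - a)) - of_int (poly H (ybal t t' B a)))"
      unfolding 1 2 by (simp only: right_diff_distrib mult_ac)
  qed
  moreover have "pdv (int k) (\<Sum>a\<le>B. w a * (of_int m * (unit_part s r a * unit_part s' r' (B - a)) - of_int (poly H (ybal t t' B a))))"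
  proof (rule pdv_sum)
    fix a assume "a \<in> {..B}"
    then have "pdv (- int C + int (k + C + 1)) (w a * (of_int m * (unit_part s r a * unit_part s' r' (B - a)) - of_int (poly H (ybal t t' B a))))"
      by (intro pdv_mult C mH(4)) auto
    then show "pdv (int k) (w a * (of_int m * (unit_part s r a * unit_part s' r' (B - a)) - of_int (poly H (ybal t t' B a))))"
      by (rule pdv_mono) simp
  qed
  moreover have "pdv (int k) (of_int m * (unit_part s r a * unit_part s' r' (B - a)) - of_int (poly H (ybal t t' B a)))" if "a \<le> B" for a
    using mH(4)[OF that] by (rule pdv_mono) simp
  ultimately show ?thesis using mH(1-3) t by (intro exI[of _ m] exI[of _ H]) auto
qed

lemma fact_pfact_rat: "(fact N :: rat) = of_nat p ^ (N div p) * fact (N div p) * of_int (pfact N)"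
  using arg_cong[OF fact_pfact[of N], of rat_of_int] by simp

text \<open>Transfers a bound from N div p to N: \<open>fact N\<close> supplies p^(N div p) times
  \<open>fact (N div p)\<close>, and the dissection supplies p^(t + t' - 1 - B).\<close>

lemma class_bound:
  assumes r: "r < p" "r' < p" and s: "s \<le> 2" "s' \<le> 2" and N: "N = p * B + r + r'" and odd: "odd (N + s + s')"
    and t: "t = block_shift (r + s)" "t' = block_shift (r' + s')"
    and x0: "x0 = int (r' + s') - int (r + s) - int p * (int t' - int t)"
    and bound: "\<And>H. cpoly H \<Longrightarrow> pdv e (fact (N div p) * altsum t t' B (pcompose F [:x0, int p:] * H))"
  shows "pdv (e + int t + int t' - 1 + int (N div p) - int B) (fact N * (\<Sum>a\<le>B. altterm s s' N F (p * a + r)))"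
proof -
  let ?A = "N div p"
  define g where "g = e + int t + int t' - 1 + int ?A - int B"
  define k where "k = nat g"
  obtain m H where mH: "\<not> int p dvd m" "cpoly H"
    "pdv (int k) (of_int m * (\<Sum>a\<le>B. altterm s s' N F (p * a + r)) -
      (- 1) ^ r * of_nat p powi (int t + int t' - 1 - int B) * altsum t t' B (pcompose F [:x0, int p:] * H))"
    using class_sum_approx[OF r s N odd t x0, of k F] by blast
  let ?S = "\<Sum>a\<le>B. altterm s s' N F (p * a + r)"
  let ?M = "(- 1) ^ r * of_nat p powi (int t + int t' - 1 - int B) * altsum t t' B (pcompose F [:x0, int p:] * H)"
  have "pdv (0 + int k) (fact N * (of_int m * ?S - ?M))"
    using pdv_of_nat[of "fact N"] mH(3) by (intro pdv_mult) simp_all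
  then have 1: "pdv g (fact N * (of_int m * ?S - ?M))"
    by (rule pdv_mono) (simp add: k_def)
  have "pdv g (of_nat p powi (int ?A + (int t + int t' - 1 - int B)) * (fact ?A * altsum t t' B (pcompose F [:x0, int p:] * H)))"
  proof -
    have "g = (int ?A + (int t + int t' - 1 - int B)) + e" by (simp add: g_def)
    then show ?thesis using pdv_mult[OF pdv_powi bound[OF mH(2)]] by metis
  qed
  then have "pdv g (of_int ((- 1) ^ r * pfact N) * (of_nat p powi (int ?A + (int t + int t' - 1 - int B)) * (fact ?A * altsum t t' B (pcompose F [:x0, int p:] * H))))"
    by (rule pdv_int_mult)
  also have "of_int ((- 1) ^ r * pfact N) * (of_nat p powi (int ?A + (int t + int t' - 1 - int B)) * (fact ?A * altsum t t' B (pcompose F [:x0, int p:] * H))) = fact N * ?M"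
    by (subst (2) fact_pfact_rat) (simp add: power_int_add mult_ac)
  finally have "pdv g (fact N * (of_int m * ?S - ?M) + fact N * ?M)"
    using 1 by (intro pdv_add)
  then have "pdv g (of_int m * (fact N * ?S))"
    by (simp add: algebra_simps)
  then show ?thesis
    using pdv_unit_mult_iff[OF mH(1)] by (simp add: g_def)
qed

lemma altsum_classes:
  "altsum s s' N F = (\<Sum>r<p. \<Sum>a | p * a + r \<le> N. altterm s s' N F (p * a + r))"
  unfolding altsum_def altterm_def by (rule sum_residue_classes) simp

end

section \<open>Divisibility of the moments\<close>

lemma sum_even_odd: "sum f {..2 * n + 1 :: nat} = (\<Sum>k\<le>n. f (2 * k) + f (2 * k + 1))"
  by (induction n) (simp_all add: add.assoc)

text \<open>An odd index is N - 2k for some k. Reflection changes the sign of Y and the alternating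
  sign, so it gives the same term as index 2k.\<close>

lemma altsum_Hsum: "altsum 0 0 (2 * n + 1) [:0, 1:] = 2 * Hsum n"
proof -
  let ?N = "2 * n + 1"
  let ?f = "\<lambda>a. (- 1) ^ a * of_int (poly [:0, 1:] (ybal 0 0 ?N a)) * kap 0 a * kap 0 (?N - a) :: rat"
  let ?g = "\<lambda>k. (2 * of_nat n + 1 - 4 * of_nat k) * (qeven k)\<^sup>2 * (qodd (n - k))\<^sup>2"
  have ev: "?f (2 * k) = ?g k" if "k \<le> n" for k
  proof -
    have "2 * n + 1 - 2 * k = 2 * (n - k) + 1" using that by simp
    then show ?thesis by (simp add: ybal_def kap_def qeven_def qodd_def algebra_simps)
  qed
  have od: "?f (2 * (n - k) + 1) = ?g k" if "k \<le> n" for k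
  proof -
    have 1: "2 * n + 1 - (2 * (n - k) + 1) = 2 * k" using that by simp
    have 2: "(- 1 :: rat) ^ (2 * (n - k) + 1) = - 1" by simp
    have 3: "poly [:0, 1:] (ybal 0 0 ?N (2 * (n - k) + 1)) = - (2 * int n + 1 - 4 * int k)"
      using that by (simp add: ybal_def of_nat_diff)
    show ?thesis
      unfolding 1 2 3 by (simp add: kap_def qeven_def qodd_def mult_ac)
  qed
  have "altsum 0 0 ?N [:0, 1:] = (\<Sum>k\<le>n. ?f (2 * k)) + (\<Sum>k\<le>n. ?f (2 * k + 1))"
    unfolding altsum_def sum_even_odd sum.distrib ..
  also have "(\<Sum>k\<le>n. ?f (2 * k + 1)) = (\<Sum>k\<le>n. ?f (2 * (n - k) + 1))"
    by (rule sum.reindex_bij_witness[where i = "\<lambda>k. n - k" and j = "\<lambda>k. n - k"]) auto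
  also have "(\<Sum>k\<le>n. ?f (2 * k)) + (\<Sum>k\<le>n. ?f (2 * (n - k) + 1)) = (\<Sum>k\<le>n. ?g k) + (\<Sum>k\<le>n. ?g k)"
    by (intro arg_cong2[where f = "(+)"] sum.cong refl ev od) auto
  finally show ?thesis by (simp add: Hsum_def)
qed

definition wsum :: "nat \<Rightarrow> rat" where
  "wsum N = fact N * altsum 0 0 N [:0, 1:]"

lemma G_wsum: "odd N \<Longrightarrow> 4 * rat_of_int (G ((N - 1) div 2)) = 2 ^ N * wsum N"
proof (elim oddE)
  fix n assume N: "N = 2 * n + 1"
  then have "(N - 1) div 2 = n" by simp
  moreover have "(2 :: rat) ^ N = 2 * 4 ^ n"
    by (simp add: N power_mult)
  ultimately show "4 * rat_of_int (G ((N - 1) div 2)) = 2 ^ N * wsum N"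
    unfolding wsum_def N altsum_Hsum by (simp add: G_eq_Hsum)
qed

context prime3
begin

text \<open>\<open>B\<close> is N div p or one less, according to whether r is at most N mod
  p.\<close>

lemma residue_class_cases:
  assumes "r < p"
  obtains "{a. p * a + r \<le> N} = {}"
  | B r' where "r' < p" "N = p * B + r + r'" "{a. p * a + r \<le> N} = {..B}" "B \<le> N div p"
proof -
  define A R where "A = N div p" and "R = N mod p"
  have N: "N = p * A + R" "R < p" by (simp_all add: A_def R_def)
  consider "r \<le> R" | "r > R" "A = 0" | A' where "r > R" "A = Suc A'"
    by (metis not_less not0_implies_Suc)
  then show ?thesis
  proof cases
    case 1
    then have "N = p * A + r + (R - r)" "R - r < p" using N by simp_all
    then show ?thesis
      using that(2)[of "R - r" A] residue_index_set[of "R - r" p r A] by (simp add: A_def)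
  next
    case 2
    then have "{a. p * a + r \<le> N} = {}" using N by auto
    then show ?thesis by (rule that(1))
  next
    case 3
    then have *: "N = p * A' + r + (p + R - r)" "p + R - r < p" using N assms by simp_all
    show ?thesis
    proof (rule that(2)[OF *(2,1)])
      show "{a. p * a + r \<le> N} = {..A'}"
        using residue_index_set[OF *(2), of r A'] *(1) by simp
      show "A' \<le> N div p" using 3 by (simp add: A_def[symmetric])
    qed
  qed
qed

lemma pdv_fact_mono: "pdv e (fact B * x) \<Longrightarrow> B \<le> A \<Longrightarrow> pdv e (fact A * x)"
proof -
  assume *: "pdv e (fact B * x)" "B \<le> A"
  then obtain c :: int where "fact A = c * fact B"
    by (metis dvdE fact_dvd mult.commute)
  then have "(fact A :: rat) = of_int c * fact B"
    by (metis of_int_fact of_int_mult)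
  then show ?thesis
    using pdv_int_mult[OF *(1), of c] by (simp add: mult.assoc)
qed

lemma block_shift_sum_parity: "odd (p * B + r + r' + s + s') \<Longrightarrow> odd (B + block_shift (r + s) + block_shift (r' + s'))"
  using p_odd block_shift_parity[of "r + s"] block_shift_parity[of "r' + s'"] by auto

lemma pcompose_linear: "\<exists>R. pcompose F [:x, m:] = [:poly F x:] + Polynomial.smult (m :: int) (pCons 0 R)"
proof (induction F)
  case 0
  then show ?case by (intro exI[of _ 0]) simp
next
  case (pCons a F)
  then obtain R where R: "pcompose F [:x, m:] = [:poly F x:] + Polynomial.smult m (pCons 0 R)" by blast
  have "pcompose (pCons a F) [:x, m:] = [:a:] + [:x, m:] * ([:poly F x:] + Polynomial.smult m (pCons 0 R))"
    by (simp add: pcompose_pCons R)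
  also have "\<dots> = [:poly (pCons a F) x:] + Polynomial.smult m (pCons 0 ([:poly F x:] + Polynomial.smult x R + Polynomial.smult m (pCons 0 R)))"
    by (rule poly_eqI) (simp add: coeff_pCons algebra_simps split: nat.splits)
  finally show ?case by blast
qed

lemma cpoly_pcompose: "cpoly (pcompose F [:x, int p:])"
  unfolding cpoly_def using pcompose_linear by blast

lemma cpoly_mult: "cpoly F \<Longrightarrow> cpoly H \<Longrightarrow> cpoly (F * H)"
proof -
  assume "cpoly F" "cpoly H"
  then obtain a b c d where "F = [:a:] + Polynomial.smult (int p) b" "H = [:c:] + Polynomial.smult (int p) d"
    unfolding cpoly_def by blast
  then have "F * H = [:a * c:] + Polynomial.smult (int p) (Polynomial.smult a d + Polynomial.smult c b + Polynomial.smult (int p) (b * d))"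
    by (simp add: algebra_simps smult_add_right)
  then show ?thesis unfolding cpoly_def by blast
qed

text \<open>Termwise the sums are not \<open>p\<close>-integral; integrality survives only through the vanishing on constants.\<close>

lemma altsum_integral:
  "s \<le> 2 \<Longrightarrow> s' \<le> 2 \<Longrightarrow> odd (N + s + s') \<Longrightarrow> pdv 0 (fact N * altsum s s' N F)"
proof (induction N arbitrary: s s' F rule: less_induct)
  case (less N)
  show ?case
  proof (cases "N = 0")
    case True
    have "kap s 0 = 1" if "s \<le> 2" for s
      using that by (auto simp: kap_def le_Suc_eq numeral_2_eq_2)
    then show ?thesis
      using less.prems by (simp add: True altsum_def pdv_of_int)
  next
    case False
    have "pdv 0 (fact N * (\<Sum>a | p * a + r \<le> N. altterm s s' N F (p * a + r)))" if r: "r < p" for r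
    proof (rule residue_class_cases[OF r, of N])
      assume "{a. p * a + r \<le> N} = {}"
      then show ?thesis by simp
    next
      fix B r' assume 2: "r' < p" "N = p * B + r + r'" "{a. p * a + r \<le> N} = {..B}" "B \<le> N div p"
      define t t' where "t = block_shift (r + s)" and "t' = block_shift (r' + s')"
      define x0 where "x0 = int (r' + s') - int (r + s) - int p * (int t' - int t)"
      have odd: "odd (B + t + t')"
        using less.prems(3) unfolding 2(2) t_def t'_def by (rule block_shift_sum_parity)
      have "N div p < N" using False p_gt_2 by simp
      then have "B < N" using 2(4) by simp
      have IH: "pdv 0 (fact (N div p) * altsum t t' B H)" for H
        by (rule pdv_fact_mono[OF less.IH[OF \<open>B < N\<close> _ _ odd] 2(4)]) (simp_all add: t_def t'_def block_shift_le)
      \<comment> \<open>For t = t' = 0 the dissection leaves a factor 1/p. Then B is odd, constants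
        sum to 0, and what remains of the polynomial is a multiple of p, which pays for it.\<close>
      define e :: int where "e = (if t + t' = 0 then 1 else 0)"
      have "pdv (e + int t + int t' - 1 + int (N div p) - int B) (fact N * (\<Sum>a\<le>B. altterm s s' N F (p * a + r)))"
      proof (rule class_bound[OF r 2(1) less.prems(1,2) 2(2) less.prems(3) t_def t'_def x0_def])
        fix H assume H: "cpoly H"
        show "pdv e (fact (N div p) * altsum t t' B (pcompose F [:x0, int p:] * H))"
        proof (cases "t + t' = 0")
          case True
          obtain h0 h1 where h: "pcompose F [:x0, int p:] * H = [:h0:] + Polynomial.smult (int p) h1"
            using cpoly_mult[OF cpoly_pcompose H] unfolding cpoly_def by blast
          have "altsum t t' B (pcompose F [:x0, int p:] * H) = of_nat p * altsum t t' B h1"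
            using True odd unfolding h by (simp add: altsum_add altsum_smult altsum_const_eq_0)
          then show ?thesis
            using pdv_mult[OF pdv_powi[of 1] IH[of h1]] True by (simp add: e_def mult_ac)
        next
          case False
          then have "e = 0" by (simp add: e_def)
          then show ?thesis using IH by simp
        qed
      qed
      then show ?thesis
        unfolding 2(3) by (rule pdv_mono) (use 2(4) in \<open>auto simp: e_def\<close>)
    qed
    then show ?thesis
      unfolding altsum_classes by (subst sum_distrib_left) (intro pdv_sum; simp)
  qed
qed

abbreviation X3 :: "int poly \<Rightarrow> int poly" where
  "X3 F \<equiv> pCons 0 (pCons 0 (pCons 0 F))"

text \<open>
  The odd moments of the weights are divisible by \<open>A\<close>, and nearly by \<open>A\<^sup>2\<close> from the third moment on.
  The four statements reproduce each other when \<open>A\<close> is replaced by \<open>p A\<close>.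
\<close>

definition moment_bounds :: "nat \<Rightarrow> nat \<Rightarrow> bool" where
  "moment_bounds v A \<longleftrightarrow> (\<forall>F. pdv (int v) (fact A * altsum 0 0 A F) \<and> pdv (2 * int v - 1) (fact A * altsum 0 0 A (X3 F)) \<and>
     pdv (int v - 1) (fact A * altsum 1 1 A F) \<and> pdv (2 * int v - 1) (fact A * altsum 1 1 A (X3 F)))"

lemma moment_boundsD:
  assumes "moment_bounds v A"
  shows "pdv (int v) (fact A * altsum 0 0 A F)" "pdv (2 * int v - 1) (fact A * altsum 0 0 A (X3 F))"
    "pdv (int v - 1) (fact A * altsum 1 1 A F)" "pdv (2 * int v - 1) (fact A * altsum 1 1 A (X3 F))"
  using assms unfolding moment_bounds_def by blast+

text \<open>Write H (A + Y)^2 = A (A H + 2 Y H) + Y^2 H. The first part gains v from A. In the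
  second, the degree 2 term vanishes by symmetry, and all terms of degree 3 or more carry a factor p
  from \<open>H\<close>.\<close>

lemma shifted_bound:
  assumes "odd A" "p ^ v dvd A" "cpoly H"
    and Q1: "\<And>F. pdv al (fact A * altsum t t A F)" and Q3: "\<And>F. pdv be (fact A * altsum t t A (X3 F))"
    and ga: "ga \<le> int v + al" "ga \<le> 1 + be"
  shows "pdv ga (fact A * altsum t t A (H * [:int A, 1:]\<^sup>2))"
proof -
  obtain h0 h1 where h: "H = [:h0:] + Polynomial.smult (int p) h1"
    using assms(3) unfolding cpoly_def by blast
  obtain d h2 where d: "h1 = pCons d h2" by (cases h1)
  define K where "K = Polynomial.smult (int A) H + Polynomial.smult 2 (pCons 0 H)"
  have "H * [:int A, 1:]\<^sup>2 = Polynomial.smult (int A) K + pCons 0 (pCons 0 H)"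
    by (simp add: K_def power2_eq_square algebra_simps smult_add_right)
  moreover have "pCons 0 (pCons 0 H) = [:0, 0, h0 + int p * d:] + Polynomial.smult (int p) (X3 h2)"
    by (simp add: h d)
  ultimately have eq: "altsum t t A (H * [:int A, 1:]\<^sup>2) =
      of_int (int A) * altsum t t A K + of_int (int p) * altsum t t A (X3 h2)"
    by (simp only: altsum_add altsum_smult altsum_square_eq_0[OF assms(1)] add_0)
  have "int p ^ v dvd int A" using assms(2) by (metis of_nat_dvd_iff of_nat_power)
  then have "pdv (int v + al) (of_int (int A) * (fact A * altsum t t A K))"
    by (rule pdv_dvd) (rule Q1)
  moreover have "pdv (int 1 + be) (of_int (int p) * (fact A * altsum t t A (X3 h2)))"
    by (rule pdv_dvd) (use Q3 in simp_all)
  ultimately have "pdv ga (of_int (int A) * (fact A * altsum t t A K)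
     + of_int (int p) * (fact A * altsum t t A (X3 h2)))"
    using ga by (intro pdv_add) (auto elim: pdv_mono)
  then show ?thesis
    unfolding eq by (simp add: algebra_simps)
qed

lemma shifted_bound':
  assumes A: "odd A" "p ^ v dvd A" "A = Suc B" and H: "cpoly H"
    and Q1: "\<And>F. pdv al (fact A * altsum t t A F)" and Q3: "\<And>F. pdv be (fact A * altsum t t A (X3 F))"
    and ga: "ga \<le> int v + al" "ga \<le> 1 + be"
  shows "pdv ga (fact A * altsum t (Suc t) B H)" "pdv ga (fact A * altsum (Suc t) t B H)"
proof -
  have *: "pdv ga (fact A * altsum t (Suc t) B H)" if "cpoly H" for H
  proof -
    have "pdv ga (fact A * (4 * altsum t (Suc t) B H))"
      unfolding altsum_shift using shifted_bound[OF A(1,2) that Q1 Q3 ga] by (simp add: A(3))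
    then have "pdv ga (of_int 4 * (fact A * altsum t (Suc t) B H))"
      by (simp add: mult_ac)
    then show ?thesis by (simp only: pdv_unit_mult_iff[OF p_not_dvd_4])
  qed
  from *[OF H] show "pdv ga (fact A * altsum t (Suc t) B H)" .
  have "cpoly (pcompose H [:0, - 1:])"
  proof -
    obtain h0 h1 where "H = [:h0:] + Polynomial.smult (int p) h1"
      using H unfolding cpoly_def by blast
    then have "pcompose H [:0, - 1:] = [:h0:] + Polynomial.smult (int p) (pcompose h1 [:0, - 1:])"
      by (simp add: pcompose_add pcompose_smult)
    then show ?thesis unfolding cpoly_def by blast
  qed
  from pdv_int_mult[OF *[OF this], of "(- 1) ^ B"]
  show "pdv ga (fact A * altsum (Suc t) t B H)"
    by (subst altsum_reflect) (simp add: mult_ac)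
qed

text \<open>The complementary residue is p - r and B = A - 1 is even, so the shifts have odd sum and
  differ by exactly one: the situation of \<open>shifted_bound'\<close>.\<close>

lemma nonzero_class_bound:
  assumes A: "odd A" "p ^ v dvd A" and cl: "moment_bounds v A" and sg: "s \<le> 1" and r: "0 < r" "r < p"
  shows "pdv (2 * int v + 1) (fact (p * A) * (\<Sum>a\<le>A - 1. altterm s s (p * A) F (p * a + r)))"
proof -
  define B r' where "B = A - 1" and "r' = p - r"
  have AB: "A = Suc B" using A(1) by (cases A) (auto simp: B_def)
  define t t' where "t = block_shift (r + s)" and "t' = block_shift (r' + s)"
  define x0 where "x0 = int (r' + s) - int (r + s) - int p * (int t' - int t)"
  have r': "r' < p" and N: "p * A = p * B + r + r'"
    using r by (auto simp: r'_def AB)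
  have odd: "odd (p * A + s + s)" using A(1) p_odd by simp
  have "odd (B + t + t')"
    using odd unfolding N t_def t'_def by (rule block_shift_sum_parity)
  then have "odd (t + t')" using A(1) AB by auto
  moreover have "t = 0 \<or> t = 1 \<or> t = 2" "t' = 0 \<or> t' = 1 \<or> t' = 2"
    by (auto simp: t_def t'_def block_shift_def)
  ultimately have tt: "t = 0 \<and> t' = 1 \<or> t = 1 \<and> t' = 0 \<or> t = 1 \<and> t' = 2 \<or> t = 2 \<and> t' = 1"
    by (elim disjE) simp_all
  \<comment> \<open>The shifts 0 and 1 give 2v. For the shifts 1 and 2 the weaker 2v - 1 is
    outweighed by the larger contribution of t + t'.\<close>
  define e :: int where "e = (if t + t' = 1 then 2 * int v else 2 * int v - 1)"
  have "pdv (e + int t + int t' - 1 + int (p * A div p) - int B) (fact (p * A) * (\<Sum>a\<le>B. altterm s s (p * A) F (p * a + r)))"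
  proof (rule class_bound[OF r(2) r' _ _ N odd t_def t'_def x0_def])
    show "s \<le> 2" "s \<le> 2" using sg by simp_all
    fix H assume "cpoly H"
    then have H: "cpoly (pcompose F [:x0, int p:] * H)" by (intro cpoly_mult cpoly_pcompose)
    have AA: "p * A div p = A" by simp
    note s0 = shifted_bound'[OF A AB H moment_boundsD(1,2)[OF cl], of "2 * int v"]
      and s1 = shifted_bound'[OF A AB H moment_boundsD(3,4)[OF cl], of "2 * int v - 1"]
    show "pdv e (fact (p * A div p) * altsum t t' B (pcompose F [:x0, int p:] * H))"
      using tt s0 s1 unfolding AA e_def by (auto simp: numeral_2_eq_2)
  qed
  then show ?thesis
    unfolding B_def[symmetric] by (rule pdv_mono) (use tt in \<open>auto simp: e_def AB\<close>)
qed

lemma altsum_split_classes: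
  assumes "A > 0"
  shows "altsum s s' (p * A) F = (\<Sum>a\<le>A. altterm s s' (p * A) F (p * a)) + (\<Sum>r\<in>{1..<p}. \<Sum>a\<le>A - 1. altterm s s' (p * A) F (p * a + r))"
proof -
  have "{..<p} = insert 0 {1..<p}" by auto
  then have "altsum s s' (p * A) F = (\<Sum>a | p * a \<le> p * A. altterm s s' (p * A) F (p * a)) + (\<Sum>r\<in>{1..<p}. \<Sum>a | p * a + r \<le> p * A. altterm s s' (p * A) F (p * a + r))"
    unfolding altsum_classes by simp
  moreover have "{a. p * a \<le> p * A} = {..A}"
    using residue_index_set[of 0 p 0 A] by simp
  moreover have "{a. p * a + r \<le> p * A} = {..A - 1}" if "r \<in> {1..<p}" for r
  proof -
    have eq: "p * A = p * (A - 1) + r + (p - r)"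
      using that assms by (cases A) auto
    have "p - r < p" using that by simp
    from residue_index_set[OF this, of r "A - 1"] show ?thesis
      unfolding eq .
  qed
  ultimately show ?thesis by simp
qed

lemma nonzero_classes_bound:
  assumes "odd A" "p ^ v dvd A" "moment_bounds v A" "s \<le> 1"
  shows "pdv (2 * int v + 1) (fact (p * A) * (\<Sum>r\<in>{1..<p}. \<Sum>a\<le>A - 1. altterm s s (p * A) F (p * a + r)))"
  by (subst sum_distrib_left) (intro pdv_sum nonzero_class_bound[OF assms]; simp)

text \<open>The class r = 0 exchanges the shifts s and 1 - s. It gains a factor p when s = 0 and
  loses one when s = 1.\<close>

lemma zero_class_bound:
  assumes A: "odd A" and s: "s \<le> 1"
    and bound: "\<And>H. cpoly H \<Longrightarrow> pdv e (fact A * altsum (1 - s) (1 - s) A (pcompose F [:0, int p:] * H))"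
  shows "pdv (e + 1 - 2 * int s) (fact (p * A) * (\<Sum>a\<le>A. altterm s s (p * A) F (p * a)))"
proof -
  have t: "1 - s = block_shift (0 + s)" using s p_gt_2 by (cases s) (auto simp: block_shift_def)
  have "pdv (e + int (1 - s) + int (1 - s) - 1 + int (p * A div p) - int A) (fact (p * A) * (\<Sum>a\<le>A. altterm s s (p * A) F (p * a + 0)))"
  proof (rule class_bound[where r' = 0 and s' = s and ?x0.0 = 0])
    show "odd (p * A + s + s)" using A p_odd by simp
    show "pdv e (fact (p * A div p) * altsum (1 - s) (1 - s) A (pcompose F [:0, int p:] * H))" if "cpoly H" for H
      using bound[OF that] by simp
  qed (use s t in auto)
  moreover have "e + int (1 - s) + int (1 - s) - 1 + int (p * A div p) - int A = e + 1 - 2 * int s"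
    using s by (simp add: of_nat_diff)
  ultimately show ?thesis by (simp only: add_0_right)
qed

lemma X3_pcompose: "pcompose (X3 F) [:0, m:] = Polynomial.smult (m ^ 3) (X3 (pcompose F [:0, m:]))"
  by (simp add: pcompose_pCons power3_eq_cube smult_add_right mult_ac)

lemma mult_X3: "X3 F * H = X3 (F * H)"
  by simp

lemma pdv_p_mult: "pdv e x \<Longrightarrow> pdv (int n + e) (of_int (int p ^ n) * x)"
  by (rule pdv_dvd) simp

text \<open>In the zero class Y becomes pY, so first moments gain p and third moments p^3, besides
  the factor p or 1/p from the exchange of shifts. The nonzero classes contribute 2v + 1 = 2(v + 1)
  - 1, exactly what is claimed for third moments.\<close>

lemma moment_bounds_hold: "odd A \<Longrightarrow> p ^ v dvd A \<Longrightarrow> moment_bounds v A"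
proof (induction v arbitrary: A)
  case 0
  have "pdv 0 (fact A * altsum 0 0 A F)" "pdv 0 (fact A * altsum 1 1 A F)" for F
    using 0 by (auto intro!: altsum_integral)
  moreover from this have "pdv (- 1) (fact A * altsum 0 0 A F)" "pdv (- 1) (fact A * altsum 1 1 A F)" for F
    by (auto intro!: pdv_mono[of 0 _ "- 1"])
  ultimately show ?case
    unfolding moment_bounds_def by simp
next
  case (Suc v N)
  from Suc.prems(2) obtain A where N: "N = p * A" and dvd: "p ^ v dvd A"
    by (metis dvd_mult_cancel1 dvd_def mult.assoc power_Suc dvd_triv_left)
  have A: "odd A" using Suc.prems(1) N by simp
  then have "A > 0" by (cases A) auto
  have cl: "moment_bounds v A" using A dvd by (rule Suc.IH)
  note D = moment_boundsD[OF cl]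
  \<comment> \<open>\<open>e'\<close> bounds the zero class before the factor p^(1 - 2s) of the
    exchange; 2v + 1 is the bound for all other classes.\<close>
  have total: "pdv e (fact N * altsum s s N F)"
    if s: "s \<le> 1" and e: "e \<le> e' + 1 - 2 * int s" "e \<le> 2 * int v + 1"
      and bound: "\<And>H. cpoly H \<Longrightarrow> pdv e' (fact A * altsum (1 - s) (1 - s) A (pcompose F [:0, int p:] * H))"
    for e e' s F
    unfolding N altsum_split_classes[OF \<open>A > 0\<close>] distrib_left
    using pdv_mono[OF zero_class_bound[OF A s bound] e(1)] pdv_mono[OF nonzero_classes_bound[OF A dvd cl s] e(2)]
    by (rule pdv_add)
  have x: "pcompose [:0, 1:] [:0, int p:] * ([:h0:] + Polynomial.smult (int p) h1)
      = Polynomial.smult (int p) (Polynomial.smult h0 [:0, 1:] + Polynomial.smult (int p) (pCons 0 h1))" for h0 h1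
    by (simp add: pcompose_pCons smult_add_right mult_ac)
  have x00: "pdv (int (Suc v)) (fact N * altsum 0 0 N [:0, 1:])"
  proof (rule total[where e' = "int v"])
    fix H assume "cpoly H"
    then obtain h0 h1 where H: "H = [:h0:] + Polynomial.smult (int p) h1" unfolding cpoly_def by blast
    have "pdv (int 1 + (int v - 1)) (of_int (int p ^ 1) * (fact A * altsum 1 1 A (Polynomial.smult h0 [:0, 1:] + Polynomial.smult (int p) (pCons 0 h1))))"
      by (intro pdv_p_mult D)
    then show "pdv (int v) (fact A * altsum (1 - 0) (1 - 0) A (pcompose [:0, 1:] [:0, int p:] * H))"
      unfolding H x altsum_smult by (simp add: mult_ac add.commute)
  qed auto
  have x11: "pdv (int (Suc v) - 1) (fact N * altsum 1 1 N [:0, 1:])"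
  proof (rule total[where e' = "int v + 1"])
    fix H assume "cpoly H"
    then obtain h0 h1 where H: "H = [:h0:] + Polynomial.smult (int p) h1" unfolding cpoly_def by blast
    have "pdv (int 1 + int v) (of_int (int p ^ 1) * (fact A * altsum 0 0 A (Polynomial.smult h0 [:0, 1:] + Polynomial.smult (int p) (pCons 0 h1))))"
      by (intro pdv_p_mult D)
    then show "pdv (int v + 1) (fact A * altsum (1 - 1) (1 - 1) A (pcompose [:0, 1:] [:0, int p:] * H))"
      unfolding H x altsum_smult by (simp add: mult_ac add.commute)
  qed auto
  have c00: "pdv (2 * int (Suc v) - 1) (fact N * altsum 0 0 N (X3 F))" for F
  proof (rule total[where e' = "2 * int v + 2"])
    fix H
    have "pdv (int 3 + (2 * int v - 1)) (of_int (int p ^ 3) * (fact A * altsum 1 1 A (X3 (pcompose F [:0, int p:] * H))))"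
      by (intro pdv_p_mult D)
    then show "pdv (2 * int v + 2) (fact A * altsum (1 - 0) (1 - 0) A (pcompose (X3 F) [:0, int p:] * H))"
      unfolding X3_pcompose mult_smult_left mult_X3 altsum_smult by (simp add: mult_ac add.commute)
  qed auto
  have c11: "pdv (2 * int (Suc v) - 1) (fact N * altsum 1 1 N (X3 F))" for F
  proof (rule total[where e' = "2 * int v + 2"])
    fix H
    have "pdv (int 3 + (2 * int v - 1)) (of_int (int p ^ 3) * (fact A * altsum 0 0 A (X3 (pcompose F [:0, int p:] * H))))"
      by (intro pdv_p_mult D)
    then show "pdv (2 * int v + 2) (fact A * altsum (1 - 1) (1 - 1) A (pcompose (X3 F) [:0, int p:] * H))"
      unfolding X3_pcompose mult_smult_left mult_X3 altsum_smult by (simp add: mult_ac add.commute)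
  qed auto
  \<comment> \<open>An arbitrary polynomial reduces to its first moment and the terms of degree at
    least 3 by \<open>altsum_decomp\<close>.\<close>
  have gen: "pdv e (fact N * altsum t t N F)"
    if "pdv e (fact N * altsum t t N [:0, 1:])" "\<And>F. pdv e (fact N * altsum t t N (X3 F))" for e t F
  proof -
    obtain a b c F' where F: "F = pCons a (pCons b (pCons c F'))"
      by (metis pCons_cases)
    have "pdv e (of_int b * (fact N * altsum t t N [:0, 1:]) + fact N * altsum t t N (X3 F'))"
      using that by (intro pdv_add pdv_int_mult)
    then show ?thesis
      unfolding F altsum_decomp[OF Suc.prems(1), of t a b c F'] by (simp add: algebra_simps)
  qed
  have "pdv (int (Suc v)) (fact N * altsum 0 0 N F)" for F
    by (rule gen[OF x00], rule pdv_mono[OF c00]) simp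
  moreover have "pdv (int (Suc v) - 1) (fact N * altsum 1 1 N F)" for F
    by (rule gen[OF x11], rule pdv_mono[OF c11]) simp
  ultimately show ?case
    unfolding moment_bounds_def using c00 c11 by blast
qed

section \<open>Two dissection steps and the value of the unit\<close>

lemma power_cong_1:
  assumes "p ^ v dvd M" "\<not> int p dvd a"
  shows "[a ^ ((p - 1) * M) = 1] (mod int p ^ (v + 1))"
proof -
  obtain n where n: "M = p ^ v * n" using assms(1) by auto
  have "coprime a (int (p ^ (v + 1)))" using coprime_p_power[OF assms(2), of "v + 1"] by simp
  have "1 < int (p ^ (v + 1))" using one_less_power[of "int p" "v + 1"] p_gt_2 by simp
  then interpret R: residues "int (p ^ (v + 1))" "residue_ring (int (p ^ (v + 1)))"
    by unfold_locales simp_all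
  have "[a ^ totient (nat (int (p ^ (v + 1)))) = 1] (mod int (p ^ (v + 1)))"
    by (rule R.euler_theorem) fact
  moreover have "totient (nat (int (p ^ (v + 1)))) = p ^ v * (p - 1)"
    using totient_prime_power_Suc[OF prime_p, of v] by (simp only: nat_int Suc_eq_plus1)
  ultimately have "[(a ^ (p ^ v * (p - 1))) ^ n = 1 ^ n] (mod int (p ^ (v + 1)))"
    by (intro cong_pow) simp
  then show ?thesis
    by (simp add: n mult_ac flip: power_mult)
qed

lemma pfact_mult_power:
  "k > 0 \<Longrightarrow> [pfact (n * p ^ k) = pfact (p ^ k) ^ n] (mod int p ^ k)"
proof (induction n)
  case (Suc n)
  have "[pfact (p ^ k + n * p ^ k) = pfact (p ^ k) * pfact (n * p ^ k)] (mod int p ^ k)"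
    by (rule pfact_add_power) fact
  moreover have "[pfact (p ^ k) * pfact (n * p ^ k) = pfact (p ^ k) * pfact (p ^ k) ^ n] (mod int p ^ k)"
    using Suc by (intro cong_mult cong_refl) simp
  ultimately show ?case by (auto intro: cong_trans)
qed simp

text \<open>With M = p^v n both factors are powers of \<open>pfact (p ^ (v + 1))\<close>, and the
  total exponent (p + 1) n is even.\<close>

lemma pfact_pair_cong:
  assumes "p ^ v dvd M"
  shows "[pfact (p * (p * M)) * pfact (p * M) = 1] (mod int p ^ (v + 1))"
proof -
  let ?k = "v + 1"
  obtain n where n: "M = p ^ v * n" using assms by auto
  have "p * (p * M) = (p * n) * p ^ ?k" "p * M = n * p ^ ?k"
    by (simp_all add: n)
  then have "[pfact (p * (p * M)) * pfact (p * M) = pfact (p ^ ?k) ^ (p * n) * pfact (p ^ ?k) ^ n] (mod int p ^ ?k)"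
    using pfact_mult_power[of ?k "p * n"] pfact_mult_power[of ?k n] by (simp only:) (intro cong_mult; simp)
  moreover have "pfact (p ^ ?k) ^ (p * n) * pfact (p ^ ?k) ^ n = (pfact (p ^ ?k) ^ 2) ^ ((p + 1) div 2 * n)"
  proof -
    have "p * n + n = 2 * ((p + 1) div 2) * n" using p_odd by simp
    then show ?thesis by (simp add: mult.assoc flip: power_add power_mult)
  qed
  moreover have "[(pfact (p ^ ?k) ^ 2) ^ ((p + 1) div 2 * n) = 1 ^ ((p + 1) div 2 * n)] (mod int p ^ ?k)"
    by (intro cong_pow pfact_power_square) simp
  ultimately show ?thesis by (metis cong_trans power_one)
qed

text \<open>The indices p^2 M and p M + 1 have opposite parity, and the constants cancel crosswise:
  modulo p^(v+1) the right side of \<open>qfac_unit_square_cong\<close> for the odd index is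
  \<open>par_const lam 0\<close>, and for the even index it is
  \<open>par_const lam 1\<close>.\<close>

lemma qfac_unit_pair_cong:
  assumes "odd M" "p ^ v dvd M"
  shows "[(qfac_unit (p * (p * M)) * qfac_unit (p * M + 1)) ^ 2 = 1] (mod int p ^ (v + 1))"
proof -
  let ?k = "v + 1"
  obtain n where n: "M = p ^ v * n" using assms(2) by auto
  obtain lam w where lam: "4 * lam = 1 + w * p ^ ?k" "lam > 0"
    using inverse_of_4_mod_power by blast
  have k: "?k > 0" by simp
  have main: "[par_const lam (J mod 2) * qfac_unit J ^ 2 = 4 ^ (J + 1 - b) * pfact (c * p ^ ?k + m) ^ 2] (mod int p ^ ?k)"
    if J: "J = p * a + x" "b = a + block_shift x" "x \<le> 1" "b \<le> J + 1" "2 * lam * J + lam - 1 = c * p ^ ?k + m" for J a x b c m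
  proof -
    obtain e where e: "e < p" "2 * int J - 3 = int p * (2 * int b - 3) + 4 * int e"
      using block_shift_dissect[of x a] J(1-3) by auto
    have "odd (b + J)" using block_shift_parity[of x] p_odd J(1,2) by auto
    from qfac_unit_square_cong[OF k lam e(2,1) this J(4)] show ?thesis unfolding J(5) .
  qed
  have red: "[x = 4 ^ y * pfact m ^ 2] (mod int p ^ ?k)" if "[x = 4 ^ y * pfact (c * p ^ ?k + m) ^ 2] (mod int p ^ ?k)" for x y c m
    using cong_trans[OF that cong_mult[OF cong_refl pfact_square_periodic[OF k]]] .
  have 4: "[4 ^ ((p - 1) * M') = 1] (mod int p ^ ?k)" if "p ^ v dvd M'" for M'
    using power_cong_1[OF that p_not_dvd_4] .
  have Mpos: "M > 0" using assms(1) by (cases M) auto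
  have odds: "(p * (p * M)) mod 2 = 1" "(p * M + 1) mod 2 = 0"
  proof -
    have "odd (p * (p * M))" "even (p * M + 1)" using assms(1) p_odd by simp_all
    then show "(p * (p * M)) mod 2 = 1" "(p * M + 1) mod 2 = 0" by presburger+
  qed
  define P where "P = par_const lam 0 * par_const lam 1"
  have c0: "par_const lam 0 = pfact (lam - 1) ^ 2" and c1: "par_const lam 1 = 16 * pfact (3 * lam - 1) ^ 2"
    by (simp_all add: par_const_def)
  have 1: "[par_const lam 1 * qfac_unit (p * (p * M)) ^ 2 = 4 ^ ((p - 1) * (p * M)) * pfact (lam - 1) ^ 2] (mod int p ^ ?k)"
  proof -
    have z: "2 * lam * (p * (p * M)) + lam - 1 = (2 * lam * p * n) * p ^ ?k + (lam - 1)"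
      using lam(2) by (simp add: n algebra_simps)
    have b: "p * M + block_shift 0 \<le> p * (p * M) + 1" "p * (p * M) + 1 - (p * M + block_shift 0) = (p - 1) * (p * M)"
      using p_gt_2 by (simp_all add: block_shift_def diff_mult_distrib)
    have "[par_const lam ((p * (p * M)) mod 2) * qfac_unit (p * (p * M)) ^ 2
        = 4 ^ (p * (p * M) + 1 - (p * M + block_shift 0)) * pfact ((2 * lam * p * n) * p ^ ?k + (lam - 1)) ^ 2] (mod int p ^ ?k)"
      by (rule main[OF _ refl _ b(1) z]) simp_all
    from red[OF this] show ?thesis unfolding b(2) odds(1) .
  qed
  have 2: "[par_const lam 0 * qfac_unit (p * M + 1) ^ 2 = 4 ^ ((p - 1) * M + 2) * pfact (3 * lam - 1) ^ 2] (mod int p ^ ?k)"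
  proof -
    have t: "block_shift 1 = 0" using p_gt_2 by (simp add: block_shift_def)
    obtain q where q: "p = Suc q" using p_gt_2 by (cases p) auto
    have z: "2 * lam * (p * M + 1) + lam - 1 = (2 * lam * n) * p ^ ?k + (3 * lam - 1)"
      using lam(2) by (simp add: n algebra_simps)
    have b: "M + block_shift 1 \<le> (p * M + 1) + 1" "(p * M + 1) + 1 - (M + block_shift 1) = (p - 1) * M + 2"
      unfolding t by (simp_all add: q)
    have "[par_const lam ((p * M + 1) mod 2) * qfac_unit (p * M + 1) ^ 2
        = 4 ^ ((p * M + 1) + 1 - (M + block_shift 1)) * pfact ((2 * lam * n) * p ^ ?k + (3 * lam - 1)) ^ 2] (mod int p ^ ?k)"
      by (rule main[OF _ refl _ b(1) z]) simp_all
    from red[OF this] show ?thesis unfolding b(2) odds(2) .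
  qed
  have 3: "[4 ^ ((p - 1) * (p * M)) * pfact (lam - 1) ^ 2 = 1 * pfact (lam - 1) ^ 2] (mod int p ^ ?k)"
    using assms(2) by (intro cong_mult 4 cong_refl) simp
  have "[4 ^ ((p - 1) * M) * 16 * pfact (3 * lam - 1) ^ 2 = 1 * 16 * pfact (3 * lam - 1) ^ 2] (mod int p ^ ?k)"
    using assms(2) by (intro cong_mult 4 cong_refl)
  then have 4: "[4 ^ ((p - 1) * M + 2) * pfact (3 * lam - 1) ^ 2 = 16 * pfact (3 * lam - 1) ^ 2] (mod int p ^ ?k)"
    by (simp add: power_add mult_ac)
  have "[P * (qfac_unit (p * (p * M)) * qfac_unit (p * M + 1)) ^ 2 = P * 1] (mod int p ^ ?k)"
    using cong_mult[OF cong_trans[OF 1 3] cong_trans[OF 2 4]]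
    by (simp add: P_def c0 c1[unfolded One_nat_def] power_mult_distrib mult_ac)
  moreover have "coprime P (int p ^ ?k)"
  proof (rule coprime_p_power)
    have "\<not> int p dvd 16" using p_not_dvd_mult[OF p_not_dvd_4 p_not_dvd_4] by simp
    then show "\<not> int p dvd P"
      unfolding P_def c0 c1 by (intro p_not_dvd_mult p_not_dvd_power p_not_dvd_pfact)
  qed
  ultimately show ?thesis by (simp only: cong_mult_lcancel)
qed

lemma pdv_cong_1:
  assumes "[a = 1] (mod int p ^ k)" "[b = 1] (mod int p ^ k)" "k > 0"
  shows "pdv (int k) (of_int a / of_int b - 1)"
proof -
  have "\<not> int p dvd b"
  proof
    assume "int p dvd b"
    moreover have "[b = 1] (mod int p)"
      using assms(2,3) by (meson cong_dvd_modulus dvd_power)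
    ultimately have "int p dvd 1" using cong_dvd_iff by blast
    then show False using p_not_dvd_1 by simp
  qed
  then have "pdv (int k + 0) (of_int (a - b) * (of_int 1 / of_int b))"
    using assms(1,2) by (intro pdv_mult pdv_unit)
      (simp only: pdv_of_int_iff, metis cong_iff_dvd_diff cong_sym cong_trans)
  moreover have "b \<noteq> 0" using \<open>\<not> int p dvd b\<close> by auto
  ultimately show ?thesis by (simp add: field_simps)
qed

text \<open>Substituting pY gives the nonconstant part of \<open>H1\<close> its second factor p.
  Here \<open>e0\<close> is the exact constant coefficient, so the rest multiplies Y and is small at
  Y = M.\<close>

lemma cpoly_scaled:
  assumes "cpoly H1" "H2 = [:h0:] + Polynomial.smult (int p ^ 2) h1"
  shows "\<exists>e0 E. pcompose H1 [:0, int p:] * H2 = pCons e0 (Polynomial.smult (int p ^ 2) E)"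
proof -
  obtain c g where H1: "H1 = [:c:] + Polynomial.smult (int p) g"
    using assms(1) unfolding cpoly_def by blast
  obtain R where R: "pcompose g [:0, int p:] = [:poly g 0:] + Polynomial.smult (int p) (pCons 0 R)"
    using pcompose_linear by blast
  define c' where "c' = c + int p * poly g 0"
  have 1: "pcompose H1 [:0, int p:] = [:c':] + Polynomial.smult (int p ^ 2) (pCons 0 R)"
    by (simp add: H1 pcompose_add pcompose_smult R c'_def power2_eq_square)
  define E where "E = Polynomial.smult c' h1 + Polynomial.smult h0 (pCons 0 R) + Polynomial.smult (int p ^ 2) (pCons 0 R * h1)"
  have "pcompose H1 [:0, int p:] * H2 = [:c' * h0:] + Polynomial.smult (int p ^ 2) E"
    unfolding 1 assms(2) E_def by (simp add: algebra_simps smult_add_right)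
  moreover obtain d E' where "E = pCons d E'" by (cases E)
  ultimately have "pcompose H1 [:0, int p:] * H2 = pCons (c' * h0 + int p ^ 2 * d) (Polynomial.smult (int p ^ 2) E')"
    by simp
  then show ?thesis by blast
qed

text \<open>The error budget: the nonzero classes for p^2 M contribute 2(v + 1) + 1; those for pM
  contribute 2v + 1, plus one p from \<open>F1\<close> and one from the outer step; the third
  moments contribute 2v - 1 with a factor p^4. All of these reach exactly 2v + 3.\<close>

lemma wsum_scaled:
  assumes M: "odd M" "p ^ v dvd M"
  shows "pdv (2 * int v + 3) (wsum (p * (p * M)) -
    of_nat p ^ 2 * (of_int ((qfac_unit (p * (p * M)) * qfac_unit (p * M + 1)) ^ 2) / of_int (pfact (p * (p * M)) * pfact (p * M))) * wsum M)"
proof -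
  define A N where "A = p * M" and "N = p * A"
  let ?X = "[:0, 1:] :: int poly"
  have A: "odd A" "p ^ Suc v dvd A" using M p_odd by (simp_all add: A_def)
  have pos: "A > 0" "M > 0" using A(1) M(1) by (auto intro: Nat.gr0I)
  define k where "k = 2 * v + 3"
  have k: "int k = 2 * int v + 3" by (simp add: k_def)
  have divs: "N div p = A" "A div p = M" by (simp_all add: N_def A_def)
  have odds: "odd (N + 0 + 0)" "odd (A + 1 + 1)" using A(1) p_odd by (simp_all add: N_def)
  have t: "1 = block_shift (0 + 0)" "0 = block_shift (0 + 1)" using p_gt_2 by (simp_all add: block_shift_def)

  define Z where "Z = (\<Sum>a\<le>A. altterm 0 0 N ?X (p * a))"
  have "\<exists>m H. \<not> int p dvd m \<and> cpoly H \<and> ((0::nat) = 0 \<and> (0::nat) = 0 \<longrightarrow> (\<exists>h0 h1. H = [:h0:] + Polynomial.smult (int p ^ 2) h1)) \<and>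
    (\<forall>a\<le>A. pdv (int k) (of_int m * (unit_part 0 0 a * unit_part 0 0 (A - a)) - of_int (poly H (ybal 1 1 A a)))) \<and>
    pdv (int k) (of_int m * (\<Sum>a\<le>A. altterm 0 0 N ?X (p * a + 0)) -
      (- 1) ^ 0 * of_nat p powi (int 1 + int 1 - 1 - int A) * altsum 1 1 A (pcompose ?X [:0, int p:] * H))"
    by (rule class_sum_approx[where r = 0 and r' = 0 and s = 0 and s' = 0 and B = A and t = 1 and t' = 1 and ?x0.0 = 0])
      (use odds t in \<open>simp_all add: N_def\<close>)
  then obtain m1 H1 where m1: "\<not> int p dvd m1" and H1: "cpoly H1"
    and H1v: "\<And>a. a \<le> A \<Longrightarrow> pdv (int k) (of_int m1 * (unit_part 0 0 a * unit_part 0 0 (A - a)) - of_int (poly H1 (ybal 1 1 A a)))"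
    and Z0: "pdv (int k) (of_int m1 * (\<Sum>a\<le>A. altterm 0 0 N ?X (p * a + 0)) -
      (- 1) ^ 0 * of_nat p powi (int 1 + int 1 - 1 - int A) * altsum 1 1 A (pcompose ?X [:0, int p:] * H1))"
    by blast
  have Z: "pdv (int k) (of_int m1 * Z - of_nat p powi (1 - int A) * altsum 1 1 A (pcompose ?X [:0, int p:] * H1))"
    using Z0 by (simp add: Z_def)
  define F1 where "F1 = pcompose ?X [:0, int p:] * H1"
  have F1: "F1 = Polynomial.smult (int p) (?X * H1)"
    by (simp add: F1_def pcompose_pCons)
  define Z' where "Z' = (\<Sum>a\<le>M. altterm 1 1 A F1 (p * a))"
  have "\<exists>m H. \<not> int p dvd m \<and> cpoly H \<and> ((1::nat) = 1 \<and> (0::nat) = 0 \<longrightarrow> (\<exists>h0 h1. H = [:h0:] + Polynomial.smult (int p ^ 2) h1)) \<and>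
    (\<forall>a\<le>M. pdv (int k) (of_int m * (unit_part 1 0 a * unit_part 1 0 (M - a)) - of_int (poly H (ybal 0 0 M a)))) \<and>
    pdv (int k) (of_int m * (\<Sum>a\<le>M. altterm 1 1 A F1 (p * a + 0)) -
      (- 1) ^ 0 * of_nat p powi (int 0 + int 0 - 1 - int M) * altsum 0 0 M (pcompose F1 [:0, int p:] * H))"
    by (rule class_sum_approx[where r = 0 and r' = 0 and s = 1 and s' = 1 and B = M and t = 0 and t' = 0 and ?x0.0 = 0])
      (use odds t in \<open>simp_all add: A_def\<close>)
  then obtain m2 H2 h0 h1 where m2: "\<not> int p dvd m2" and H2: "H2 = [:h0:] + Polynomial.smult (int p ^ 2) h1"
    and H2v: "\<And>a. a \<le> M \<Longrightarrow> pdv (int k) (of_int m2 * (unit_part 1 0 a * unit_part 1 0 (M - a)) - of_int (poly H2 (ybal 0 0 M a)))"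
    and Z0': "pdv (int k) (of_int m2 * (\<Sum>a\<le>M. altterm 1 1 A F1 (p * a + 0)) -
      (- 1) ^ 0 * of_nat p powi (int 0 + int 0 - 1 - int M) * altsum 0 0 M (pcompose F1 [:0, int p:] * H2))"
    by blast
  have Z': "pdv (int k) (of_int m2 * Z' - of_nat p powi (- 1 - int M) * altsum 0 0 M (pcompose F1 [:0, int p:] * H2))"
    using Z0' by (simp add: Z'_def)
  obtain e0 E where E: "pcompose H1 [:0, int p:] * H2 = pCons e0 (Polynomial.smult (int p ^ 2) E)"
    using cpoly_scaled[OF H1 H2] by blast
  obtain d E' where E': "E = pCons d E'" by (cases E)

  define B0 where "B0 = fact M * altsum 0 0 M (X3 E')"
  have B0: "pdv (2 * int v - 1) B0"
    unfolding B0_def by (rule moment_boundsD(2)[OF moment_bounds_hold[OF M]])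
  have last: "fact M * altsum 0 0 M (pcompose F1 [:0, int p:] * H2) = of_nat p ^ 2 * (of_int e0 * wsum M + of_nat p ^ 2 * B0)"
  proof -
    have x3: "X3 (Polynomial.smult (int p ^ 2) E') = Polynomial.smult (int p ^ 2) (X3 E')"
      by simp
    have "pcompose F1 [:0, int p:] * H2 = Polynomial.smult (int p ^ 2) (?X * (pcompose H1 [:0, int p:] * H2))"
      unfolding F1 by (simp add: pcompose_smult pcompose_mult pcompose_pCons power2_eq_square)
    also have "?X * (pcompose H1 [:0, int p:] * H2) = pCons 0 (pCons e0 (pCons (int p ^ 2 * d) (Polynomial.smult (int p ^ 2) E')))"
      unfolding E E' by simp
    finally have "altsum 0 0 M (pcompose F1 [:0, int p:] * H2)
        = of_int (int p ^ 2) * (of_int e0 * altsum 0 0 M ?X + of_int (int p ^ 2) * altsum 0 0 M (X3 E'))"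
      by (simp only: altsum_smult altsum_decomp[OF M(1), of 0 0 e0 "int p ^ 2 * d" "Polynomial.smult (int p ^ 2) E'"] x3)
    then show ?thesis
      by (simp add: wsum_def B0_def algebra_simps)
  qed

  define P where "P = fact N * (\<Sum>r\<in>{1..<p}. \<Sum>a\<le>A - 1. altterm 0 0 N ?X (p * a + r))"
  define P' where "P' = fact A * (\<Sum>r\<in>{1..<p}. \<Sum>a\<le>M - 1. altterm 1 1 A F1 (p * a + r))"
  have wN: "wsum N = fact N * Z + P"
    unfolding wsum_def P_def Z_def N_def altsum_split_classes[OF pos(1)] distrib_left ..
  have aA: "fact A * altsum 1 1 A F1 = fact A * Z' + P'"
    unfolding P'_def Z'_def A_def altsum_split_classes[OF pos(2)] distrib_left ..
  have P: "pdv (2 * int v + 3) P"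
    using nonzero_classes_bound[OF A moment_bounds_hold[OF A], of 0 ?X] unfolding P_def N_def by (simp add: algebra_simps)
  have P': "pdv (2 * int v + 2) P'"
  proof -
    have "P' = of_int (int p ^ 1) * (fact A * (\<Sum>r\<in>{1..<p}. \<Sum>a\<le>M - 1. altterm 1 1 A (?X * H1) (p * a + r)))"
      unfolding P'_def F1 altterm_def by (simp add: sum_distrib_left mult_ac)
    then show ?thesis
      using pdv_p_mult[OF nonzero_classes_bound[OF M moment_bounds_hold[OF M], of 1 "?X * H1"], of 1] unfolding A_def by (simp add: add.commute)
  qed
  have fN: "fact N = of_nat p ^ A * fact A * (of_int (pfact N) :: rat)"
    using fact_pfact_rat[of N] by (simp add: divs)
  have fA: "fact A = of_nat p ^ M * fact M * (of_int (pfact A) :: rat)"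
    using fact_pfact_rat[of A] by (simp add: divs)
  have pw: "of_nat p ^ A * of_nat p powi (1 - int A) = (of_nat p :: rat)"
    "of_nat p ^ M * of_nat p powi (- 1 - int M) = (1 / of_nat p :: rat)"
  proof -
    have "of_nat p ^ A * of_nat p powi (1 - int A) = (of_nat p powi (int A + (1 - int A)) :: rat)"
      by (subst power_int_add) simp_all
    then show "of_nat p ^ A * of_nat p powi (1 - int A) = (of_nat p :: rat)" by simp
    have "of_nat p ^ M * of_nat p powi (- 1 - int M) = (of_nat p powi (int M + (- 1 - int M)) :: rat)"
      by (subst power_int_add) simp_all
    then show "of_nat p ^ M * of_nat p powi (- 1 - int M) = (1 / of_nat p :: rat)"
      by (simp add: power_int_minus inverse_eq_divide)
  qed
  let ?f = "of_int (pfact N) :: rat" and ?f' = "of_int (pfact A) :: rat"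
  let ?u = "of_int m1 :: rat" and ?u' = "of_int m2 :: rat" and ?p = "of_nat p :: rat"
  have s1: "pdv (int k) (?u * (fact N * Z) - ?p * ?f * (fact A * altsum 1 1 A F1))"
  proof -
    have "pdv (0 + int k) (fact N * (?u * Z - ?p powi (1 - int A) * altsum 1 1 A F1))"
      using Z pdv_of_nat[of "fact N"] unfolding F1_def by (intro pdv_mult) simp_all
    also have "fact N * (?u * Z - ?p powi (1 - int A) * altsum 1 1 A F1) = ?u * (fact N * Z) - (?p ^ A * ?p powi (1 - int A)) * ?f * (fact A * altsum 1 1 A F1)"
      by (subst (2) fN) (simp add: right_diff_distrib mult_ac fN)
    finally show ?thesis unfolding pw by simp
  qed
  \<comment> \<open>The inner step from shift 1 to shift 0 produces 1/p, which the factor p of the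
    outer step clears.\<close>
  have s2: "pdv (int k) (?p * (?u' * (fact A * Z')) - ?f' * (fact M * altsum 0 0 M (pcompose F1 [:0, int p:] * H2)))"
  proof -
    have "pdv (0 + int k) (?p * fact A * (?u' * Z' - ?p powi (- 1 - int M) * altsum 0 0 M (pcompose F1 [:0, int p:] * H2)))"
      using Z' pdv_of_nat[of "p * fact A"] by (intro pdv_mult) simp_all
    also have "?p * fact A * (?u' * Z' - ?p powi (- 1 - int M) * altsum 0 0 M (pcompose F1 [:0, int p:] * H2))
       = ?p * (?u' * (fact A * Z')) - ?p * (?p ^ M * ?p powi (- 1 - int M)) * ?f' * (fact M * altsum 0 0 M (pcompose F1 [:0, int p:] * H2))"
      by (simp add: right_diff_distrib mult_ac fA)
    finally show ?thesis unfolding pw using p_gt_2 by simp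
  qed
  \<comment> \<open>At a = 0 the first unit of each pair is an empty product, so \<open>H1\<close>
    at A and \<open>H2\<close> at M are known up to the multipliers \<open>m1\<close> and
    \<open>m2\<close>. Their product differs from \<open>e0\<close> by a multiple of p^2 M.\<close>
  have e0: "pdv (int v + 2) (of_int e0 - ?u * ?u' * (unit_part 0 0 A * unit_part 1 0 M))"
  proof -
    have psi0: "unit_part 0 0 0 = 1" "unit_part 1 0 0 = 1" by (simp_all add: unit_part_def qfac_unit_def)
    let ?h1 = "of_int (poly H1 (int A)) :: rat" and ?h2 = "of_int (poly H2 (int M)) :: rat"
    have 1: "pdv (int k) (?u * unit_part 0 0 A - ?h1)"
      using H1v[of 0] psi0 by (simp add: ybal_def)
    have 2: "pdv (int k) (?u' * unit_part 1 0 M - ?h2)"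
      using H2v[of 0] psi0 by (simp add: ybal_def)
    have "pdv (int k + 0) ((?u * unit_part 0 0 A - ?h1) * (?u' * unit_part 1 0 M))"
      by (rule pdv_mult[OF 1 pdv_int_mult[OF pdv_unit_part]])
    moreover have "pdv (0 + int k) (?h1 * (?u' * unit_part 1 0 M - ?h2))"
      by (rule pdv_mult[OF pdv_of_int 2])
    ultimately have "pdv (int k) ((?u * unit_part 0 0 A - ?h1) * (?u' * unit_part 1 0 M) + ?h1 * (?u' * unit_part 1 0 M - ?h2))"
      by (intro pdv_add) simp_all
    then have "pdv (int k) (?u * ?u' * (unit_part 0 0 A * unit_part 1 0 M) - ?h1 * ?h2)"
      by (simp add: algebra_simps)
    then have a: "pdv (int v + 2) (?u * ?u' * (unit_part 0 0 A * unit_part 1 0 M) - ?h1 * ?h2)"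
      by (rule pdv_mono) (simp add: k)
    have "poly (pcompose H1 [:0, int p:] * H2) (int M) = poly H1 (int A) * poly H2 (int M)"
      by (simp add: poly_pcompose A_def mult.commute)
    then have "poly H1 (int A) * poly H2 (int M) = e0 + int p ^ 2 * (int M * poly E (int M))"
      unfolding E by (simp add: algebra_simps)
    then have hh: "?h1 * ?h2 = of_int (e0 + int p ^ 2 * (int M * poly E (int M)))"
      by (metis of_int_mult)
    have "int p ^ v dvd int M" using M(2) by (metis of_nat_dvd_iff of_nat_power)
    then have "int p ^ (v + 2) dvd int p ^ 2 * (int M * poly E (int M))"
      unfolding add.commute[of v] power_add by (intro mult_dvd_mono dvd_mult2) simp_all
    then have "pdv (int (v + 2)) (of_int (int p ^ 2 * (int M * poly E (int M))))"
      by (simp only: pdv_of_int_iff)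
    then have b: "pdv (int v + 2) (?h1 * ?h2 - of_int e0)"
      unfolding hh by (simp add: add.commute)
    have "pdv (int v + 2) (- ((?u * ?u' * (unit_part 0 0 A * unit_part 1 0 M) - ?h1 * ?h2) + (?h1 * ?h2 - of_int e0)))"
      using a b by (intro pdv_minus pdv_add)
    then show ?thesis by simp
  qed
  have wM: "pdv (int v) (wsum M)"
    unfolding wsum_def by (rule moment_boundsD(1)[OF moment_bounds_hold[OF M]])
  let ?Psi = "unit_part 0 0 A * unit_part 1 0 M"
  let ?g = "2 * int v + 3"
  have "pdv ?g (?u * ?u' * wsum N - ?p ^ 2 * ?f * ?f' * (?u * ?u' * ?Psi) * wsum M)"
  proof -
    \<comment> \<open>The ingredients are replaced one at a time, so the total error is an exact sum
      of six terms that are estimated separately.\<close>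
    define d1 where "d1 = ?u * (fact N * Z) - ?p * ?f * (fact A * altsum 1 1 A F1)"
    define d2 where "d2 = ?p * (?u' * (fact A * Z')) - ?f' * (fact M * altsum 0 0 M (pcompose F1 [:0, int p:] * H2))"
    define d3 where "d3 = of_int e0 - ?u * ?u' * ?Psi"
    have "?u * ?u' * wsum N - ?p ^ 2 * ?f * ?f' * (?u * ?u' * ?Psi) * wsum M
      = of_int (m1 * m2) * P + of_int m2 * d1 + of_int (m2 * pfact N) * (?p * P') + of_int (pfact N) * d2
        + of_int (pfact N * pfact A) * (?p ^ 2 * (d3 * wsum M)) + of_int (pfact N * pfact A) * (?p ^ 4 * B0)"
      unfolding wN d1_def d2_def d3_def last aA of_int_mult by (simp add: algebra_simps power2_eq_square power4_eq_xxxx)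
    moreover have "pdv ?g (of_int (m1 * m2) * P)" by (intro pdv_int_mult P)
    moreover have "pdv ?g (of_int m2 * d1)" using s1 unfolding k d1_def by (rule pdv_int_mult)
    moreover have "pdv ?g (of_int (m2 * pfact N) * (?p * P'))"
      using pdv_power_mult[OF P', of 1] by (intro pdv_int_mult) (simp add: add.commute)
    moreover have "pdv ?g (of_int (pfact N) * d2)" using s2 unfolding k d2_def by (rule pdv_int_mult)
    moreover have "pdv ?g (of_int (pfact N * pfact A) * (?p ^ 2 * (d3 * wsum M)))"
    proof (rule pdv_int_mult)
      have "pdv (int 2 + ((int v + 2) + int v)) (?p ^ 2 * (d3 * wsum M))"
        using e0 wM unfolding d3_def by (intro pdv_power_mult pdv_mult)
      then show "pdv ?g (?p ^ 2 * (d3 * wsum M))" by (rule pdv_mono) simp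
    qed
    moreover have "pdv ?g (of_int (pfact N * pfact A) * (?p ^ 4 * B0))"
      using pdv_power_mult[OF B0, of 4] by (intro pdv_int_mult) (simp add: add.commute)
    ultimately show ?thesis by (simp only: pdv_add)
  qed
  also have "?u * ?u' * wsum N - ?p ^ 2 * ?f * ?f' * (?u * ?u' * ?Psi) * wsum M = of_int (m1 * m2) * (wsum N - ?p ^ 2 * (?f * ?f' * ?Psi) * wsum M)"
    by (simp add: algebra_simps)
  finally have "pdv ?g (wsum N - ?p ^ 2 * (?f * ?f' * ?Psi) * wsum M)"
    by (simp only: pdv_unit_mult_iff[OF p_not_dvd_mult[OF m1 m2]])
  moreover have "?f * ?f' * ?Psi = of_int ((qfac_unit (p * (p * M)) * qfac_unit (p * M + 1)) ^ 2) / of_int (pfact (p * (p * M)) * pfact (p * M))"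
  proof -
    have "?f \<noteq> 0" "?f' \<noteq> 0" using p_not_dvd_pfact not_dvd_nonzero by auto
    then show ?thesis
      by (simp add: unit_part_def N_def A_def power_divide power_mult_distrib power2_eq_square)
  qed
  ultimately show ?thesis by (simp add: N_def A_def)
qed

text \<open>The unit is 1 only modulo p^(v+1); the missing v + 2 come from \<open>wsum M\<close> and
  the factor p^2.\<close>

lemma wsum_cong:
  assumes M: "odd M" "p ^ v dvd M"
  shows "pdv (2 * int v + 3) (wsum (p * (p * M)) - of_nat p ^ 2 * wsum M)"
proof -
  let ?c = "of_int ((qfac_unit (p * (p * M)) * qfac_unit (p * M + 1)) ^ 2) / of_int (pfact (p * (p * M)) * pfact (p * M)) :: rat"
  have "pdv (int (v + 1)) (?c - 1)"
    by (rule pdv_cong_1[OF qfac_unit_pair_cong[OF M] pfact_pair_cong[OF M(2)]]) simp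
  moreover have "pdv (int v) (wsum M)"
    unfolding wsum_def by (rule moment_boundsD(1)[OF moment_bounds_hold[OF M]])
  ultimately have "pdv (int 2 + (int (v + 1) + int v)) (of_nat p ^ 2 * ((?c - 1) * wsum M))"
    by (intro pdv_power_mult pdv_mult)
  then have "pdv (2 * int v + 3) (of_nat p ^ 2 * ((?c - 1) * wsum M))"
    by (rule pdv_mono) simp
  from pdv_add[OF wsum_scaled[OF M] this] show ?thesis
    by (simp add: algebra_simps)
qed

text \<open>Returning to \<open>G\<close> replaces 2^(p^2 M) by 2^M. The exponents differ by (p -
  1)(p + 1) M, so these agree modulo p^(v+1), and \<open>wsum M\<close> and p^2 again supply the
  rest.\<close>

lemma G_supercongruence:
  assumes M: "odd M" "p ^ v dvd M"
  shows "int p ^ (2 * v + 3) dvd G ((p ^ 2 * M - 1) div 2) - int p ^ 2 * G ((M - 1) div 2)"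
proof -
  let ?N = "p * (p * M)"
  have N: "odd ?N" "p ^ 2 * M = ?N" using M(1) p_odd by (simp_all add: power2_eq_square)
  let ?D = "G ((?N - 1) div 2) - int p ^ 2 * G ((M - 1) div 2)"
  have "\<not> int p dvd 2" using p_not_dvd_4 by (metis dvd_trans dvd_triv_left mult_2 numeral_Bit0)
  have "[(2::int) ^ ?N = 2 ^ M] (mod int p ^ (v + 1))"
  proof -
    have "?N = (p - 1) * (M * (p + 1)) + M"
      using p_gt_2 by (cases p) (simp_all add: algebra_simps)
    moreover have "[(2::int) ^ ((p - 1) * (M * (p + 1))) * 2 ^ M = 1 * 2 ^ M] (mod int p ^ (v + 1))"
      using M(2) \<open>\<not> int p dvd 2\<close> by (intro cong_mult power_cong_1 cong_refl) auto
    ultimately show ?thesis by (simp add: power_add)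
  qed
  then have two: "pdv (int (v + 1)) (of_int (2 ^ ?N - 2 ^ M))"
    by (simp only: pdv_of_int_iff cong_iff_dvd_diff)
  have "pdv (int v) (wsum M)"
    unfolding wsum_def by (rule moment_boundsD(1)[OF moment_bounds_hold[OF M]])
  with two have "pdv (int 2 + (int (v + 1) + int v)) (of_nat p ^ 2 * (of_int (2 ^ ?N - 2 ^ M) * wsum M))"
    by (intro pdv_power_mult pdv_mult)
  then have 1: "pdv (2 * int v + 3) (of_nat p ^ 2 * (of_int (2 ^ ?N - 2 ^ M) * wsum M))"
    by (rule pdv_mono) simp
  have 2: "pdv (2 * int v + 3) (of_int (2 ^ ?N) * (wsum ?N - of_nat p ^ 2 * wsum M))"
    by (intro pdv_int_mult wsum_cong M)
  have "of_int 4 * of_int ?D = 4 * rat_of_int (G ((?N - 1) div 2)) - of_nat p ^ 2 * (4 * rat_of_int (G ((M - 1) div 2)))"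
    by simp
  also have "\<dots> = of_int (2 ^ ?N) * (wsum ?N - of_nat p ^ 2 * wsum M) + of_nat p ^ 2 * (of_int (2 ^ ?N - 2 ^ M) * wsum M)"
    unfolding G_wsum[OF N(1)] G_wsum[OF M(1)] by (simp add: algebra_simps)
  finally have "pdv (2 * int v + 3) (of_int 4 * of_int ?D)"
    using pdv_add[OF 2 1] by simp
  then have "pdv (int (2 * v + 3)) (of_int ?D)"
    by (simp only: pdv_unit_mult_iff[OF p_not_dvd_4]) simp
  then show ?thesis unfolding N(2) by (simp only: pdv_of_int_iff)
qed

end

theorem theorem1p1:
  fixes p :: nat
  assumes "prime p" and "[p = 3] (mod 4)"
  shows "(\<forall>m r :: nat. m > 0 \<and> odd m \<and> r \<ge> 2 \<longrightarrow>
            [G ((m * p ^ r - 1) div 2) = int p ^ 2 * G ((m * p ^ (r - 2) - 1) div 2)]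
              (mod int p ^ (2 * r - 1)))
       \<and> (\<forall>M :: nat. M > 0 \<and> odd M \<longrightarrow>
            padic_of_int p (G ((p ^ 2 * M - 1) div 2) - int p ^ 2 * G ((M - 1) div 2))
              \<in> PIdl\<^bsub>padic_int p\<^esub> (padic_of_int p (int p ^ (2 * multiplicity p M + 3))))"
proof -
  interpret prime3 p
    using assms by unfold_locales (simp_all add: cong_def)
  show ?thesis
  proof (intro conjI allI impI)
    fix m r :: nat assume mr: "m > 0 \<and> odd m \<and> r \<ge> 2"
    \<comment> \<open>Here p may divide m as well; the divisor \<open>p ^ (r - 2)\<close> of
      \<open>?M\<close> already gives the exponent 2 (r - 2) + 3 = 2r - 1.\<close>
    let ?M = "m * p ^ (r - 2)"
    have "p ^ r = p ^ 2 * p ^ (r - 2)"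
      using mr by (metis le_add_diff_inverse power_add)
    then have "m * p ^ r = p ^ 2 * ?M" by (simp add: mult_ac)
    moreover have "2 * r - 1 = 2 * (r - 2) + 3" using mr by presburger
    moreover have "odd ?M" "p ^ (r - 2) dvd ?M" using mr p_odd by simp_all
    ultimately show "[G ((m * p ^ r - 1) div 2) = int p ^ 2 * G ((?M - 1) div 2)] (mod int p ^ (2 * r - 1))"
      unfolding cong_iff_dvd_diff using G_supercongruence[of ?M "r - 2"] by metis
  next
    fix M :: nat assume "M > 0 \<and> odd M"
    then show "padic_of_int p (G ((p ^ 2 * M - 1) div 2) - int p ^ 2 * G ((M - 1) div 2))
        \<in> PIdl\<^bsub>padic_int p\<^esub> (padic_of_int p (int p ^ (2 * multiplicity p M + 3)))"
      unfolding padic_of_int_mem_power_ideal_iff[OF p_pos]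
      by (intro G_supercongruence multiplicity_dvd) simp
  qed
qed

end
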